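(* Let $n\ge1$, let $\boldsymbol x=\{x_1,\dots,x_{2n}\}$ be distinct real points and let $\alpha$ be a non-crossing link pattern of $\boldsymbol x$. Then each individual curve in the multiple $\mathrm{SLE}(0;\boldsymbol x;\alpha)$ ensemble, grown from one of its endpoints $x_j$, is the curve generated by an $\mathrm{SLE}(0,x_j,\boldsymbol\rho)$ Loewner chain for some finite atomic signed measure $\boldsymbol\rho$ on $\widehat{\mathbb C}$, symmetric under conjugation, with total mass $\int\boldsymbol\rho=\boldsymbol\rho(\widehat{\mathbb C})=-6$.
   Context: $\mathbb H$ is the upper half-plane, $\widehat{\mathbb C}$ the Riemann sphere, $\widehat{\mathbb R}=\mathbb R\cup\{\infty\}$. For distinct real $\boldsymbol x$, $\mathrm{CRR}_{n+1}(\boldsymbol x)$ is the set of real rational functions of degree $n+1$ whose critical points are precisely $\boldsymbol x$, and $\Gamma(R)=\{z\in\widehat{\mathbb C}:R(z)\in\widehat{\mathbb R}\}$. For $R\in\mathrm{CRR}_{n+1}(\boldsymbol x)$, $\Gamma(R)$ consists of the real line, $n$ pairwise disjoint simple curves in $\mathbb H$ connecting the points of $\boldsymbol x$ in pairs according to a non-crossing link pattern, and their complex conjugates. For each link pattern $\alpha$ (a non-crossing pairing of $\boldsymbol x$) it is known that there is $R\in\mathrm{CRR}_{n+1}(\boldsymbol x)$ whose real locus has link pattern $\alpha$, unique up to post-composition by real Möbius transformations; the multiple $\mathrm{SLE}(0;\boldsymbol x;\alpha)$ ensemble is the collection of the $n$ curves of $\Gamma(R)$ in $\mathbb H$ for such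 $R$. $\mathrm{SLE}(0,x,\boldsymbol\rho)$, for $x\in\mathbb R$ and a finite atomic signed measure $\boldsymbol\rho$ on $\widehat{\mathbb C}$ symmetric under conjugation, is the Loewner chain $\partial_tg_t(z)=\frac{2}{g_t(z)-x_t}$, $g_0(z)=z$, with driving function $\dot x_t=\int_{\mathbb C}\frac{d\boldsymbol\rho(w)}{x_t-g_t(w)}$, $x_0=x$ (a charge at $\infty$ does not enter the integral but counts in the total mass), run until the first time $x_t=g_t(w)$ for some $w\in\mathrm{supp}\,\boldsymbol\rho$. *)

theory Defs
  imports "HOL-Analysis.Analysis" "HOL-Computational_Algebra.Polynomial"
begin

section \<open>Riemann sphere and rational maps\<close>

text \<open>The Riemann sphere is \<open>complex option\<close>, with \<open>None\<close> as the point at infinity.\<close>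

type_synonym chat = "complex option"

definition real_hat :: "chat set" where
  "real_hat = insert None (range (\<lambda>r::real. Some (complex_of_real r)))"

definition sphere_cnj :: "chat \<Rightarrow> chat" where
  "sphere_cnj = map_option cnj"

definition sphere_inverse :: "chat \<Rightarrow> chat" where
  "sphere_inverse a =
     (case a of None \<Rightarrow> Some 0 | Some z \<Rightarrow> if z = 0 then None else Some (inverse z))"

text \<open>The map \<open>p / q\<close> of the sphere, meant for coprime \<open>p\<close> and \<open>q\<close>. For
  \<open>degree p < degree q\<close> the coefficient of \<open>p\<close> used at infinity is zero.\<close>

definition rat_map :: "real poly \<Rightarrow> real poly \<Rightarrow> chat \<Rightarrow> chat" where
  "rat_map p q a =
     (case a of
        Some z \<Rightarrow>
          (let P = poly (map_poly complex_of_real p) z; Q = poly (map_poly complex_of_real q) z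
           in if Q = 0 then None else Some (P / Q))
      | None \<Rightarrow>
          (if degree p > degree q then None
           else Some (complex_of_real (coeff p (degree q) / lead_coeff q))))"

definition real_rational :: "nat \<Rightarrow> (chat \<Rightarrow> chat) \<Rightarrow> bool" where
  "real_rational d R \<longleftrightarrow>
     (\<exists>p q. q \<noteq> 0 \<and> coprime p q \<and> max (degree p) (degree q) = d \<and> R = rat_map p q)"

text \<open>Critical points on the sphere: the derivative vanishes, in the chart \<open>1 / w\<close> of the target
  at poles and in the chart \<open>1 / z\<close> of the source at infinity.\<close>

definition critical_at :: "(chat \<Rightarrow> chat) \<Rightarrow> complex \<Rightarrow> bool" where
  "critical_at R z \<longleftrightarrow>
     (if R (Some z) \<noteq> None
      then ((\<lambda>u. the (R (Some u))) has_field_derivative 0) (at z)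
      else ((\<lambda>u. the (sphere_inverse (R (Some u)))) has_field_derivative 0) (at z))"

definition critical_point :: "(chat \<Rightarrow> chat) \<Rightarrow> chat \<Rightarrow> bool" where
  "critical_point R a =
     (case a of Some z \<Rightarrow> critical_at R z | None \<Rightarrow> critical_at (R \<circ> sphere_inverse) 0)"

definition CRR :: "nat \<Rightarrow> real set \<Rightarrow> (chat \<Rightarrow> chat) set" where
  "CRR d x = {R. real_rational d R \<and>
                 {a. critical_point R a} = (\<lambda>r. Some (complex_of_real r)) ` x}"

definition real_locus :: "(chat \<Rightarrow> chat) \<Rightarrow> chat set" where
  "real_locus R = {a. R a \<in> real_hat}"


section \<open>Link patterns and the multiple SLE(0) ensemble\<close>

definition link_pattern :: "real set \<Rightarrow> real set set \<Rightarrow> bool" where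
  "link_pattern x \<alpha> \<longleftrightarrow>
     \<Union>\<alpha> = x \<and> pairwise disjnt \<alpha> \<and> (\<forall>L\<in>\<alpha>. card L = 2) \<and>
     \<not> (\<exists>a b c d. a < b \<and> b < c \<and> c < d \<and> {a, c} \<in> \<alpha> \<and> {b, d} \<in> \<alpha>)"

text \<open>\<open>\<eta> L\<close> parametrizes, in one of the two orientations, the curve of the real locus that joins
  the two points of the link \<open>L\<close> through the upper half-plane.\<close>

definition real_locus_curves ::
    "(chat \<Rightarrow> chat) \<Rightarrow> real set set \<Rightarrow> (real set \<Rightarrow> real \<Rightarrow> complex) \<Rightarrow> bool" where
  "real_locus_curves R \<alpha> \<eta> \<longleftrightarrow>
     (\<forall>L\<in>\<alpha>. arc (\<eta> L) \<and>
             {pathstart (\<eta> L), pathfinish (\<eta> L)} = complex_of_real ` L \<and>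
             (\<forall>s\<in>{0<..<1}. Im (\<eta> L s) > 0)) \<and>
     pairwise (\<lambda>L M. disjnt (path_image (\<eta> L)) (path_image (\<eta> M))) \<alpha> \<and>
     real_locus R = real_hat \<union> (\<Union>L\<in>\<alpha>. Some ` path_image (\<eta> L))
                             \<union> (\<Union>L\<in>\<alpha>. Some ` cnj ` path_image (\<eta> L))"

text \<open>The set \<open>C\<close> of curves is the multiple SLE(0) ensemble of \<open>x\<close> and \<open>\<alpha>\<close>. A curve is identified
  with its trace, including the two real endpoints.\<close>

definition multiple_SLE0 :: "nat \<Rightarrow> real set \<Rightarrow> real set set \<Rightarrow> complex set set \<Rightarrow> bool" where
  "multiple_SLE0 n x \<alpha> C \<longleftrightarrow>
     (\<exists>R \<in> CRR (n + 1) x. \<exists>\<eta>. real_locus_curves R \<alpha> \<eta> \<and> C = (\<lambda>L. path_image (\<eta> L)) ` \<alpha>)"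


section \<open>Loewner chains\<close>

text \<open>\<open>u\<close> solves the Loewner equation driven by \<open>X\<close> with initial value \<open>z\<close> on the closed interval
  from \<open>0\<close> to \<open>t\<close>; such a \<open>u\<close> exists iff \<open>z\<close> is swallowed strictly after \<open>t\<close>. The point \<open>z\<close> may
  also be real or lie in the lower half-plane.\<close>

definition loewner_solution :: "(real \<Rightarrow> real) \<Rightarrow> complex \<Rightarrow> real \<Rightarrow> (real \<Rightarrow> complex) \<Rightarrow> bool" where
  "loewner_solution X z t u \<longleftrightarrow>
     u 0 = z \<and>
     (\<forall>s\<in>{0..t}. u s \<noteq> complex_of_real (X s) \<and>
        (u has_vector_derivative 2 / (u s - complex_of_real (X s))) (at s within {0..t}))"

definition loewner_alive :: "(real \<Rightarrow> real) \<Rightarrow> real \<Rightarrow> complex \<Rightarrow> bool" where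
  "loewner_alive X t z \<longleftrightarrow> (\<exists>u. loewner_solution X z t u)"

text \<open>The value \<open>g\<^sub>t(z)\<close>, meaningful when \<open>loewner_alive X t z\<close>.\<close>

definition loewner_map :: "(real \<Rightarrow> real) \<Rightarrow> real \<Rightarrow> complex \<Rightarrow> complex" where
  "loewner_map X t z = (THE w. \<exists>u. loewner_solution X z t u \<and> w = u t)"

definition loewner_hull :: "(real \<Rightarrow> real) \<Rightarrow> real \<Rightarrow> complex set" where
  "loewner_hull X t = {z. Im z > 0 \<and> \<not> loewner_alive X t z}"

definition times_before :: "ereal \<Rightarrow> real set" where
  "times_before T = {t. 0 \<le> t \<and> ereal t < T}"

text \<open>A finite atomic signed measure on the sphere is given by the masses of its atoms.\<close>

definition finite_atomic :: "(chat \<Rightarrow> real) \<Rightarrow> bool" where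
  "finite_atomic \<rho> \<longleftrightarrow> finite {a. \<rho> a \<noteq> 0}"

definition cnj_symmetric :: "(chat \<Rightarrow> real) \<Rightarrow> bool" where
  "cnj_symmetric \<rho> \<longleftrightarrow> (\<forall>a. \<rho> (sphere_cnj a) = \<rho> a)"

definition total_mass :: "(chat \<Rightarrow> real) \<Rightarrow> real" where
  "total_mass \<rho> = (\<Sum>a | \<rho> a \<noteq> 0. \<rho> a)"

text \<open>\<open>X\<close> is the driving function of SLE(0, \<open>x\<close>, \<open>\<rho>\<close>), run on \<open>[0, T)\<close>. The last clause makes \<open>T\<close>
  the first time at which \<open>X\<close> meets the image of a finite atom; as the Loewner equation is singular
  there, the collision is expressed by left limits.\<close>

definition SLE0_chain :: "real \<Rightarrow> (chat \<Rightarrow> real) \<Rightarrow> ereal \<Rightarrow> (real \<Rightarrow> real) \<Rightarrow> bool" where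
  "SLE0_chain x \<rho> T X \<longleftrightarrow>
     0 < T \<and> X 0 = x \<and>
     (\<forall>t\<in>times_before T.
        (\<forall>w. \<rho> (Some w) \<noteq> 0 \<longrightarrow> loewner_alive X t w) \<and>
        ((\<lambda>s. complex_of_real (X s)) has_vector_derivative
           (\<Sum>w | \<rho> (Some w) \<noteq> 0.
              complex_of_real (\<rho> (Some w)) / (complex_of_real (X t) - loewner_map X t w)))
          (at t within {0..})) \<and>
     (\<forall>\<tau>. T = ereal \<tau> \<longrightarrow>
        (\<exists>w l. \<rho> (Some w) \<noteq> 0 \<and> (X \<longlongrightarrow> l) (at_left \<tau>) \<and>
               ((\<lambda>t. loewner_map X t w) \<longlongrightarrow> complex_of_real l) (at_left \<tau>)))"

text \<open>\<open>\<gamma>\<close> is the simple curve generated by the chain: it starts at \<open>X 0\<close>, stays in the upper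
  half-plane afterwards, and \<open>\<gamma> ((0, t])\<close> is the hull at time \<open>t\<close>.\<close>

definition generates_curve :: "ereal \<Rightarrow> (real \<Rightarrow> real) \<Rightarrow> (real \<Rightarrow> complex) \<Rightarrow> bool" where
  "generates_curve T X \<gamma> \<longleftrightarrow>
     continuous_on (times_before T) \<gamma> \<and> inj_on \<gamma> (times_before T) \<and>
     \<gamma> 0 = complex_of_real (X 0) \<and>
     (\<forall>t\<in>times_before T. loewner_hull X t = \<gamma> ` {0<..t})"

end

theory Submission
  imports Defs "HOL-Complex_Analysis.Complex_Analysis"
    "HOL-Computational_Algebra.Fundamental_Theorem_Algebra"
begin

text \<open>Let \<open>R = P / Q\<close>. The atoms are the critical points other than
  \<open>x\<^sub>j\<close>, with charge \<open>2\<close>, and the preimages of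
  \<open>\<plusminus>\<i>\<close> under \<open>R\<close>, that is, the zeros of \<open>P
  \<plusminus> \<i> Q\<close>, with charge \<open>-2\<close>. Let \<open>B = (P + \<i> Q) / (P -
  \<i> Q)\<close>, which has modulus \<open>1\<close> exactly on the real locus, and let
  \<open>B\<^sub>t\<close> be the quotient whose zeros and poles are the images under
  \<open>g\<^sub>t\<close> of those of \<open>B\<close>. The Loewner equation and the prescribed
  drift of the driving function keep the critical points of \<open>B\<^sub>t\<close> at the driving
  function \<open>X\<^sub>t\<close> and at the images of the other critical points, and from this
  \<open>B\<^sub>t \<circ> g\<^sub>t = B\<close> follows. On the trace, \<open>g\<^sub>t\<close>
  tends to the real point \<open>X\<^sub>t\<close>, so that \<open>\<bar>B\<bar> = 1\<close>: the
  trace stays in the real locus and follows the curve that starts at \<open>x\<^sub>j\<close>. The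
  Schwarz lemma bounds the lifetime and the driving function, a normal family argument excludes a
  collision before the curve is exhausted, and then the conserved function forces the driving
  function to converge to the image of the other endpoint.\<close>

section \<open>Lipschitz differential equations\<close>

text \<open>The atoms avoid the poles of \<open>R\<close>, which could lie at infinity. For real
  \<open>P\<close> and \<open>Q\<close> both P + \<i> Q and P - \<i> Q have degree exactly n + 1,
  and their zeros are nonreal and simple because all critical points are real. So there are 2n - 1
  charges 2 and 2n + 2 charges -2, with sum 2 (2n - 1) - 2 (2n + 2) = -6, and no charge at infinity.
  With these values the drift is the one for which the residue relations at the zeros and poles of
  \<open>B\<^sub>t\<close> persist in time. The curve is obtained from the flow directly. Near a
  collision the square of g_t(z) - X_t moves with velocity close to 4, at a rate controlled by a
  bound on \<open>X'\<close>. Hence real points are not swallowed, exactly one point of the upper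
  half-plane is swallowed at each positive time, and it depends continuously on the time. The
  obstacle is the final time \<open>T\<close>, near which no bound on \<open>X'\<close> is
  available. What remains uniform up to \<open>T\<close> are the Schwarz bounds outside a large disc
  and the conserved function, so the arguments at \<open>T\<close> are compactness arguments based
  on these two.\<close>

lemma gronwall_weighted:
  fixes d :: "real \<Rightarrow> 'a::banach"
  assumes b: "0 \<le> b" and L: "0 < L"
    and deriv: "\<And>s. s \<in> {0..b} \<Longrightarrow> (d has_vector_derivative d' s) (at s within {0..b})"
    and bound: "\<And>s. s \<in> {0..b} \<Longrightarrow> norm (d' s) \<le> L * norm (d s)"
    and t: "t \<in> {0..b}"
  shows "norm (d t) \<le> 2 * norm (d 0) * exp (2 * L * t)"
proof -
  have cont: "continuous_on {0..b} d"
    using deriv by (meson continuous_on_eq_continuous_within has_vector_derivative_continuous)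
  \<comment> \<open>At a maximum point of the weighted norm the integrated bound returns at most
    half of the maximum, which can be absorbed. This costs the factor 2 in front and in the
    exponent, but needs no differentiability of the norm.\<close>
  define m where "m s = exp (- (2 * L * s)) * norm (d s)" for s
  have "continuous_on {0..b} m"
    unfolding m_def by (intro continuous_intros cont)
  then obtain s where s: "s \<in> {0..b}" and max: "\<And>r. r \<in> {0..b} \<Longrightarrow> m r \<le> m s"
    using continuous_attains_sup[of "{0..b}" m] b by auto
  have nd: "norm (d r) \<le> m s * exp (2 * L * r)" if "r \<in> {0..b}" for r
  proof -
    have "norm (d r) = m r * exp (2 * L * r)"
      by (simp add: m_def exp_minus field_simps)
    then show ?thesis using max[OF that] by simp
  qed
  have "(d' has_integral (d s - d 0)) {0..s}"
    by (rule fundamental_theorem_of_calculus)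
      (use s in \<open>auto intro: has_vector_derivative_within_subset[OF deriv]\<close>)
  moreover have "((\<lambda>r. L * m s * exp (2 * L * r)) has_integral
      (m s * exp (2 * L * s) / 2 - m s * exp (2 * L * 0) / 2)) {0..s}"
    by (rule fundamental_theorem_of_calculus)
      (use s L in \<open>auto intro!: derivative_eq_intros simp: has_real_derivative_iff_has_vector_derivative[symmetric]\<close>)
  moreover have "norm (d' r) \<le> L * m s * exp (2 * L * r)" if "r \<in> {0..s}" for r
    using order_trans[OF bound[of r] mult_left_mono[OF nd[of r], of L]] that s L by (simp add: mult.assoc)
  ultimately have "norm (d s - d 0) \<le> m s * exp (2 * L * s) / 2 - m s * exp (2 * L * 0) / 2"
    by (metis (no_types, lifting) has_integral_integrable integral_norm_bound_integral integral_unique)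
  moreover have "m s \<ge> 0" by (simp add: m_def)
  ultimately have "norm (d s) \<le> norm (d 0) + m s * exp (2 * L * s) / 2"
    using norm_triangle_ineq2[of "d s" "d 0"] by simp
  then have "m s \<le> exp (- (2 * L * s)) * (norm (d 0) + m s * exp (2 * L * s) / 2)"
    unfolding m_def[of s] by (intro mult_left_mono) (auto simp: m_def)
  also have "\<dots> = exp (- (2 * L * s)) * norm (d 0) + m s / 2"
    by (simp add: exp_minus field_simps)
  also have "exp (- (2 * L * s)) * norm (d 0) \<le> 1 * norm (d 0)"
    using s L by (intro mult_right_mono) auto
  finally have "m s \<le> 2 * norm (d 0)" by simp
  then show ?thesis
    using nd[OF t] mult_right_mono[of "m s" "2 * norm (d 0)" "exp (2 * L * t)"] by (smt (verit) exp_ge_zero)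
qed

text \<open>The unknown is exp (-2 L t) u(t): in this weight the integral operator contracts by 1/2
  on the whole interval, whatever its length. The clamp \<open>c\<close> turns functions on the
  interval into bounded continuous functions on the line, a complete space.\<close>

lemma picard_global:
  fixes f :: "real \<Rightarrow> 'a::banach \<Rightarrow> 'a"
  assumes b: "0 \<le> b" and L: "0 < L"
    and cont: "continuous_on ({0..b} \<times> UNIV) (\<lambda>(t, x). f t x)"
    and lip: "\<And>t x y. t \<in> {0..b} \<Longrightarrow> norm (f t x - f t y) \<le> L * norm (x - y)"
  obtains u where "u 0 = x0"
    "\<And>t. t \<in> {0..b} \<Longrightarrow> (u has_vector_derivative f t (u t)) (at t within {0..b})"
proof -
  define c where "c t = max 0 (min b t)" for t
  have c: "c t \<in> {0..b}" for t using b by (auto simp: c_def)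
  have cid: "c t = t" if "t \<in> {0..b}" for t using that by (auto simp: c_def)
  have contc: "continuous_on UNIV c" unfolding c_def by (intro continuous_intros)
  define I where "I w t = x0 + integral {0..t} (\<lambda>s. f s (exp (2 * L * s) *\<^sub>R w s))" for w t
  have contf: "continuous_on {0..b} (\<lambda>s. f s (h s))" if "continuous_on {0..b} h" for h
  proof -
    have "continuous_on {0..b} ((\<lambda>(t, x). f t x) \<circ> (\<lambda>s. (s, h s)))"
      by (rule continuous_on_compose)
        (auto intro!: continuous_intros that intro: continuous_on_subset[OF cont])
    then show ?thesis by (simp add: o_def)
  qed
  have contfw: "continuous_on {0..b} (\<lambda>s. f s (exp (2 * L * s) *\<^sub>R apply_bcontfun w s))"
    for w :: "real \<Rightarrow>\<^sub>C 'a"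
    by (intro contf continuous_intros) auto
  have derI: "(I (apply_bcontfun w) has_vector_derivative f t (exp (2 * L * t) *\<^sub>R w t)) (at t within {0..b})"
    if "t \<in> {0..b}" for w :: "real \<Rightarrow>\<^sub>C 'a" and t
    unfolding I_def
    by (auto intro!: derivative_eq_intros integral_has_vector_derivative[OF contfw] that)
  have contI: "continuous_on {0..b} (I (apply_bcontfun w))" for w :: "real \<Rightarrow>\<^sub>C 'a"
    using derI by (meson continuous_on_eq_continuous_within has_vector_derivative_continuous)
  define G where "G w t = exp (- (2 * L * c t)) *\<^sub>R I (apply_bcontfun w) (c t)" for w :: "real \<Rightarrow>\<^sub>C 'a" and t
  have contG: "continuous_on UNIV (G w)" for w
  proof -
    have "continuous_on UNIV ((\<lambda>t. exp (- (2 * L * t)) *\<^sub>R I (apply_bcontfun w) t) \<circ> c)"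
      by (rule continuous_on_compose[OF contc])
        (rule continuous_on_subset[of "{0..b}"], use c in \<open>auto intro!: continuous_intros contI\<close>)
    then show ?thesis by (simp add: G_def o_def)
  qed
  have bddG: "bounded (range (G w))" for w
  proof -
    have "compact ((\<lambda>t. exp (- (2 * L * t)) *\<^sub>R I (apply_bcontfun w) t) ` {0..b})"
      by (intro compact_continuous_image continuous_intros contI) auto
    moreover have "range (G w) \<subseteq> (\<lambda>t. exp (- (2 * L * t)) *\<^sub>R I (apply_bcontfun w) t) ` {0..b}"
      using c by (auto simp: G_def)
    ultimately show ?thesis by (meson bounded_subset compact_imp_bounded)
  qed
  define F where "F w = Bcontfun (G w)" for w
  have F: "apply_bcontfun (F w) = G w" for w
    unfolding F_def by (rule Bcontfun_inverse) (use contG bddG in \<open>auto simp: bcontfun_def\<close>)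
  have "dist (F v) (F w) \<le> 1/2 * dist v w" for v w
  proof (rule dist_bound)
    fix r
    define t where "t = c r"
    have t: "t \<in> {0..b}" using c by (simp add: t_def)
    let ?D = "dist v w"
    have int: "(\<lambda>s. f s (exp (2 * L * s) *\<^sub>R apply_bcontfun w s)) integrable_on {0..t}" for w :: "real \<Rightarrow>\<^sub>C 'a"
      by (rule integrable_continuous_interval, rule continuous_on_subset[OF contfw]) (use t in auto)
    have "I v t - I w t = integral {0..t} (\<lambda>s. f s (exp (2 * L * s) *\<^sub>R v s) - f s (exp (2 * L * s) *\<^sub>R w s))"
      unfolding I_def by (simp add: Henstock_Kurzweil_Integration.integral_diff int)
    also have "norm \<dots> \<le> integral {0..t} (\<lambda>s. L * (exp (2 * L * s) * ?D))"
    proof (rule integral_norm_bound_integral)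
      show "(\<lambda>s. f s (exp (2 * L * s) *\<^sub>R v s) - f s (exp (2 * L * s) *\<^sub>R w s)) integrable_on {0..t}"
        by (intro integrable_diff int)
      show "(\<lambda>s. L * (exp (2 * L * s) * ?D)) integrable_on {0..t}"
        by (intro integrable_continuous_interval continuous_intros)
      fix s assume "s \<in> {0..t}"
      then have "norm (f s (exp (2 * L * s) *\<^sub>R v s) - f s (exp (2 * L * s) *\<^sub>R w s))
          \<le> L * norm (exp (2 * L * s) *\<^sub>R v s - exp (2 * L * s) *\<^sub>R w s)"
        using t by (intro lip) auto
      also have "\<dots> = L * (exp (2 * L * s) * dist (v s) (w s))"
        by (simp add: scaleR_diff_right[symmetric] dist_norm)
      also have "\<dots> \<le> L * (exp (2 * L * s) * ?D)"
        using L dist_bounded[of v s w] by simp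
      finally show "norm (f s (exp (2 * L * s) *\<^sub>R v s) - f s (exp (2 * L * s) *\<^sub>R w s)) \<le> L * (exp (2 * L * s) * ?D)" .
    qed
    also have "integral {0..t} (\<lambda>s. L * (exp (2 * L * s) * ?D)) = exp (2 * L * t) * ?D / 2 - exp (2 * L * 0) * ?D / 2"
      by (rule integral_unique, rule fundamental_theorem_of_calculus)
        (use t L in \<open>auto intro!: derivative_eq_intros simp: has_real_derivative_iff_has_vector_derivative[symmetric]\<close>)
    also have "\<dots> \<le> exp (2 * L * t) * ?D / 2" by simp
    finally have le: "norm (I v t - I w t) \<le> exp (2 * L * t) * ?D / 2" .
    have "dist (F v r) (F w r) = exp (- (2 * L * t)) * norm (I v t - I w t)"
      by (simp add: F G_def t_def[symmetric] dist_norm scaleR_diff_right[symmetric])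
    also have "\<dots> \<le> exp (- (2 * L * t)) * (exp (2 * L * t) * ?D / 2)"
      by (intro mult_left_mono le) auto
    also have "\<dots> = 1/2 * ?D" by (simp add: exp_minus)
    finally show "dist (F v r) (F w r) \<le> 1/2 * ?D" .
  qed
  then obtain w where w: "F w = w"
    using banach_fix_type[of "1/2" F] by auto
  define u where "u = I (apply_bcontfun w)"
  have wt: "exp (2 * L * t) *\<^sub>R apply_bcontfun w t = u t" if "t \<in> {0..b}" for t
  proof -
    have "apply_bcontfun w t = exp (- (2 * L * t)) *\<^sub>R u t"
      using F[of w] w cid[OF that] by (simp add: G_def u_def)
    then show ?thesis by (simp add: exp_minus)
  qed
  show ?thesis
  proof
    show "u 0 = x0" by (simp add: u_def I_def)
    fix t assume "t \<in> {0..b}"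
    then show "(u has_vector_derivative f t (u t)) (at t within {0..b})"
      using derI[of t w] wt[of t] by (simp add: u_def)
  qed
qed

section \<open>Solutions of the Loewner equation\<close>

text \<open>A globally Lipschitz replacement of 1 / z, equal to it for norm at least
  \<open>\<delta>\<close>. With it the Loewner field can be solved for all times, and a solution is
  genuine as long as its gap to the driver is at least \<open>\<delta>\<close>.\<close>

definition trunc_inverse :: "real \<Rightarrow> complex \<Rightarrow> complex" where
  "trunc_inverse \<delta> z = cnj z / of_real ((max (norm z) \<delta>)\<^sup>2)"

lemma trunc_inverse_eq: "0 < \<delta> \<Longrightarrow> \<delta> \<le> norm z \<Longrightarrow> trunc_inverse \<delta> z = 1 / z"
  by (auto simp: trunc_inverse_def max_absorb1 complex_norm_square divide_simps simp flip: of_real_power)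

lemma trunc_inverse_lipschitz:
  assumes d: "0 < \<delta>"
  shows "norm (trunc_inverse \<delta> z - trunc_inverse \<delta> w) \<le> 3 / \<delta>\<^sup>2 * norm (z - w)"
proof -
  define m where "m = max (norm z) \<delta>"
  define k where "k = max (norm w) \<delta>"
  have m: "m \<ge> \<delta>" "norm z \<le> m" and k: "k \<ge> \<delta>" "norm w \<le> k" by (auto simp: m_def k_def)
  have pos: "m > 0" "k > 0" using m k d by auto
  have mk: "\<bar>k - m\<bar> \<le> norm (z - w)"
    using norm_triangle_ineq3[of z w] by (auto simp: m_def k_def max_def)
  have "trunc_inverse \<delta> z - trunc_inverse \<delta> w = cnj (z - w) / of_real (m\<^sup>2) + cnj w * of_real ((k - m) * (k + m) / (m\<^sup>2 * k\<^sup>2))"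
    using pos by (simp add: trunc_inverse_def m_def[symmetric] k_def[symmetric] field_simps power2_eq_square)
  also have "norm \<dots> \<le> norm (z - w) / m\<^sup>2 + norm w * (\<bar>k - m\<bar> * (k + m) / (m\<^sup>2 * k\<^sup>2))"
    apply (rule order_trans[OF norm_triangle_ineq])
    using pos by (simp add: norm_mult norm_divide abs_mult norm_power del: of_real_mult of_real_divide of_real_power flip: complex_cnj_diff)
  also have "norm w * (\<bar>k - m\<bar> * (k + m) / (m\<^sup>2 * k\<^sup>2)) \<le> k * (norm (z - w) * (k + m) / (m\<^sup>2 * k\<^sup>2))"
    using pos mk k by (intro mult_mono divide_right_mono mult_right_mono) auto
  also have "\<dots> = norm (z - w) / m\<^sup>2 + norm (z - w) / (m * k)"
    using pos by (simp add: field_simps power2_eq_square)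
  also have "norm (z - w) / m\<^sup>2 + (norm (z - w) / m\<^sup>2 + norm (z - w) / (m * k))
      \<le> norm (z - w) / \<delta>\<^sup>2 + (norm (z - w) / \<delta>\<^sup>2 + norm (z - w) / \<delta>\<^sup>2)"
    using m k d by (intro add_mono divide_left_mono) (auto simp: power2_eq_square intro!: mult_mono)
  finally show ?thesis by simp
qed

lemma continuous_on_trunc_inverse [continuous_intros]:
  assumes "0 < \<delta>" "continuous_on S f"
  shows "continuous_on S (\<lambda>x. trunc_inverse \<delta> (f x))"
  unfolding trunc_inverse_def using assms
  by (intro continuous_intros) (auto simp: max_def)

lemma has_vector_derivative_subset_eq:
  "(f has_vector_derivative D) (at s within S) \<Longrightarrow> S' \<subseteq> S \<Longrightarrow> D = D' \<Longrightarrow>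
    (f has_vector_derivative D') (at s within S')"
  using has_vector_derivative_within_subset by blast

lemma continuous_on_vector_derivative:
  assumes "\<And>s. s \<in> S \<Longrightarrow> (f has_vector_derivative f' s) (at s within S)"
  shows "continuous_on S f"
  unfolding continuous_on_eq_continuous_within
  using has_vector_derivative_continuous[OF assms] by blast

text \<open>Integrating factor. In this form zeros and signs of a solution are read off its initial
  value; injectivity of the flow, the sign of the imaginary part and the conservation laws all come
  from here.\<close>

lemma linear_ode_exp:
  fixes f c :: "real \<Rightarrow> 'a::{real_normed_field, banach}"
  assumes c: "continuous_on {0..t} c"
    and f: "\<And>s. s \<in> {0..t} \<Longrightarrow> (f has_vector_derivative c s * f s) (at s within {0..t})"
    and s: "s \<in> {0..t}"
  shows "f s = f 0 * exp (integral {0..s} c)"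
proof -
  define h where "h r = f r * exp (- integral {0..r} c)" for r
  have "(h has_vector_derivative 0) (at r within {0..t})" if "r \<in> {0..t}" for r
  proof -
    have "((\<lambda>r. - integral {0..r} c) has_vector_derivative - c r) (at r within {0..t})"
      using integral_has_vector_derivative[OF c that] by (auto intro!: derivative_eq_intros)
    then have "((\<lambda>r. exp (- integral {0..r} c)) has_vector_derivative (- c r * exp (- integral {0..r} c))) (at r within {0..t})"
      using field_vector_diff_chain_within[of "\<lambda>r. - integral {0..r} c" "- c r" r "{0..t}" exp "exp (- integral {0..r} c)"]
      by (auto simp: o_def intro: DERIV_exp[THEN DERIV_subset, OF subset_UNIV])
    from has_vector_derivative_mult[OF f[OF that] this] show ?thesis
      unfolding h_def by (rule has_vector_derivative_subset_eq) (auto simp: algebra_simps)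
  qed
  then obtain k where "\<And>r. r \<in> {0..t} \<Longrightarrow> h r = k"
    using has_vector_derivative_zero_constant[of "{0..t}" h] by auto
  then have "h s = h 0" using s by auto
  then show ?thesis by (simp add: h_def exp_minus field_simps)
qed

lemma loewner_solution_mono: "loewner_solution X z t u \<Longrightarrow> s \<le> t \<Longrightarrow> loewner_solution X z s u"
  unfolding loewner_solution_def
  using has_vector_derivative_within_subset[of u _ _ "{0..t}" "{0..s}"] by auto

lemma loewner_alive_mono: "loewner_alive X t z \<Longrightarrow> s \<le> t \<Longrightarrow> loewner_alive X s z"
  unfolding loewner_alive_def using loewner_solution_mono by blast

lemma loewner_solution_cnj:
  assumes "loewner_solution X z t u"
  shows "loewner_solution X (cnj z) t (\<lambda>s. cnj (u s))"
  unfolding loewner_solution_def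
proof (intro conjI ballI)
  show "cnj (u 0) = cnj z" using assms by (simp add: loewner_solution_def)
  fix s assume s: "s \<in> {0..t}"
  then have "u s \<noteq> of_real (X s)" and d: "(u has_vector_derivative 2 / (u s - of_real (X s))) (at s within {0..t})"
    using assms by (auto simp: loewner_solution_def)
  then show "cnj (u s) \<noteq> of_real (X s)" by (metis complex_cnj_cnj complex_cnj_complex_of_real)
  show "((\<lambda>s. cnj (u s)) has_vector_derivative 2 / (cnj (u s) - of_real (X s))) (at s within {0..t})"
    using has_vector_derivative_cnj[OF d] by simp
qed

lemma loewner_alive_cnj [simp]: "loewner_alive X t (cnj z) = loewner_alive X t z"
  unfolding loewner_alive_def by (metis loewner_solution_cnj complex_cnj_cnj)

section \<open>The truncated Loewner equation, uniqueness and continuation\<close>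

definition trunc_solution :: "real \<Rightarrow> (real \<Rightarrow> real) \<Rightarrow> real \<Rightarrow> (real \<Rightarrow> complex) \<Rightarrow> bool" where
  "trunc_solution \<delta> X b u \<longleftrightarrow>
    (\<forall>s\<in>{0..b}. (u has_vector_derivative 2 * trunc_inverse \<delta> (u s - of_real (X s))) (at s within {0..b}))"

lemma trunc_solution_mono: "trunc_solution \<delta> X b u \<Longrightarrow> a \<le> b \<Longrightarrow> trunc_solution \<delta> X a u"
  unfolding trunc_solution_def
  using has_vector_derivative_within_subset[of u _ _ "{0..b}" "{0..a}"] by auto

lemma trunc_solution_exists:
  assumes "0 \<le> b" "0 < \<delta>" and X: "continuous_on {0..b} X"
  obtains u where "u 0 = z" "trunc_solution \<delta> X b u"
proof -
  have "continuous_on ({0..b} \<times> UNIV) (\<lambda>(t, x). 2 * trunc_inverse \<delta> (x - of_real (X t)))"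
    unfolding case_prod_unfold using assms
    by (intro continuous_intros continuous_on_compose2[OF X]) auto
  moreover have "norm (2 * trunc_inverse \<delta> (x - of_real (X t)) - 2 * trunc_inverse \<delta> (y - of_real (X t))) \<le> 6 / \<delta>\<^sup>2 * norm (x - y)" for x y t
  proof -
    have "norm (2 * trunc_inverse \<delta> (x - of_real (X t)) - 2 * trunc_inverse \<delta> (y - of_real (X t)))
      = 2 * norm (trunc_inverse \<delta> (x - of_real (X t)) - trunc_inverse \<delta> (y - of_real (X t)))"
      by (metis norm_mult norm_numeral right_diff_distrib)
    then show ?thesis using trunc_inverse_lipschitz[OF assms(2), of "x - of_real (X t)" "y - of_real (X t)"] by simp
  qed
  ultimately obtain u where "u 0 = z"
    "\<And>t. t \<in> {0..b} \<Longrightarrow> (u has_vector_derivative 2 * trunc_inverse \<delta> (u t - of_real (X t))) (at t within {0..b})"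
    by (rule picard_global[OF assms(1), of "6 / \<delta>\<^sup>2" "\<lambda>t x. 2 * trunc_inverse \<delta> (x - of_real (X t))" z, rotated])
      (use assms in auto)
  then show ?thesis using that unfolding trunc_solution_def by blast
qed

lemma trunc_solution_close:
  assumes "0 < \<delta>" and u: "trunc_solution \<delta> X b u" and v: "trunc_solution \<delta> X b v" and s: "s \<in> {0..b}"
  shows "norm (u s - v s) \<le> 2 * norm (u 0 - v 0) * exp (12 / \<delta>\<^sup>2 * b)"
proof -
  have "norm (u s - v s) \<le> 2 * norm (u 0 - v 0) * exp (2 * (6 / \<delta>\<^sup>2) * s)"
  proof (rule gronwall_weighted[where b = b and d' = "\<lambda>s. 2 * trunc_inverse \<delta> (u s - of_real (X s)) - 2 * trunc_inverse \<delta> (v s - of_real (X s))"])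
    fix r assume r: "r \<in> {0..b}"
    then show "((\<lambda>r. u r - v r) has_vector_derivative 2 * trunc_inverse \<delta> (u r - of_real (X r)) - 2 * trunc_inverse \<delta> (v r - of_real (X r))) (at r within {0..b})"
      using u v unfolding trunc_solution_def by (intro has_vector_derivative_diff) auto
    have "norm (2 * trunc_inverse \<delta> (u r - of_real (X r)) - 2 * trunc_inverse \<delta> (v r - of_real (X r)))
      = 2 * norm (trunc_inverse \<delta> (u r - of_real (X r)) - trunc_inverse \<delta> (v r - of_real (X r)))"
      by (metis norm_mult norm_numeral right_diff_distrib)
    then show "norm (2 * trunc_inverse \<delta> (u r - of_real (X r)) - 2 * trunc_inverse \<delta> (v r - of_real (X r))) \<le> 6 / \<delta>\<^sup>2 * norm (u r - v r)"
      using trunc_inverse_lipschitz[OF assms(1), of "u r - of_real (X r)" "v r - of_real (X r)"] by simp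
  qed (use assms s in auto)
  also have "\<dots> \<le> 2 * norm (u 0 - v 0) * exp (12 / \<delta>\<^sup>2 * b)"
    using s assms(1) by (intro mult_left_mono) (auto simp: divide_right_mono)
  finally show ?thesis .
qed

lemma loewner_solution_iff_trunc:
  assumes "0 < \<delta>" "\<And>s. s \<in> {0..t} \<Longrightarrow> \<delta> \<le> norm (u s - of_real (X s))"
  shows "loewner_solution X z t u \<longleftrightarrow> u 0 = z \<and> trunc_solution \<delta> X t u"
proof -
  have "u s \<noteq> of_real (X s)" if "s \<in> {0..t}" for s using assms(1) assms(2)[OF that] by auto
  then show ?thesis
    unfolding loewner_solution_def trunc_solution_def using trunc_inverse_eq[OF assms(1) assms(2)] by auto
qed

lemma loewner_solution_cont: "loewner_solution X z t u \<Longrightarrow> continuous_on {0..t} u"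
  by (rule continuous_on_vector_derivative) (auto simp: loewner_solution_def)

lemma loewner_solution_gap:
  assumes "loewner_solution X z t u" "continuous_on {0..t} X" "0 \<le> t"
  obtains \<delta> where "0 < \<delta>" "\<And>s. s \<in> {0..t} \<Longrightarrow> \<delta> \<le> norm (u s - of_real (X s))"
proof -
  have "continuous_on {0..t} (\<lambda>s. norm (u s - of_real (X s)))"
    by (intro continuous_intros assms loewner_solution_cont[OF assms(1)])
  then obtain s where "s \<in> {0..t}" "\<And>r. r \<in> {0..t} \<Longrightarrow> norm (u s - of_real (X s)) \<le> norm (u r - of_real (X r))"
    using continuous_attains_inf[of "{0..t}" "\<lambda>s. norm (u s - of_real (X s))"] assms(3) by auto
  then show ?thesis
    using that[of "norm (u s - of_real (X s))"] assms(1) unfolding loewner_solution_def by auto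
qed

lemma loewner_solution_unique:
  assumes u: "loewner_solution X z t u" and v: "loewner_solution X z t v"
    and X: "continuous_on {0..t} X" and s: "s \<in> {0..t}"
  shows "u s = v s"
proof -
  have t: "0 \<le> t" using s by auto
  obtain d1 where d1: "0 < d1" "\<And>s. s \<in> {0..t} \<Longrightarrow> d1 \<le> norm (u s - of_real (X s))"
    using loewner_solution_gap[OF u X t] by blast
  obtain d2 where d2: "0 < d2" "\<And>s. s \<in> {0..t} \<Longrightarrow> d2 \<le> norm (v s - of_real (X s))"
    using loewner_solution_gap[OF v X t] by blast
  define d where "d = min d1 d2"
  have d: "0 < d" "\<And>s. s \<in> {0..t} \<Longrightarrow> d \<le> norm (u s - of_real (X s))"
    "\<And>s. s \<in> {0..t} \<Longrightarrow> d \<le> norm (v s - of_real (X s))"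
    using d1 d2 by (auto simp: d_def min_le_iff_disj)
  have "norm (u s - v s) \<le> 2 * norm (u 0 - v 0) * exp (12 / d\<^sup>2 * t)"
    using trunc_solution_close[OF d(1) _ _ s] loewner_solution_iff_trunc[of d t] d u v by blast
  moreover have "u 0 = v 0" using u v by (simp add: loewner_solution_def)
  ultimately show ?thesis by simp
qed

lemma loewner_map_eq:
  assumes "loewner_solution X z t u" "continuous_on {0..t} X" "0 \<le> t"
  shows "loewner_map X t z = u t"
  unfolding loewner_map_def
proof (rule the_equality)
  show "\<exists>v. loewner_solution X z t v \<and> u t = v t" using assms(1) by blast
  fix w assume "\<exists>v. loewner_solution X z t v \<and> w = v t"
  then show "w = u t" using loewner_solution_unique[OF assms(1) _ assms(2), of _ t] assms(3) by auto
qed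

lemma loewner_solution_cong:
  "loewner_solution X z t u \<Longrightarrow> (\<And>s. s \<in> {0..t} \<Longrightarrow> u s = v s) \<Longrightarrow> 0 \<le> t \<Longrightarrow> loewner_solution X z t v"
  unfolding loewner_solution_def
  by (auto intro!: has_vector_derivative_transform[where f = u and g = v and S = "{0..t}"])

lemma loewner_map_solution:
  assumes "loewner_alive X t z" "continuous_on {0..t} X" "0 \<le> t"
  shows "loewner_solution X z t (\<lambda>s. loewner_map X s z)"
proof -
  obtain u where u: "loewner_solution X z t u" using assms by (auto simp: loewner_alive_def)
  then have "u s = loewner_map X s z" if "s \<in> {0..t}" for s
    using loewner_map_eq[OF loewner_solution_mono[OF u], of s] continuous_on_subset[OF assms(2), of "{0..s}"] that by auto
  then show ?thesis by (intro loewner_solution_cong[OF u _ assms(3)])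
qed

lemma loewner_alive_0: "loewner_alive X 0 z \<longleftrightarrow> z \<noteq> of_real (X 0)"
proof
  assume "z \<noteq> of_real (X 0)"
  \<comment> \<open>Differentiability within a one-point interval is vacuous, so the constant
    function solves the equation up to time 0.\<close>
  then have "loewner_solution X z 0 (\<lambda>_. z)"
    by (simp add: loewner_solution_def has_vector_derivative_def has_derivative_within_singleton_iff bounded_linear_scaleR_left)
  then show "loewner_alive X 0 z" by (auto simp: loewner_alive_def)
qed (auto simp: loewner_alive_def loewner_solution_def)

text \<open>The truncated solution from \<open>z\<close> exists up to \<open>b\<close> and follows
  the genuine one up to \<open>t\<close>, so by continuity its gap remains at least
  \<open>2 * \<delta>\<close> slightly longer. By Gronwall nearby starting points stay within
  \<open>\<delta>\<close> of it; their gaps are at least \<open>\<delta>\<close>, and truncation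
  does not affect them either.\<close>

lemma loewner_alive_nbhd:
  assumes al: "loewner_alive X t z" and X: "continuous_on {0..b} X" and t: "0 \<le> t" "t < b"
  obtains \<eta> \<delta> e C where "0 < \<eta>" "t + \<eta> \<le> b" "0 < \<delta>" "0 < e"
    "\<And>z'. z' \<in> ball z e \<Longrightarrow> loewner_alive X (t + \<eta>) z'"
    "\<And>z' s. z' \<in> ball z e \<Longrightarrow> s \<in> {0..t + \<eta>} \<Longrightarrow> \<delta> \<le> norm (loewner_map X s z' - of_real (X s))"
    "\<And>z' s. z' \<in> ball z e \<Longrightarrow> s \<in> {0..t + \<eta>} \<Longrightarrow>
        norm (loewner_map X s z' - loewner_map X s z) \<le> C * norm (z' - z)"
proof -
  have Xt: "continuous_on {0..t} X" using X t by (auto intro: continuous_on_subset)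
  obtain u where u: "loewner_solution X z t u" using al by (auto simp: loewner_alive_def)
  obtain d where d: "0 < d" "\<And>s. s \<in> {0..t} \<Longrightarrow> d \<le> norm (u s - of_real (X s))"
    using loewner_solution_gap[OF u Xt t(1)] by blast
  define \<delta> where "\<delta> = d / 4"
  have \<delta>: "0 < \<delta>" using d by (simp add: \<delta>_def)
  obtain w where w: "w 0 = z" "trunc_solution \<delta> X b w"
    using trunc_solution_exists[of b \<delta> X z] t \<delta> X by auto
  have wu: "w s = u s" if "s \<in> {0..t}" for s
  proof -
    have "trunc_solution \<delta> X t u" using loewner_solution_iff_trunc[of \<delta> t u X z] u d(1) order_trans[of \<delta> d, OF _ d(2)]
      by (auto simp: \<delta>_def)
    then have "norm (w s - u s) \<le> 2 * norm (w 0 - u 0) * exp (12 / \<delta>\<^sup>2 * t)"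
      using trunc_solution_close[OF \<delta> trunc_solution_mono[OF w(2)] _ that, of u] t by auto
    then show ?thesis using w u by (simp add: loewner_solution_def)
  qed
  have contw: "continuous_on {0..b} w" 
    by (rule continuous_on_vector_derivative) (use w(2) in \<open>auto simp: trunc_solution_def\<close>)
  have contd: "continuous_on {0..b} (\<lambda>s. norm (w s - of_real (X s)))" by (intro continuous_intros contw X)
  have "\<exists>\<eta>0>0. \<forall>s\<in>{0..b}. dist s t < \<eta>0 \<longrightarrow>
      dist (norm (w s - of_real (X s))) (norm (w t - of_real (X t))) < d/2"
    using contd[unfolded continuous_on_iff, rule_format, of t "d/2"] d(1) t by simp
  then obtain \<eta>0 where \<eta>0: "0 < \<eta>0" "\<And>s. s \<in> {0..b} \<Longrightarrow> dist s t < \<eta>0 \<Longrightarrow>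
      dist (norm (w s - of_real (X s))) (norm (w t - of_real (X t))) < d/2"
    by blast
  define \<eta> where "\<eta> = min (\<eta>0 / 2) (b - t)"
  have \<eta>: "0 < \<eta>" "t + \<eta> \<le> b" "\<eta> < \<eta>0" using \<eta>0 t by (auto simp: \<eta>_def)
  have gapw: "2 * \<delta> \<le> norm (w s - of_real (X s))" if "s \<in> {0..t + \<eta>}" for s
  proof (cases "s \<le> t")
    case True
    then show ?thesis using d(2)[of s] wu[of s] that d(1) by (auto simp: \<delta>_def)
  next
    case False
    then have "dist (norm (w s - of_real (X s))) (norm (w t - of_real (X t))) < d/2"
      using \<eta>0(2)[of s] that \<eta> by (auto simp: dist_real_def)
    moreover have "d \<le> norm (w t - of_real (X t))" using d(2)[of t] wu[of t] t by auto
    ultimately show ?thesis unfolding \<delta>_def dist_real_def by linarith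
  qed
  define C where "C = 2 * exp (12 / \<delta>\<^sup>2 * b)"
  have C: "0 < C" by (simp add: C_def)
  define e where "e = \<delta> / C"
  have e: "0 < e" using \<delta> C by (simp add: e_def)
  have main: "\<exists>v. loewner_solution X z' (t + \<eta>) v \<and> (\<forall>s\<in>{0..t + \<eta>}. \<delta> \<le> norm (v s - of_real (X s)) \<and> norm (v s - w s) \<le> C * norm (z' - z))"
    if z': "z' \<in> ball z e" for z'
  proof -
    obtain v where v: "v 0 = z'" "trunc_solution \<delta> X b v"
      using trunc_solution_exists[of b \<delta> X z'] t \<delta> X by auto
    have cl: "norm (v s - w s) \<le> C * norm (z' - z)" if "s \<in> {0..b}" for s
      using trunc_solution_close[OF \<delta> v(2) w(2) that] v w by (simp add: C_def mult_ac)
    have "C * norm (z' - z) \<le> \<delta>"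
      using z' C by (simp add: e_def dist_norm norm_minus_commute field_simps)
    then have gap: "\<delta> \<le> norm (v s - of_real (X s))" if "s \<in> {0..t + \<eta>}" for s
      using cl[of s] gapw[OF that] norm_triangle_ineq2[of "w s - of_real (X s)" "v s - of_real (X s)"] that \<eta>
      by (auto simp: norm_minus_commute)
    then have "loewner_solution X z' (t + \<eta>) v"
      using loewner_solution_iff_trunc[OF \<delta>, of "t + \<eta>" v X z'] v \<eta> trunc_solution_mono[OF v(2)] by auto
    then show ?thesis using gap cl \<eta> by auto
  qed
  have Xe: "continuous_on {0..s} X" if "s \<le> t + \<eta>" for s
    using X \<eta> that by (auto intro: continuous_on_subset)
  have mapeq: "loewner_map X s z' = v s" if "loewner_solution X z' (t + \<eta>) v" "s \<in> {0..t + \<eta>}" for v s z'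
    using loewner_map_eq[OF loewner_solution_mono[OF that(1)], of s] Xe that by auto
  have wsol: "loewner_solution X z (t + \<eta>) w"
    using loewner_solution_iff_trunc[OF \<delta>, of "t + \<eta>" w X z] order_trans[OF _ gapw, of \<delta>] \<delta> w \<eta> trunc_solution_mono[OF w(2), of "t + \<eta>"] by auto
  show ?thesis
  proof (rule that[OF \<eta>(1,2) \<delta> e])
    fix z' assume z': "z' \<in> ball z e"
    then obtain v where v: "loewner_solution X z' (t + \<eta>) v"
      "\<forall>s\<in>{0..t + \<eta>}. \<delta> \<le> norm (v s - of_real (X s)) \<and> norm (v s - w s) \<le> C * norm (z' - z)"
      using main by blast
    show "loewner_alive X (t + \<eta>) z'" using v by (auto simp: loewner_alive_def)
    fix s assume s: "s \<in> {0..t + \<eta>}"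
    show "\<delta> \<le> norm (loewner_map X s z' - of_real (X s))" using v s mapeq by auto
    show "norm (loewner_map X s z' - loewner_map X s z) \<le> C * norm (z' - z)"
      using v s mapeq[OF v(1) s] mapeq[OF wsol s] by auto
  qed
qed

text \<open>The truncated solution exists up to and including \<open>\<tau>\<close>, coincides with
  the flow before \<open>\<tau>\<close>, and keeps the gap at \<open>\<tau>\<close> by continuity.
  On the initial interval up to \<open>s0\<close> the gap comes from compactness.\<close>

lemma loewner_alive_limit:
  assumes al: "\<And>s. s \<in> {0..<\<tau>} \<Longrightarrow> loewner_alive X s z" and X: "continuous_on {0..\<tau>} X" and \<tau>: "0 \<le> s0" "s0 < \<tau>"
    and \<delta>: "0 < \<delta>" "\<And>s. s \<in> {s0..<\<tau>} \<Longrightarrow> \<delta> \<le> norm (loewner_map X s z - of_real (X s))"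
  shows "loewner_alive X \<tau> z"
proof -
  have Xs: "continuous_on {0..s} X" if "s \<le> \<tau>" for s using X that by (auto intro: continuous_on_subset)
  have sol: "loewner_solution X z s (\<lambda>s. loewner_map X s z)" if "s \<in> {0..<\<tau>}" for s
    using loewner_map_solution[OF al[OF that] Xs] that by auto
  obtain d where d: "0 < d" "\<And>s. s \<in> {0..s0} \<Longrightarrow> d \<le> norm (loewner_map X s z - of_real (X s))"
    using loewner_solution_gap[OF sol Xs, of s0] \<tau> by auto
  define \<epsilon> where "\<epsilon> = min d \<delta>"
  have \<epsilon>: "0 < \<epsilon>" "\<And>s. s \<in> {0..<\<tau>} \<Longrightarrow> \<epsilon> \<le> norm (loewner_map X s z - of_real (X s))"
  proof -
    show "0 < \<epsilon>" using d \<delta> by (simp add: \<epsilon>_def)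
    fix s assume "s \<in> {0..<\<tau>}"
    then show "\<epsilon> \<le> norm (loewner_map X s z - of_real (X s))"
      using d(2)[of s] \<delta>(2)[of s] by (cases "s \<le> s0") (auto simp: \<epsilon>_def min_le_iff_disj)
  qed
  obtain w where w: "w 0 = z" "trunc_solution \<epsilon> X \<tau> w"
    using trunc_solution_exists[of \<tau> \<epsilon> X z] \<tau> \<epsilon> X by auto
  have eq: "w s = loewner_map X s z" if s: "s \<in> {0..<\<tau>}" for s
  proof -
    have "trunc_solution \<epsilon> X s (\<lambda>s. loewner_map X s z) \<and> loewner_map X 0 z = z"
      using loewner_solution_iff_trunc[OF \<epsilon>(1), of s "\<lambda>s. loewner_map X s z" X z] sol[OF s] \<epsilon>(2) s by auto
    then have "norm (w s - loewner_map X s z) \<le> 2 * norm (w 0 - loewner_map X 0 z) * exp (12 / \<epsilon>\<^sup>2 * s)"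
      using trunc_solution_close[OF \<epsilon>(1) trunc_solution_mono[OF w(2)], of s "\<lambda>s. loewner_map X s z" s] s by auto
    then show ?thesis using w \<open>_ \<and> loewner_map X 0 z = z\<close> by simp
  qed
  have contw: "continuous_on {0..\<tau>} w" 
    by (rule continuous_on_vector_derivative) (use w(2) in \<open>auto simp: trunc_solution_def\<close>)
  have "\<epsilon> \<le> norm (w s - of_real (X s))" if "s \<in> {0..\<tau>}" for s
  proof (rule continuous_ge_on_closure[of "{0..<\<tau>}" "\<lambda>s. norm (w s - of_real (X s))"])
    show "continuous_on (closure {0..<\<tau>}) (\<lambda>s. norm (w s - of_real (X s)))"
      using \<tau> by (auto intro!: continuous_intros contw X)
    show "s \<in> closure {0..<\<tau>}" using that \<tau> by simp
  qed (use eq \<epsilon> in auto)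
  then have "loewner_solution X z \<tau> w"
    using loewner_solution_iff_trunc[OF \<epsilon>(1), of \<tau> w X z] w by auto
  then show ?thesis by (auto simp: loewner_alive_def)
qed

text \<open>Applied with k = 0 to bound displacements by speed, and with k = 4 to compare the
  squared gap with uniform motion.\<close>

lemma vector_mean_value_bound:
  fixes f :: "real \<Rightarrow> 'a::real_normed_vector"
  assumes ab: "a \<le> b"
    and f: "\<And>s. s \<in> {a..b} \<Longrightarrow> (f has_vector_derivative f' s) (at s within {a..b})"
    and B: "\<And>s. s \<in> {a..b} \<Longrightarrow> norm (f' s - k) \<le> B"
  shows "norm (f b - f a - (b - a) *\<^sub>R k) \<le> B * (b - a)"
proof -
  define h where "h s = f s - s *\<^sub>R k" for s
  have "norm (h b - h a) \<le> B * norm (b - a)"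
  proof (rule differentiable_bound[of "{a..b}" h "\<lambda>s x. x *\<^sub>R (f' s - k)"])
    fix s assume s: "s \<in> {a..b}"
    have "(h has_vector_derivative (f' s - k)) (at s within {a..b})"
      unfolding h_def by (auto intro!: derivative_eq_intros f[OF s])
    then show "(h has_derivative (\<lambda>x. x *\<^sub>R (f' s - k))) (at s within {a..b})"
      by (simp add: has_vector_derivative_def)
    show "onorm (\<lambda>x. x *\<^sub>R (f' s - k)) \<le> B"
    proof (rule onorm_le)
      fix x :: real
      have "norm (x *\<^sub>R (f' s - k)) = norm (f' s - k) * \<bar>x\<bar>" by simp
      also have "\<dots> \<le> B * norm x" using B[OF s] by (auto intro!: mult_right_mono)
      finally show "norm (x *\<^sub>R (f' s - k)) \<le> B * norm x" .
    qed
  qed (use ab in auto)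
  then show ?thesis using ab by (simp add: h_def algebra_simps)
qed

text \<open>The derivative is bounded on each closed interval before \<open>T\<close>, with a bound
  that may degenerate at \<open>T\<close>. Every estimate in this locale is therefore local in
  time.\<close>

locale loewner_driver =
  fixes X X' :: "real \<Rightarrow> real" and T :: real
  assumes T_pos: "0 < T"
    and X_deriv: "\<And>s. s \<in> {0..<T} \<Longrightarrow> (X has_vector_derivative X' s) (at s within {0..<T})"
    and X'_bdd: "\<And>t. t \<in> {0..<T} \<Longrightarrow> \<exists>M. \<forall>s\<in>{0..t}. \<bar>X' s\<bar> \<le> M"
begin

section \<open>Injectivity, symmetry, imaginary parts and holomorphy of the flow\<close>

abbreviation g :: "real \<Rightarrow> complex \<Rightarrow> complex" where "g \<equiv> loewner_map X"
abbreviation alive :: "real \<Rightarrow> complex \<Rightarrow> bool" where "alive \<equiv> loewner_alive X"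

lemma X_cont: "continuous_on {0..<T} X"
  using X_deriv by (rule continuous_on_vector_derivative)

lemma X_cont': "t < T \<Longrightarrow> continuous_on {0..t} X"
  by (rule continuous_on_subset[OF X_cont]) auto

lemma g_solution: "alive t z \<Longrightarrow> 0 \<le> t \<Longrightarrow> t < T \<Longrightarrow> loewner_solution X z t (\<lambda>s. g s z)"
  using loewner_map_solution X_cont' by blast

lemma alive_mono: "alive t z \<Longrightarrow> s \<le> t \<Longrightarrow> alive s z"
  by (rule loewner_alive_mono)

lemma g_0: "z \<noteq> of_real (X 0) \<Longrightarrow> g 0 z = z"
  using g_solution[of 0 z] loewner_alive_0[of X z] T_pos by (simp add: loewner_solution_def)

lemma alive_neq: "alive t z \<Longrightarrow> 0 \<le> t \<Longrightarrow> z \<noteq> of_real (X 0)"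
  using loewner_alive_0 loewner_alive_mono by blast

lemma g_neq: "alive t z \<Longrightarrow> 0 \<le> t \<Longrightarrow> t < T \<Longrightarrow> g t z \<noteq> of_real (X t)"
  using g_solution[of t z] by (auto simp: loewner_solution_def)

lemma g_neq': "alive t z \<Longrightarrow> s \<in> {0..t} \<Longrightarrow> t < T \<Longrightarrow> g s z \<noteq> of_real (X s)"
  using g_neq[of s z] alive_mono[of t z s] by auto

lemma g_deriv:
  "alive t z \<Longrightarrow> t < T \<Longrightarrow> s \<in> {0..t} \<Longrightarrow>
    ((\<lambda>s. g s z) has_vector_derivative 2 / (g s z - of_real (X s))) (at s within {0..t})"
  using g_solution[of t z] by (auto simp: loewner_solution_def)

lemma g_cont: "alive t z \<Longrightarrow> t < T \<Longrightarrow> continuous_on {0..t} (\<lambda>s. g s z)"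
  using g_deriv by (rule continuous_on_vector_derivative)

text \<open>Since 2 / p - 2 / q is a multiple of p - q, the difference of two solutions satisfies a
  linear equation. The formula gives injectivity at once and, divided by z1 - z2, the difference
  quotient of the flow.\<close>

lemma g_diff:
  assumes "alive t z1" "alive t z2" "t < T" "0 \<le> t"
  shows "g t z1 - g t z2 =
    (z1 - z2) * exp (integral {0..t} (\<lambda>r. - 2 / ((g r z1 - of_real (X r)) * (g r z2 - of_real (X r)))))"
proof -
  have z: "z1 = g 0 z1" "z2 = g 0 z2" using g_0 alive_neq assms by auto
  have ne: "g r z1 - of_real (X r) \<noteq> 0" "g r z2 - of_real (X r) \<noteq> 0" if "r \<in> {0..t}" for r
    using g_neq' assms that by auto
  have "g t z1 - g t z2 = (g 0 z1 - g 0 z2) * exp (integral {0..t} (\<lambda>r. - 2 / ((g r z1 - of_real (X r)) * (g r z2 - of_real (X r)))))"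
  proof (rule linear_ode_exp[where t = t])
    show "continuous_on {0..t} (\<lambda>r. - 2 / ((g r z1 - of_real (X r)) * (g r z2 - of_real (X r))))"
      using assms ne by (intro continuous_intros g_cont X_cont') auto
    fix s assume s: "s \<in> {0..t}"
    have eq: "2 / a - 2 / b = - 2 / (a * b) * (a - b)" if "a \<noteq> 0" "b \<noteq> 0" for a b :: complex
      using that by (simp add: divide_simps)
    show "((\<lambda>t. g t z1 - g t z2) has_vector_derivative
         - 2 / ((g s z1 - of_real (X s)) * (g s z2 - of_real (X s))) * (g s z1 - g s z2)) (at s within {0..t})"
      using has_vector_derivative_diff[OF g_deriv g_deriv, OF assms(1,3) s assms(2,3) s] eq[OF ne[OF s]]
      by (elim has_vector_derivative_subset_eq) auto
  qed (use assms in auto)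
  then show ?thesis using z by simp
qed

lemma g_inj: "alive t z1 \<Longrightarrow> alive t z2 \<Longrightarrow> t < T \<Longrightarrow> 0 \<le> t \<Longrightarrow> g t z1 = g t z2 \<longleftrightarrow> z1 = z2"
  using g_diff[of t z1 z2] by auto

lemma g_cnj: "alive t z \<Longrightarrow> t < T \<Longrightarrow> 0 \<le> t \<Longrightarrow> g t (cnj z) = cnj (g t z)"
  using loewner_map_eq[OF loewner_solution_cnj[OF g_solution[of t z]] X_cont'] by simp

text \<open>The imaginary part satisfies a linear equation with negative coefficient, so its sign is
  preserved and its modulus decreases.\<close>

lemma Im_g:
  assumes "alive t z" "t < T" "0 \<le> t"
  shows "Im (g t z) = Im z * exp (integral {0..t} (\<lambda>r. - 2 / (norm (g r z - of_real (X r)))\<^sup>2))"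
proof -
  have z: "z = g 0 z" using g_0 alive_neq assms by auto
  have ne: "g r z - of_real (X r) \<noteq> 0" if "r \<in> {0..t}" for r
    using g_neq' assms that by auto
  have "Im (g t z) = Im (g 0 z) * exp (integral {0..t} (\<lambda>r. - 2 / (norm (g r z - of_real (X r)))\<^sup>2))"
  proof (rule linear_ode_exp[where t = t])
    show "continuous_on {0..t} (\<lambda>r. - 2 / (norm (g r z - of_real (X r)))\<^sup>2)"
      using assms ne by (intro continuous_intros g_cont X_cont') auto
    fix s assume s: "s \<in> {0..t}"
    have "((\<lambda>t. Im (g t z)) has_vector_derivative Im (2 / (g s z - of_real (X s)))) (at s within {0..t})"
      using bounded_linear.has_vector_derivative[OF bounded_linear_Im g_deriv[OF assms(1,2) s]] .
    moreover have "Im (2 / (g s z - of_real (X s))) = - 2 / (norm (g s z - of_real (X s)))\<^sup>2 * Im (g s z)"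
      by (simp add: Im_divide cmod_def)
    ultimately show "((\<lambda>t. Im (g t z)) has_vector_derivative
       - 2 / (norm (g s z - of_real (X s)))\<^sup>2 * Im (g s z)) (at s within {0..t})"
      by simp
  qed (use assms in auto)
  then show ?thesis using z by simp
qed

lemma Im_g_pos_iff: "alive t z \<Longrightarrow> t < T \<Longrightarrow> 0 \<le> t \<Longrightarrow> Im (g t z) > 0 \<longleftrightarrow> Im z > 0"
  using Im_g[of t z] by (simp add: zero_less_mult_iff)

lemma Im_g_0_iff: "alive t z \<Longrightarrow> t < T \<Longrightarrow> 0 \<le> t \<Longrightarrow> Im (g t z) = 0 \<longleftrightarrow> Im z = 0"
  using Im_g[of t z] by simp

lemma g_real: "alive t (of_real a) \<Longrightarrow> t < T \<Longrightarrow> 0 \<le> t \<Longrightarrow> g t (of_real a) = of_real (Re (g t (of_real a)))"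
  using Im_g_0_iff[of t "of_real a"] by (simp add: complex_eq_iff)

lemma Im_g_antimono:
  assumes "alive t z" "t < T" "0 \<le> s" "s \<le> t"
  shows "\<bar>Im (g t z)\<bar> \<le> \<bar>Im (g s z)\<bar>"
proof -
  let ?f = "\<lambda>r. - 2 / (norm (g r z - of_real (X r)))\<^sup>2"
  have ne: "g r z - of_real (X r) \<noteq> 0" if "r \<in> {0..t}" for r
    using g_neq' assms that by auto
  have "continuous_on {0..t} ?f"
    using assms ne by (intro continuous_intros g_cont X_cont') auto
  then have int: "?f integrable_on {0..t}" by (rule integrable_continuous_interval)
  then have "integral {0..s} ?f + integral {s..t} ?f = integral {0..t} ?f"
    using assms by (intro Henstock_Kurzweil_Integration.integral_combine int) auto
  moreover have "?f integrable_on {s..t}"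
    using assms by (intro integrable_on_subinterval[OF int]) auto
  then have "integral {s..t} ?f \<le> integral {s..t} (\<lambda>_. 0)"
    by (rule integral_le) auto
  ultimately have "integral {0..t} ?f \<le> integral {0..s} ?f" by simp
  then show ?thesis
    using Im_g[OF assms(1,2)] Im_g[OF alive_mono[OF assms(1,4)]] assms
    by (simp add: abs_mult mult_left_mono)
qed

lemma Im_g_le: "alive t z \<Longrightarrow> t < T \<Longrightarrow> 0 \<le> t \<Longrightarrow> \<bar>Im (g t z)\<bar> \<le> \<bar>Im z\<bar>"
  using Im_g_antimono[of t z 0] g_0[of z] alive_neq[of t z] by auto

text \<open>The constants of \<open>loewner_alive_nbhd\<close>, bundled: one radius, one gap and one
  Lipschitz constant serve all times up to \<open>t + \<eta>\<close>.\<close>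

definition stable_nbhd :: "real \<Rightarrow> complex \<Rightarrow> real \<Rightarrow> real \<Rightarrow> real \<Rightarrow> real \<Rightarrow> bool" where
  "stable_nbhd t z \<eta> \<delta> e C \<longleftrightarrow> 0 < \<eta> \<and> t + \<eta> < T \<and> 0 < \<delta> \<and> 0 < e \<and>
    (\<forall>z'\<in>ball z e. alive (t + \<eta>) z' \<and> (\<forall>s\<in>{0..t + \<eta>}.
       \<delta> \<le> norm (g s z' - of_real (X s)) \<and> norm (g s z' - g s z) \<le> C * norm (z' - z)))"

lemma stable_nbhdD:
  assumes "stable_nbhd t z \<eta> \<delta> e C"
  shows "0 < \<eta>" "t + \<eta> < T" "0 < \<delta>" "0 < e"
    "\<And>z'. z' \<in> ball z e \<Longrightarrow> alive (t + \<eta>) z'"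
    "\<And>z' s. z' \<in> ball z e \<Longrightarrow> s \<in> {0..t + \<eta>} \<Longrightarrow> \<delta> \<le> norm (g s z' - of_real (X s))"
    "\<And>z' s. z' \<in> ball z e \<Longrightarrow> s \<in> {0..t + \<eta>} \<Longrightarrow> norm (g s z' - g s z) \<le> C * norm (z' - z)"
  using assms by (auto simp: stable_nbhd_def)

lemma stable_nbhd_exists:
  assumes "alive t z" "0 \<le> t" "t < T"
  obtains \<eta> \<delta> e C where "stable_nbhd t z \<eta> \<delta> e C"
proof (rule loewner_alive_nbhd[OF assms(1) X_cont' assms(2), of "(t + T) / 2"])
  fix \<eta> \<delta> e C assume "t + \<eta> \<le> (t + T) / 2" "0 < \<eta>" "0 < \<delta>" "0 < e"
    "\<And>z'. z' \<in> ball z e \<Longrightarrow> alive (t + \<eta>) z'"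
    "\<And>z' s. z' \<in> ball z e \<Longrightarrow> s \<in> {0..t + \<eta>} \<Longrightarrow> \<delta> \<le> norm (g s z' - of_real (X s))"
    "\<And>z' s. z' \<in> ball z e \<Longrightarrow> s \<in> {0..t + \<eta>} \<Longrightarrow> norm (g s z' - g s z) \<le> C * norm (z' - z)"
  then show ?thesis using assms by (intro that[of \<eta> \<delta> e C]) (auto simp: stable_nbhd_def)
qed (use assms in auto)

lemma g_isCont: "alive t z \<Longrightarrow> 0 \<le> t \<Longrightarrow> t < T \<Longrightarrow> isCont (g t) z"
proof -
  assume t: "alive t z" "0 \<le> t" "t < T"
  then obtain \<eta> \<delta> e C where st: "stable_nbhd t z \<eta> \<delta> e C"
    by (rule stable_nbhd_exists)
  note n = stable_nbhdD[OF st]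
  have "((\<lambda>z'. g t z' - g t z) \<longlongrightarrow> 0) (at z)"
  proof (rule Lim_null_comparison)
    show "\<forall>\<^sub>F z' in at z. norm (g t z' - g t z) \<le> C * norm (z' - z)"
      using eventually_at_ball[OF n(4), of z UNIV]
      by eventually_elim (rule n(7), use n(1) t(2) in auto)
    show "((\<lambda>z'. C * norm (z' - z)) \<longlongrightarrow> 0) (at z)" by (auto intro!: tendsto_eq_intros)
  qed
  then show ?thesis by (simp add: isCont_def LIM_zero_cancel)
qed

text \<open>By \<open>g_diff\<close> the difference quotient is the exponential of an integral
  \<open>F z'\<close>. The uniform gap and Lipschitz constant of a stable neighbourhood make the
  integrands converge uniformly in time, so \<open>F\<close> is continuous at \<open>z\<close> and
  the quotient has a limit.\<close>

lemma g_field_differentiable: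
  assumes al: "alive t z" and t: "0 \<le> t" "t < T"
  shows "g t field_differentiable (at z)"
proof -
  obtain \<eta> \<delta> e C where st: "stable_nbhd t z \<eta> \<delta> e C"
    by (rule stable_nbhd_exists[OF assms])
  note n = stable_nbhdD[OF st]
  define F where "F z' = integral {0..t} (\<lambda>r. - 2 / ((g r z' - of_real (X r)) * (g r z - of_real (X r))))" for z'
  have al': "alive t z'" if "z' \<in> ball z e" for z' using n(5)[OF that] alive_mono n(1) by auto
  have int: "(\<lambda>r. - 2 / ((g r z' - of_real (X r)) * (g r z - of_real (X r)))) integrable_on {0..t}" if "z' \<in> ball z e" for z'
    by (intro integrable_continuous_interval continuous_intros g_cont X_cont' al' al that t)
      (use g_neq' al'[OF that] al t in auto)
  have z: "z \<in> ball z e" using n by auto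
  have "(F \<longlongrightarrow> F z) (at z)"
  proof -
    have "((\<lambda>z'. F z' - F z) \<longlongrightarrow> 0) (at z)"
    proof (rule Lim_null_comparison)
      show "\<forall>\<^sub>F z' in at z. norm (F z' - F z) \<le> (2 * C * norm (z' - z) / (\<delta> * \<delta> * \<delta>)) * (t - 0)"
        using eventually_at_ball[OF n(4), of z UNIV]
      proof eventually_elim
        case (elim z')
        then have z': "z' \<in> ball z e" by auto
        have Feq: "F z' - F z = integral {0..t} (\<lambda>r. - 2 / ((g r z' - of_real (X r)) * (g r z - of_real (X r)))
            - (- 2 / ((g r z - of_real (X r)) * (g r z - of_real (X r)))))"
          unfolding F_def by (rule Henstock_Kurzweil_Integration.integral_diff[OF int[OF z'] int[OF z], symmetric])
        have "norm (F z' - F z) \<le> integral {0..t} (\<lambda>r. 2 * C * norm (z' - z) / (\<delta> * \<delta> * \<delta>))"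
          unfolding Feq
        proof (rule integral_norm_bound_integral)
          show "(\<lambda>r. - 2 / ((g r z' - of_real (X r)) * (g r z - of_real (X r)))
            - (- 2 / ((g r z - of_real (X r)) * (g r z - of_real (X r))))) integrable_on {0..t}"
            by (rule integrable_diff[OF int[OF z'] int[OF z]])
          fix r assume r: "r \<in> {0..t}"
          define a where "a = g r z' - of_real (X r)"
          define b where "b = g r z - of_real (X r)"
          have r': "r \<in> {0..t + \<eta>}" using r n(1) by simp
          have ab: "\<delta> \<le> norm a" "\<delta> \<le> norm b" "norm (a - b) \<le> C * norm (z' - z)"
            using n(6)[OF z' r'] n(6)[OF z r'] n(7)[OF z' r'] unfolding a_def b_def by simp_all
          then have "a \<noteq> 0" "b \<noteq> 0" using n(3) by auto
          then have eq: "- 2 / (a * b) - (- 2 / (b * b)) = 2 * (a - b) / (a * b * b)"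
            by (simp add: field_simps)
          have "norm (- 2 / (a * b) - (- 2 / (b * b))) = 2 * norm (a - b) / (norm a * norm b * norm b)"
            unfolding eq norm_divide norm_mult by simp
          also have "\<dots> \<le> 2 * (C * norm (z' - z)) / (\<delta> * \<delta> * \<delta>)"
          proof (rule frac_le)
            show "0 \<le> 2 * (C * norm (z' - z))" using order_trans[OF norm_ge_zero ab(3)] by simp
            show "\<delta> * \<delta> * \<delta> \<le> norm a * norm b * norm b"
              using ab(1,2) n(3) by (intro mult_mono) auto
            show "0 < \<delta> * \<delta> * \<delta>" using n(3) by simp
            show "2 * norm (a - b) \<le> 2 * (C * norm (z' - z))" using ab(3) by linarith
          qed
          finally show "norm (- 2 / ((g r z' - of_real (X r)) * (g r z - of_real (X r)))
            - (- 2 / ((g r z - of_real (X r)) * (g r z - of_real (X r))))) \<le> 2 * C * norm (z' - z) / (\<delta> * \<delta> * \<delta>)"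
            unfolding a_def b_def by (simp only: mult.assoc)
        qed (rule integrable_const_ivl)
        then show ?case using t by (simp add: mult_ac)
      qed
      show "((\<lambda>z'. (2 * C * norm (z' - z) / (\<delta> * \<delta> * \<delta>)) * (t - 0)) \<longlongrightarrow> 0) (at z)"
        using n(3) by (auto intro!: tendsto_eq_intros)
    qed
    then show ?thesis by (simp add: LIM_zero_cancel)
  qed
  then have lim: "((\<lambda>z'. exp (F z')) \<longlongrightarrow> exp (F z)) (at z)" by (intro tendsto_intros)
  have "(g t has_field_derivative exp (F z)) (at z)"
    unfolding has_field_derivative_iff
  proof (rule Lim_transform_eventually[OF lim])
    show "\<forall>\<^sub>F z' in at z. exp (F z') = (g t z' - g t z) / (z' - z)"
      using eventually_at_ball[OF n(4), of z UNIV] eventually_neq_at_within[of z z UNIV]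
    proof eventually_elim
      case (elim z')
      then show ?case using g_diff[OF al'[of z'] al t(2,1)] by (simp add: F_def)
    qed
  qed
  then show ?thesis by (auto simp: field_differentiable_def)
qed

lemma g_holomorphic: "0 \<le> t \<Longrightarrow> t < T \<Longrightarrow> S \<subseteq> {z. alive t z} \<Longrightarrow> g t holomorphic_on S"
  unfolding holomorphic_on_def
  using g_field_differentiable field_differentiable_at_within by blast

end

section \<open>Swallowed points\<close>

lemma Re_mult_cnj: "Re (a * cnj b) = Re a * Re b + Im a * Im b"
  by simp

context loewner_driver
begin

text \<open>The square \<open>(u - X)\<^sup>2\<close> has derivative \<open>4 - 2 X' (u - X)\<close>, which is close to \<open>4\<close> as long as
  the square is small; a solution that nearly collides with \<open>X\<close> at time \<open>s2\<close> is therefore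
  controlled on a time interval whose length depends on the bound for \<open>X'\<close> only.\<close>

lemma square_estimate:
  assumes s: "0 \<le> s1" "s1 \<le> s2" "s2 < T" and M: "\<And>s. s \<in> {0..s2} \<Longrightarrow> \<bar>X' s\<bar> \<le> M"
    and al: "alive s2 z"
    and small: "norm ((g s2 z - of_real (X s2))\<^sup>2) + 5 * (s2 - s1) < (1 / (2 * M + 1))\<^sup>2"
  shows "norm ((g s1 z - of_real (X s1))\<^sup>2 - (g s2 z - of_real (X s2))\<^sup>2 + of_real (4 * (s2 - s1))) \<le> s2 - s1"
    "norm ((g s1 z - of_real (X s1))\<^sup>2) < (1 / (2 * M + 1))\<^sup>2"
proof -
  define v where "v s = (g s z - of_real (X s))\<^sup>2" for s
  \<comment> \<open>With this size 2 M d is at most 1. So while the gap is at most \<open>d\<close>,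
    the velocity of its square deviates from 4 by at most 1.\<close>
  define d where "d = 1 / (2 * M + 1)"
  have M0: "0 \<le> M" using M[of s2] s by fastforce
  have d: "0 < d" "2 * M * d \<le> 1" using M0 by (auto simp: d_def field_simps)
  have v': "(v has_vector_derivative of_real 4 - of_real (2 * X' s) * (g s z - of_real (X s))) (at s within {0..s2})"
    if s': "s \<in> {0..s2}" for s
  proof -
    have "(X has_vector_derivative X' s) (at s within {0..s2})"
      by (rule has_vector_derivative_within_subset[OF X_deriv]) (use s' s in auto)
    then have X: "((\<lambda>s. complex_of_real (X s)) has_vector_derivative of_real (X' s)) (at s within {0..s2})"
      using bounded_linear.has_vector_derivative[OF bounded_linear_of_real] by blast
    have D: "((\<lambda>s. g s z - of_real (X s)) has_vector_derivative (2 / (g s z - of_real (X s)) - of_real (X' s))) (at s within {0..s2})"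
      using g_deriv[OF al s(3) s'] X by (intro has_vector_derivative_diff)
    have "g s z - of_real (X s) \<noteq> 0" using g_neq'[OF al s' s(3)] by simp
    moreover have "p * (2 / p - x) + (2 / p - x) * p = 4 - 2 * x * p" if "p \<noteq> 0" for p x :: complex
      using that by (simp add: field_simps)
    ultimately show ?thesis
      using has_vector_derivative_mult[OF D D] unfolding v_def power2_eq_square by simp
  qed
  have vcont: "continuous_on {0..s2} v" using v' by (rule continuous_on_vector_derivative)
  have est: "norm (v s2 - v a - of_real (4 * (s2 - a))) \<le> s2 - a"
    if a: "a \<in> {s1..s2}" and le: "\<And>s. s \<in> {a..s2} \<Longrightarrow> norm (v s) \<le> d\<^sup>2" for a
  proof -
    have "norm (v s2 - v a - (s2 - a) *\<^sub>R (of_real 4)) \<le> 1 * (s2 - a)"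
    proof (rule vector_mean_value_bound)
      fix r assume r: "r \<in> {a..s2}"
      then show "(v has_vector_derivative of_real 4 - of_real (2 * X' r) * (g r z - of_real (X r))) (at r within {a..s2})"
        using a s by (intro has_vector_derivative_within_subset[OF v']) auto
      have "(norm (g r z - of_real (X r)))\<^sup>2 \<le> d\<^sup>2"
        using le[OF r] by (simp add: v_def norm_power)
      then have "norm (g r z - of_real (X r)) \<le> d" using d by (simp add: abs_le_square_iff[symmetric])
      moreover have "\<bar>X' r\<bar> \<le> M" using M[of r] r a s by auto
      ultimately have "2 * \<bar>X' r\<bar> * norm (g r z - of_real (X r)) \<le> 2 * M * d"
        using M0 by (intro mult_mono) auto
      then show "norm (of_real 4 - of_real (2 * X' r) * (g r z - of_real (X r)) - of_real 4) \<le> 1"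
        using d(2) by (simp add: norm_mult)
    qed (use a in auto)
    then show ?thesis by (simp add: scaleR_conv_of_real mult.commute)
  qed
  have lt: "norm (v s) < d\<^sup>2" if s': "s \<in> {s1..s2}" for s
  proof (rule ccontr)
    assume neg: "\<not> norm (v s) < d\<^sup>2"
    \<comment> \<open>After the last time at which the bound fails, \<open>est\<close> applies and
      gives at that time a norm of at most |v s2| + (4 + 1) (s2 - a), which is below the
      threshold.\<close>
    define S where "S = {r \<in> {s1..s2}. d\<^sup>2 \<le> norm (v r)}"
    have "closed S" unfolding S_def
      using s by (intro continuous_on_closed_Collect_le continuous_intros continuous_on_subset[OF vcont]) auto
    moreover have "bounded S" by (rule bounded_subset[of "{s1..s2}"]) (auto simp: S_def)
    moreover have "S \<noteq> {}" using neg s' by (auto simp: S_def)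
    ultimately obtain a where a: "a \<in> S" "\<And>r. r \<in> S \<Longrightarrow> r \<le> a"
      using compact_attains_sup[of S] by (auto simp: compact_eq_bounded_closed)
    have as2: "a < s2"
      using a(1) small s by (cases "a = s2") (auto simp: S_def v_def d_def)
    have "norm (v r) \<le> d\<^sup>2" if "r \<in> {a..s2}" for r
    proof (rule continuous_le_on_closure[of "{a<..s2}" "\<lambda>r. norm (v r)"])
      show "continuous_on (closure {a<..s2}) (\<lambda>r. norm (v r))"
        using as2 a(1) s by (auto intro!: continuous_intros continuous_on_subset[OF vcont] simp: S_def)
      show "r \<in> closure {a<..s2}" using that as2 by simp
      fix r assume "r \<in> {a<..s2}"
      then show "norm (v r) \<le> d\<^sup>2" using a(1) a(2)[of r] by (force simp: S_def)
    qed
    then have "norm (v s2 - v a - of_real (4 * (s2 - a))) \<le> s2 - a"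
      using a(1) by (intro est) (auto simp: S_def)
    moreover have "norm (v a) \<le> norm (v s2 - v a - of_real (4 * (s2 - a))) + norm (v s2) + norm (complex_of_real (4 * (s2 - a)))"
      using norm_triangle_ineq4[of "v s2" "v s2 - v a - of_real (4 * (s2 - a)) + of_real (4 * (s2 - a))"]
        norm_triangle_ineq[of "v s2 - v a - of_real (4 * (s2 - a))" "of_real (4 * (s2 - a))"] by simp
    moreover have "norm (complex_of_real (4 * (s2 - a))) = 4 * (s2 - a)"
      unfolding norm_of_real using as2 by simp
    ultimately have "norm (v a) \<le> norm (v s2) + 5 * (s2 - a)" by simp
    also have "\<dots> \<le> norm (v s2) + 5 * (s2 - s1)" using a(1) by (auto simp: S_def)
    also have "\<dots> < d\<^sup>2" using small by (simp add: v_def d_def)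
    finally show False using a(1) by (simp add: S_def)
  qed
  have "norm (v s2 - v s1 - of_real (4 * (s2 - s1))) \<le> s2 - s1"
    using lt s by (intro est) (auto intro: less_imp_le)
  then show "norm ((g s1 z - of_real (X s1))\<^sup>2 - (g s2 z - of_real (X s2))\<^sup>2 + of_real (4 * (s2 - s1))) \<le> s2 - s1"
    by (subst norm_minus_cancel[symmetric]) (simp add: v_def algebra_simps)
  show "norm ((g s1 z - of_real (X s1))\<^sup>2) < (1 / (2 * M + 1))\<^sup>2"
    using lt[of s1] s by (simp add: v_def d_def)
qed

definition killed :: "real \<Rightarrow> complex \<Rightarrow> bool" where
  "killed \<tau> z \<longleftrightarrow> 0 < \<tau> \<and> \<tau> < T \<and> (\<forall>s\<in>{0..<\<tau>}. alive s z) \<and> \<not> alive \<tau> z"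

text \<open>The infimum of the times at which \<open>z\<close> is not alive is again such a time,
  because being alive extends slightly beyond any time at which it holds. It is positive because
  \<open>z\<close> is alive at time 0.\<close>

lemma killed_exists:
  assumes z: "z \<noteq> of_real (X 0)" and t: "0 \<le> t" "t < T" "\<not> alive t z"
  obtains \<tau> where "\<tau> \<in> {0<..t}" "killed \<tau> z"
proof -
  define S where "S = {s \<in> {0..t}. \<not> alive s z}"
  have S: "t \<in> S" "bdd_below S" using t by (auto simp: S_def)
  define \<tau> where "\<tau> = Inf S"
  have \<tau>t: "\<tau> \<le> t" unfolding \<tau>_def using S by (rule cInf_lower)
  have \<tau>0: "0 \<le> \<tau>" unfolding \<tau>_def using S by (intro cInf_greatest) (auto simp: S_def)
  have below: "alive s z" if "0 \<le> s" "s < \<tau>" for s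
    using that cInf_lower[of s S] S \<tau>t by (force simp: \<tau>_def S_def)
  have "\<not> alive \<tau> z"
  proof
    assume al: "alive \<tau> z"
    have "\<tau> < T" using \<tau>t t by simp
    then obtain \<eta> \<delta> e C where st: "stable_nbhd \<tau> z \<eta> \<delta> e C" using stable_nbhd_exists[OF al \<tau>0] by blast
    note n = stable_nbhdD[OF st]
    have "alive (\<tau> + \<eta>) z" using n by auto
    then have "\<tau> + \<eta> \<le> s" if "s \<in> S" for s
      using that alive_mono[of "\<tau> + \<eta>" z s] by (cases "s \<le> \<tau> + \<eta>") (auto simp: S_def)
    then have "\<tau> + \<eta> \<le> \<tau>" unfolding \<tau>_def using S by (intro cInf_greatest) auto
    then show False using n by simp
  qed
  moreover have "0 < \<tau>"
    using \<open>\<not> alive \<tau> z\<close> \<tau>0 loewner_alive_0[of X z] z by (cases "\<tau> = 0") auto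
  ultimately show ?thesis using that[of \<tau>] \<tau>t t below by (auto simp: killed_def)
qed

lemma killed_small:
  assumes k: "killed \<tau> z" and "0 < \<delta>" "s0 < \<tau>"
  obtains s where "s0 \<le> s" "0 \<le> s" "s < \<tau>" "norm (g s z - of_real (X s)) < \<delta>"
proof (rule ccontr)
  assume neg: "\<not> thesis"
  note main = that
  have "\<delta> \<le> norm (g s z - of_real (X s))" if "s \<in> {max 0 s0..<\<tau>}" for s
    using that main[of s] neg by (fastforce simp: not_less)
  then have "alive \<tau> z"
    using assms by (intro loewner_alive_limit[of \<tau> X z "max 0 s0" \<delta>] X_cont') (auto simp: killed_def)
  then show False using k by (simp add: killed_def)
qed

lemma killed_alive: "killed \<tau> z \<Longrightarrow> s < \<tau> \<Longrightarrow> alive s z"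
  using alive_mono[of "max 0 s" z s] by (auto simp: killed_def)

text \<open>Apply \<open>square_estimate\<close> backwards from times just before
  \<open>\<tau>\<close> at which the gap is arbitrarily small, and let these times tend to
  \<open>\<tau>\<close>.\<close>

lemma killed_square:
  assumes k: "killed \<tau> z" and M: "\<And>s. s \<in> {0..\<tau>} \<Longrightarrow> \<bar>X' s\<bar> \<le> M"
    and s: "0 \<le> s" "s < \<tau>" "5 * (\<tau> - s) < (1 / (2 * M + 1))\<^sup>2"
  shows "norm ((g s z - of_real (X s))\<^sup>2 + of_real (4 * (\<tau> - s))) \<le> \<tau> - s"
proof (rule field_le_epsilon)
  fix e :: real assume e: "0 < e"
  \<comment> \<open>The square at \<open>s2\<close> contributes at most \<open>\<epsilon>\<close>
    and the time shift 4 (\<tau> - s2) at most \<open>4 * \<epsilon>\<close>, hence the fifths. The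
    bound 1 makes the square of a gap below \<open>\<epsilon>\<close> at most
    \<open>\<epsilon>\<close>.\<close>
  define \<epsilon> where "\<epsilon> = Min {e / 5, ((1 / (2 * M + 1))\<^sup>2 - 5 * (\<tau> - s)) / 5, 1}"
  have \<epsilon>: "0 < \<epsilon>" "5 * \<epsilon> \<le> e" "5 * \<epsilon> \<le> (1 / (2 * M + 1))\<^sup>2 - 5 * (\<tau> - s)" "\<epsilon> \<le> 1"
    using e s by (auto simp: \<epsilon>_def min_def)
  obtain s2 where s2: "max s (\<tau> - \<epsilon>) \<le> s2" "0 \<le> s2" "s2 < \<tau>" "norm (g s2 z - of_real (X s2)) < \<epsilon>"
    using killed_small[OF k \<epsilon>(1), of "max s (\<tau> - \<epsilon>)"] s \<epsilon> by auto
  let ?v2 = "(g s2 z - of_real (X s2))\<^sup>2"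
  have "(norm (g s2 z - of_real (X s2)))\<^sup>2 \<le> \<epsilon> * 1"
    unfolding power2_eq_square using s2(4) \<epsilon> by (intro mult_mono) auto
  then have v2: "norm ?v2 \<le> \<epsilon>" by (simp add: norm_power)
  have "\<tau> < T" using k by (simp add: killed_def)
  have "norm ((g s z - of_real (X s))\<^sup>2 - ?v2 + of_real (4 * (s2 - s))) \<le> s2 - s"
  proof (rule square_estimate(1))
    have "norm ?v2 + 5 * (s2 - s) < 5 * \<epsilon> + 5 * (\<tau> - s)"
    proof -
      have "a + 5 * (s2 - s) < 5 * \<epsilon> + 5 * (\<tau> - s)" if "a \<le> \<epsilon>" for a
        using that \<epsilon>(1) s2(3) by argo
      then show ?thesis using v2 by blast
    qed
    then show "norm ?v2 + 5 * (s2 - s) < (1 / (2 * M + 1))\<^sup>2" using \<epsilon>(3) by linarith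
  qed (use s s2 \<open>\<tau> < T\<close> M killed_alive[OF k] in auto)
  moreover have "norm ((g s z - of_real (X s))\<^sup>2 + of_real (4 * (\<tau> - s)))
      \<le> norm ((g s z - of_real (X s))\<^sup>2 - ?v2 + of_real (4 * (s2 - s))) + (norm ?v2 + norm (complex_of_real (4 * (\<tau> - s2))))"
  proof -
    have "(g s z - of_real (X s))\<^sup>2 + of_real (4 * (\<tau> - s)) =
      ((g s z - of_real (X s))\<^sup>2 - ?v2 + of_real (4 * (s2 - s))) + (?v2 + of_real (4 * (\<tau> - s2)))"
      by (simp add: algebra_simps)
    then show ?thesis
      by (simp only: order_trans[OF norm_triangle_ineq add_left_mono[OF norm_triangle_ineq]])
  qed
  moreover have "norm (complex_of_real (4 * (\<tau> - s2))) = 4 * (\<tau> - s2)"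
    unfolding norm_of_real using s2 by simp
  moreover have "n1 \<le> \<tau> - s + e"
    if "n2 \<le> s2 - s" "n1 \<le> n2 + (n3 + n4)" "n4 = 4 * (\<tau> - s2)" "n3 \<le> \<epsilon>" for n1 n2 n3 n4
  proof -
    have "\<tau> - \<epsilon> \<le> s2" using s2(1) by simp
    then show ?thesis using that \<epsilon>(1,2) by argo
  qed
  ultimately show "norm ((g s z - of_real (X s))\<^sup>2 + of_real (4 * (\<tau> - s))) \<le> \<tau> - s + e"
    using v2 by blast
qed

lemma X'_bddE:
  assumes "t < T"
  obtains M where "0 \<le> M" "\<And>s. s \<in> {0..t} \<Longrightarrow> \<bar>X' s\<bar> \<le> M"
proof (cases "0 \<le> t")
  case True
  then obtain M where "\<forall>s\<in>{0..t}. \<bar>X' s\<bar> \<le> M" using X'_bdd[of t] assms by auto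
  then show ?thesis using that[of "max 0 M"] by (auto simp: le_max_iff_disj)
qed (use that[of 0] in auto)

lemma killed_square_eventually:
  assumes k: "killed \<tau> z"
  obtains s0 where "0 \<le> s0" "s0 < \<tau>"
    "\<And>s. s0 \<le> s \<Longrightarrow> s < \<tau> \<Longrightarrow> norm ((g s z - of_real (X s))\<^sup>2 + of_real (4 * (\<tau> - s))) \<le> \<tau> - s"
proof -
  have \<tau>: "0 < \<tau>" "\<tau> < T" using k by (auto simp: killed_def)
  obtain M where M: "0 \<le> M" "\<And>s. s \<in> {0..\<tau>} \<Longrightarrow> \<bar>X' s\<bar> \<le> M" using X'_bddE[OF \<tau>(2)] by blast
  define d where "d = (1 / (2 * M + 1))\<^sup>2"
  have d: "0 < d" using M(1) by (simp add: d_def)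
  show ?thesis
  proof (rule that[of "max 0 (\<tau> - d / 6)"])
    fix s assume "max 0 (\<tau> - d / 6) \<le> s" "s < \<tau>"
    then show "norm ((g s z - of_real (X s))\<^sup>2 + of_real (4 * (\<tau> - s))) \<le> \<tau> - s"
      using d by (intro killed_square[OF k M(2)]) (auto simp: d_def[symmetric])
  qed (use \<tau> d in auto)
qed

text \<open>For the squared gap \<open>w\<close> and remaining lifetime \<open>c\<close>: shortly
  before being swallowed a point is displaced from the driver almost vertically, at a distance
  comparable to the square root of \<open>c\<close>.\<close>

lemma Re_sq_le:
  assumes "norm (w + of_real (4 * c)) \<le> c"
  shows "Re w \<le> - 3 * c" "norm w \<le> 5 * c" "0 \<le> c"
proof -
  show c: "0 \<le> c" using order_trans[OF norm_ge_zero assms] .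
  show "Re w \<le> - 3 * c" using complex_Re_le_cmod[of "w + of_real (4 * c)"] assms by simp
  have "norm w \<le> norm (w + of_real (4 * c)) + norm (complex_of_real (4 * c))"
    using norm_triangle_ineq4[of "w + of_real (4 * c)" "of_real (4 * c)"] by simp
  then show "norm w \<le> 5 * c" using assms c unfolding norm_of_real by simp
qed

text \<open>The squared gap of a real point is nonnegative, whereas just before swallowing it would
  be close to -4 (\<tau> - s).\<close>

lemma not_killed_real: "\<not> killed \<tau> (of_real a)"
proof
  assume k: "killed \<tau> (of_real a)"
  obtain s where s: "0 \<le> s" "s < \<tau>"
    "norm ((g s (of_real a) - of_real (X s))\<^sup>2 + of_real (4 * (\<tau> - s))) \<le> \<tau> - s"
    by (rule killed_square_eventually[OF k]) blast
  have "g s (of_real a) = of_real (Re (g s (of_real a)))"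
    using k s by (intro g_real killed_alive[OF k]) (auto simp: killed_def)
  then have "Re ((g s (of_real a) - of_real (X s))\<^sup>2) = (Re (g s (of_real a)) - X s)\<^sup>2"
    by (metis Re_complex_of_real of_real_diff of_real_power)
  then have "0 \<le> Re ((g s (of_real a) - of_real (X s))\<^sup>2)" by simp
  then show False using Re_sq_le(1)[OF s(3)] s(2) by simp
qed

lemma alive_real: "a \<noteq> X 0 \<Longrightarrow> 0 \<le> t \<Longrightarrow> t < T \<Longrightarrow> alive t (of_real a)"
  by (rule ccontr) (use killed_exists[of "of_real a" t] not_killed_real in auto)

lemma killed_tendsto:
  assumes k: "killed \<tau> z"
  shows "((\<lambda>s. g s z - of_real (X s)) \<longlongrightarrow> 0) (at_left \<tau>)"
proof -
  obtain s0 where s0: "0 \<le> s0" "s0 < \<tau>"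
    "\<And>s. s0 \<le> s \<Longrightarrow> s < \<tau> \<Longrightarrow> norm ((g s z - of_real (X s))\<^sup>2 + of_real (4 * (\<tau> - s))) \<le> \<tau> - s"
    by (rule killed_square_eventually[OF k]) blast
  show ?thesis
  proof (rule Lim_null_comparison)
    have "\<forall>\<^sub>F s in at_left \<tau>. s \<in> {s0<..<\<tau>}"
      using eventually_at_left_real[OF s0(2)] .
    then show "\<forall>\<^sub>F s in at_left \<tau>. norm (g s z - of_real (X s)) \<le> sqrt (5 * (\<tau> - s))"
    proof eventually_elim
      case (elim s)
      then have "norm ((g s z - of_real (X s))\<^sup>2) \<le> 5 * (\<tau> - s)" using Re_sq_le(2)[OF s0(3)] by simp
      then show ?case by (simp add: norm_power real_le_rsqrt)
    qed
    have "((\<lambda>s. sqrt (5 * (\<tau> - s))) \<longlongrightarrow> sqrt (5 * (\<tau> - \<tau>))) (at_left \<tau>)"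
      by (intro tendsto_intros)
    then show "((\<lambda>s. sqrt (5 * (\<tau> - s))) \<longlongrightarrow> 0) (at_left \<tau>)" by simp
  qed
qed

text \<open>Two points swallowed at the same time: close to that time both \<open>u\<^sub>i - X\<close> are close to a positive
  multiple of \<open>\<i>\<close>, so that the distance of the two solutions increases, while it tends to zero.\<close>

lemma killed_unique:
  assumes k1: "killed \<tau> z1" and k2: "killed \<tau> z2" and Im: "0 < Im z1" "0 < Im z2"
  shows "z1 = z2"
proof -
  have \<tau>: "0 < \<tau>" "\<tau> < T" using k1 by (auto simp: killed_def)
  obtain a1 where a1: "0 \<le> a1" "a1 < \<tau>"
    "\<And>s. a1 \<le> s \<Longrightarrow> s < \<tau> \<Longrightarrow> norm ((g s z1 - of_real (X s))\<^sup>2 + of_real (4 * (\<tau> - s))) \<le> \<tau> - s"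
    by (rule killed_square_eventually[OF k1]) blast
  obtain a2 where a2: "0 \<le> a2" "a2 < \<tau>"
    "\<And>s. a2 \<le> s \<Longrightarrow> s < \<tau> \<Longrightarrow> norm ((g s z2 - of_real (X s))\<^sup>2 + of_real (4 * (\<tau> - s))) \<le> \<tau> - s"
    by (rule killed_square_eventually[OF k2]) blast
  define a where "a = max a1 a2"
  have a: "0 \<le> a" "a < \<tau>" using a1 a2 by (auto simp: a_def)
  define N where "N s = (norm (g s z1 - g s z2))\<^sup>2" for s
  \<comment> \<open>Each squared gap has negative real part and each gap has positive imaginary
    part, so both lie in the sector |Re| < Im. The product of two numbers of this sector has
    negative real part.\<close>
  have Re_prod: "Re ((g s z1 - of_real (X s)) * (g s z2 - of_real (X s))) < 0" if s: "a \<le> s" "s < \<tau>" for s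
  proof -
    have "Re ((g s z1 - of_real (X s))\<^sup>2) < 0" "Re ((g s z2 - of_real (X s))\<^sup>2) < 0"
      using Re_sq_le(1)[OF a1(3)[of s]] Re_sq_le(1)[OF a2(3)[of s]] s by (auto simp: a_def)
    moreover have "0 < Im (g s z1)" "0 < Im (g s z2)"
      using s a \<tau> Im Im_g_pos_iff killed_alive[OF k1] killed_alive[OF k2] by auto
    moreover have "x1 * x2 < y1 * y2" if h: "x1\<^sup>2 < y1\<^sup>2" "x2\<^sup>2 < y2\<^sup>2" "0 < y1" "0 < y2" for x1 x2 y1 y2 :: real
    proof -
      have "\<bar>x1\<bar> < y1" "\<bar>x2\<bar> < y2" using h by (auto simp: abs_less_iff power2_less_imp_less[of "\<bar>_\<bar>"] intro: power2_less_imp_less abs_le_square_iff)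
      then have "\<bar>x1\<bar> * \<bar>x2\<bar> < y1 * y2" by (intro mult_strict_mono') auto
      then show ?thesis using abs_ge_self[of "x1 * x2"] by (simp add: abs_mult)
    qed
    ultimately show ?thesis by (simp add: power2_eq_square)
  qed
  have "N a \<le> N s" if s: "a \<le> s" "s < \<tau>" for s
  proof -
    have al: "alive s z1" "alive s z2" "s < T" using s \<tau> killed_alive[OF k1] killed_alive[OF k2] by auto
    have "\<exists>D. (N has_real_derivative D) (at r within {a..s}) \<and> 0 \<le> D" if r: "r \<in> {a..s}" for r
    proof -
      define p1 where "p1 = g r z1 - of_real (X r)"
      define p2 where "p2 = g r z2 - of_real (X r)"
      have r': "r \<in> {0..s}" using r a by auto
      have ne: "p1 \<noteq> 0" "p2 \<noteq> 0" using g_neq'[OF al(1) r' al(3)] g_neq'[OF al(2) r' al(3)] by (auto simp: p1_def p2_def)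
      let ?d = "g r z1 - g r z2"
      have eq: "2 / p1 - 2 / p2 = - 2 * ?d / (p1 * p2)" using ne by (simp add: divide_simps p1_def p2_def)
      have "((\<lambda>r. g r z1 - g r z2) has_vector_derivative (2 / p1 - 2 / p2)) (at r within {a..s})"
        using has_vector_derivative_diff[OF g_deriv[OF al(1,3) r'] g_deriv[OF al(2,3) r']] a
        unfolding p1_def p2_def by (elim has_vector_derivative_within_subset) auto
      from bounded_linear.has_vector_derivative[OF bounded_linear_Re this] bounded_linear.has_vector_derivative[OF bounded_linear_Im this]
      have D: "((\<lambda>r. Re (g r z1 - g r z2)) has_real_derivative Re (2 / p1 - 2 / p2)) (at r within {a..s})"
        "((\<lambda>r. Im (g r z1 - g r z2)) has_real_derivative Im (2 / p1 - 2 / p2)) (at r within {a..s})"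
        by (simp_all add: has_real_derivative_iff_has_vector_derivative)
      have N: "N = (\<lambda>r. (Re (g r z1 - g r z2))\<^sup>2 + (Im (g r z1 - g r z2))\<^sup>2)"
        by (rule ext) (simp add: N_def cmod_power2)
      have "(N has_real_derivative 2 * (Re (2 / p1 - 2 / p2) * Re ?d + Im (2 / p1 - 2 / p2) * Im ?d)) (at r within {a..s})"
      proof -
        have "((\<lambda>r. (u r)\<^sup>2 + (w r)\<^sup>2) has_real_derivative 2 * (A * u r + B * w r)) (at r within {a..s})"
          if "(u has_real_derivative A) (at r within {a..s})" "(w has_real_derivative B) (at r within {a..s})"
          for u w :: "real \<Rightarrow> real" and A B
          using that by (auto intro!: derivative_eq_intros)
        from this[OF D] show ?thesis unfolding N by simp
      qed
      moreover have e1: "Re (2 / p1 - 2 / p2) * Re ?d + Im (2 / p1 - 2 / p2) * Im ?d = Re ((2 / p1 - 2 / p2) * cnj ?d)"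
        by (rule Re_mult_cnj[symmetric])
      \<comment> \<open>For the difference d of the solutions, d' = -2 d / (p1 p2). So Re (d' cnj d)
        is a nonnegative multiple of -Re (p1 p2), which is nonnegative by
        \<open>Re_prod\<close>.\<close>
      moreover have e2: "(2 / p1 - 2 / p2) * cnj ?d = of_real (2 * (norm ?d)\<^sup>2 / (norm (p1 * p2))\<^sup>2) * (- cnj (p1 * p2))"
      proof -
        have "(2 / p1 - 2 / p2) * cnj ?d = - 2 * (?d * cnj ?d) / (p1 * p2)"
          unfolding eq by (simp only: times_divide_eq_left mult.assoc)
        also have "?d * cnj ?d = of_real ((norm ?d)\<^sup>2)" by (rule complex_norm_square[symmetric])
        also have "- 2 * of_real ((norm ?d)\<^sup>2) / (p1 * p2) = - 2 * of_real ((norm ?d)\<^sup>2) * cnj (p1 * p2) / of_real ((norm (p1 * p2))\<^sup>2)"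
          using ne by (simp add: complex_norm_square divide_simps del: of_real_power)
        finally show ?thesis by simp
      qed
      moreover have e3: "Re (of_real (2 * (norm ?d)\<^sup>2 / (norm (p1 * p2))\<^sup>2) * (- cnj (p1 * p2))) \<ge> 0"
      proof -
        have "Re (p1 * p2) \<le> 0" using Re_prod[of r] r s by (auto simp: p1_def p2_def)
        moreover have "0 \<le> Re (of_real c * (- cnj w))" if "0 \<le> c" "Re w \<le> 0" for c w
          using that by (simp add: mult_nonneg_nonpos)
        moreover have "0 \<le> 2 * (norm ?d)\<^sup>2 / (norm (p1 * p2))\<^sup>2" by simp
        ultimately show ?thesis by blast
      qed
      moreover have "0 \<le> Re (2 / p1 - 2 / p2) * Re ?d + Im (2 / p1 - 2 / p2) * Im ?d"
        unfolding e1 e2 by (rule e3)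
      then have "0 \<le> 2 * (Re (2 / p1 - 2 / p2) * Re ?d + Im (2 / p1 - 2 / p2) * Im ?d)"
        by (rule mult_nonneg_nonneg[rotated]) simp
      then show ?thesis
        using \<open>(N has_real_derivative 2 * (Re (2 / p1 - 2 / p2) * Re ?d + Im (2 / p1 - 2 / p2) * Im ?d)) (at r within {a..s})\<close>
        by blast
    qed
    note D = this
    show ?thesis
    proof (rule DERIV_nonneg_imp_increasing_open[OF s(1)])
      fix r assume "a < r" "r < s"
      then show "\<exists>y. (N has_real_derivative y) (at r) \<and> 0 \<le> y"
        using D[of r] at_within_Icc_at[of a r s] by auto
    next
      show "continuous_on {a..s} N"
        unfolding continuous_on_eq_continuous_within using D DERIV_continuous by blast
    qed
  qed
  moreover have "(N \<longlongrightarrow> 0) (at_left \<tau>)"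
    using tendsto_power[OF tendsto_norm[OF tendsto_diff[OF killed_tendsto[OF k1] killed_tendsto[OF k2]]], of 2]
    by (simp add: N_def[abs_def])
  moreover have "\<forall>\<^sub>F s in at_left \<tau>. s \<in> {a<..<\<tau>}"
    using eventually_at_left_real[OF a(2)] .
  ultimately have "N a \<le> 0"
    by (intro tendsto_lowerbound[of N 0 "at_left \<tau>"]) (auto elim!: eventually_mono)
  then have "g a z1 = g a z2" by (simp add: N_def)
  then show ?thesis using g_inj[of a z1 z2] killed_alive[OF k1] killed_alive[OF k2] a \<tau> by auto
qed

end

section \<open>Compactness of nearly swallowed points, and the trace\<close>

context loewner_driver
begin

text \<open>Going back from a near collision, the square of the gap moves left with velocity at
  least 3, and a square with very negative real part has a large imaginary part at its root. At
  still earlier times the imaginary part is only larger.\<close>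

lemma Im_lower_bound:
  assumes s: "0 \<le> s1" "s1 \<le> s2" "s2 < T" and M: "\<And>s. s \<in> {0..s2} \<Longrightarrow> \<bar>X' s\<bar> \<le> M"
    and al: "alive s2 z"
    and small: "norm ((g s2 z - of_real (X s2))\<^sup>2) + 5 * (s2 - s1) < (1 / (2 * M + 1))\<^sup>2"
    and r: "0 \<le> r" "r \<le> s1"
  shows "3 * (s2 - s1) - norm ((g s2 z - of_real (X s2))\<^sup>2) \<le> (Im (g r z))\<^sup>2"
proof -
  let ?w = "g s1 z - of_real (X s1)" and ?w2 = "g s2 z - of_real (X s2)"
  have "norm (?w\<^sup>2 - ?w2\<^sup>2 + of_real (4 * (s2 - s1))) \<le> s2 - s1"
    by (rule square_estimate(1)[OF s M al small])
  then have "Re (?w\<^sup>2 - ?w2\<^sup>2 + of_real (4 * (s2 - s1))) \<le> s2 - s1"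
    using complex_Re_le_cmod order_trans by blast
  moreover have "Re (?w\<^sup>2 - ?w2\<^sup>2 + of_real (4 * (s2 - s1))) = Re (?w\<^sup>2) - Re (?w2\<^sup>2) + 4 * (s2 - s1)"
    by (simp only: plus_complex.sel minus_complex.sel Re_complex_of_real)
  moreover have "Re (?w2\<^sup>2) \<le> norm (?w2\<^sup>2)" by (rule complex_Re_le_cmod)
  moreover have "- (Im (g s1 z))\<^sup>2 \<le> Re (?w\<^sup>2)" by (simp add: power2_eq_square)
  moreover have "b - a + 4 * c \<le> c \<Longrightarrow> a \<le> n \<Longrightarrow> - i \<le> b \<Longrightarrow> 3 * c - n \<le> i" for a b c i n :: real
    by argo
  ultimately have "3 * (s2 - s1) - norm (?w2\<^sup>2) \<le> (Im (g s1 z))\<^sup>2" by metis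
  also have "\<dots> \<le> (Im (g r z))\<^sup>2"
    using Im_g_antimono[of s1 z r] alive_mono[OF al s(2)] s r by (simp add: abs_le_square_iff)
  finally show ?thesis .
qed

text \<open>Go back from the near collision by a fixed time \<open>e\<close>. There the imaginary
  part is at least \<open>c\<close>, so the speed was at most 2 / c before. This bounds the starting
  point from above, and monotonicity of the imaginary part bounds it away from the real
  line.\<close>

lemma near_collision_bounds:
  assumes ab: "0 < a" "a \<le> b" "b < T"
  obtains c m R where "0 < c" "0 < m"
    "\<And>s z. s \<in> {a..b} \<Longrightarrow> 0 < Im z \<Longrightarrow> alive s z \<Longrightarrow> norm (g s z - of_real (X s)) < c \<Longrightarrow> m \<le> Im z \<and> norm z \<le> R"
proof -
  obtain M where M: "0 \<le> M" "\<And>s. s \<in> {0..b} \<Longrightarrow> \<bar>X' s\<bar> \<le> M" using X'_bddE[OF ab(3)] by blast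
  define d where "d = (1 / (2 * M + 1))\<^sup>2"
  have d: "0 < d" using M by (simp add: d_def)
  define e where "e = min a (d / 10)"
  have e: "0 < e" "e \<le> a" "10 * e \<le> d" using d ab by (auto simp: e_def)
  define c where "c = sqrt e"
  have c: "0 < c" "c\<^sup>2 = e" using e by (auto simp: c_def)
  have "compact (X ` {0..b})" using X_cont'[OF ab(3)] by (intro compact_continuous_image) auto
  then obtain K where K: "\<And>s. s \<in> {0..b} \<Longrightarrow> \<bar>X s\<bar> \<le> K"
    using compact_imp_bounded bounded_iff by (metis image_eqI real_norm_def)
  define R where "R = K + sqrt d + 2 / c * b"
  show ?thesis
  proof (rule that[of c c R])
    fix s2 z assume s2: "s2 \<in> {a..b}" and z: "0 < Im z" and al: "alive s2 z"
      and lt: "norm (g s2 z - of_real (X s2)) < c"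
    define s1 where "s1 = s2 - e"
    have s1: "0 \<le> s1" "s1 \<le> s2" "s2 < T" "s2 - s1 = e" using s2 e ab by (auto simp: s1_def)
    have v2: "norm ((g s2 z - of_real (X s2))\<^sup>2) < e"
      using lt c by (metis norm_ge_zero norm_power power_strict_mono zero_less_numeral)
    have small: "norm ((g s2 z - of_real (X s2))\<^sup>2) + 5 * (s2 - s1) < (1 / (2 * M + 1))\<^sup>2"
      using v2 s1(4) e unfolding d_def[symmetric] by argo
    have M': "\<bar>X' s\<bar> \<le> M" if "s \<in> {0..s2}" for s using M(2)[of s] that s2 by auto
    have Im: "c \<le> Im (g r z)" if r: "0 \<le> r" "r \<le> s1" for r
    proof -
      have "3 * (s2 - s1) - norm ((g s2 z - of_real (X s2))\<^sup>2) \<le> (Im (g r z))\<^sup>2"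
        by (rule Im_lower_bound[OF s1(1,2,3) M' al small r])
      then have "c\<^sup>2 \<le> (Im (g r z))\<^sup>2" using s1(4) v2 c(2) e(1) by argo
      moreover have "0 < Im (g r z)"
        using Im_g_pos_iff[of r z] alive_mono[OF al, of r] z r s1 by auto
      ultimately show ?thesis by (meson power2_le_imp_le less_imp_le)
    qed
    have z0: "g 0 z = z" using g_0 alive_neq[OF al] s1 by auto
    have al1: "alive s1 z" using alive_mono[OF al s1(2)] .
    have "norm (g s1 z - g 0 z - (s1 - 0) *\<^sub>R 0) \<le> 2 / c * (s1 - 0)"
    proof (rule vector_mean_value_bound)
      fix r assume r: "r \<in> {0..s1}"
      show "((\<lambda>s. g s z) has_vector_derivative 2 / (g r z - of_real (X r))) (at r within {0..s1})"
        using g_deriv[OF al1 _ r] s1 by simp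
      have "c \<le> norm (g r z - of_real (X r))"
        using Im[of r] r abs_Im_le_cmod[of "g r z - of_real (X r)"] by simp
      then show "norm (2 / (g r z - of_real (X r)) - 0) \<le> 2 / c"
        using c by (simp add: norm_divide frac_le)
    qed (use s1 in auto)
    then have "norm (g s1 z - z) \<le> 2 / c * s1" using z0 by simp
    also have "\<dots> \<le> 2 / c * b" using c s1 s2 by (intro mult_left_mono) auto
    finally have 1: "norm (g s1 z - z) \<le> 2 / c * b" .
    have "norm ((g s1 z - of_real (X s1))\<^sup>2) < d"
      using square_estimate(2)[OF s1(1,2,3) M' al small] by (simp add: d_def)
    then have "norm (g s1 z - of_real (X s1)) \<le> sqrt d"
      by (simp add: norm_power real_le_rsqrt)
    moreover have "\<bar>X s1\<bar> \<le> K" using K[of s1] s1 s2 by auto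
    moreover have "norm z \<le> norm (g s1 z - z) + norm (g s1 z - of_real (X s1)) + norm (complex_of_real (X s1))"
      using norm_triangle_ineq4[of "g s1 z" "g s1 z - z"] norm_triangle_ineq[of "g s1 z - of_real (X s1)" "of_real (X s1)"]
      by (simp add: algebra_simps)
    ultimately have "norm z \<le> R" using 1 unfolding R_def norm_of_real by linarith
    then show "c \<le> Im z \<and> norm z \<le> R" using Im[of 0] z0 s1 by simp
  qed (use c in auto)
qed

text \<open>The limit is not alive at \<open>\<tau>\<close>, since a stable neighbourhood would keep
  the gaps away from 0. It is not swallowed at an earlier \<tau>' either: the near collisions happen
  a definite time after \<tau>', so \<open>Im_lower_bound\<close> bounds the imaginary parts of the
  images from below before \<tau>', and this passes to the limit and contradicts
  \<open>killed_small\<close>.\<close>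

lemma killed_limit:
  assumes \<tau>: "0 < \<tau>" "\<tau> < T" and s: "s \<longlonglongrightarrow> \<tau>" and z: "Z \<longlonglongrightarrow> z" "0 < Im z"
    and al: "\<And>n. 0 \<le> s n" "\<And>n. s n < T" "\<And>n. alive (s n) (Z n)"
    and small: "(\<lambda>n. g (s n) (Z n) - of_real (X (s n))) \<longlonglongrightarrow> 0"
  shows "killed \<tau> z"
proof -
  have z0: "z \<noteq> of_real (X 0)" using z by auto
  have sball: "\<forall>\<^sub>F n in sequentially. Z n \<in> ball z e" if "0 < e" for e
    using tendstoD[OF z(1) that] by eventually_elim (simp add: dist_commute)
  have nal: "\<not> alive \<tau> z"
  proof
    assume "alive \<tau> z"
    then obtain \<eta> \<delta> e C where st: "stable_nbhd \<tau> z \<eta> \<delta> e C"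
      by (rule stable_nbhd_exists) (use \<tau> in auto)
    note n = stable_nbhdD[OF st]
    have "\<forall>\<^sub>F n in sequentially. s n < \<tau> + \<eta>" using order_tendstoD(2)[OF s] n by auto
    then have "\<forall>\<^sub>F n in sequentially. False"
      using sball[OF n(4)] tendstoD[OF small n(3)]
    proof eventually_elim
      case (elim k)
      then show ?case using n(6)[of "Z k" "s k"] al(1)[of k] by auto
    qed
    then show False by simp
  qed
  obtain \<tau>' where \<tau>': "\<tau>' \<in> {0<..\<tau>}" "killed \<tau>' z"
    using killed_exists[OF z0 _ \<tau>(2) nal] \<tau> by auto
  have "\<tau>' = \<tau>"
  proof (rule ccontr)
    assume "\<tau>' \<noteq> \<tau>"
    then have lt: "\<tau>' < \<tau>" using \<tau>' by auto
    define b where "b = (\<tau> + T) / 2"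
    have b: "\<tau> < b" "b < T" using \<tau> by (auto simp: b_def)
    obtain M where M: "0 \<le> M" "\<And>s. s \<in> {0..b} \<Longrightarrow> \<bar>X' s\<bar> \<le> M" using X'_bddE[OF b(2)] by blast
    define d where "d = (1 / (2 * M + 1))\<^sup>2"
    have d: "0 < d" using M by (simp add: d_def)
    define e where "e = min ((\<tau> - \<tau>') / 2) (d / 10)"
    have e: "0 < e" "2 * e \<le> \<tau> - \<tau>'" "10 * e \<le> d" using d lt by (auto simp: e_def min_def)
    have ev: "\<forall>\<^sub>F n in sequentially. e \<le> (Im (g r (Z n)))\<^sup>2" if r: "0 \<le> r" "r < \<tau>'" for r
    proof -
      have "(\<lambda>n. norm ((g (s n) (Z n) - of_real (X (s n)))\<^sup>2)) \<longlonglongrightarrow> norm ((0::complex)\<^sup>2)"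
        by (intro tendsto_intros small)
      then have "\<forall>\<^sub>F n in sequentially. norm ((g (s n) (Z n) - of_real (X (s n)))\<^sup>2) < e"
        using order_tendstoD(2) e(1) by fastforce
      moreover have "\<forall>\<^sub>F n in sequentially. s n < b" using order_tendstoD(2)[OF s b(1)] .
      moreover have "\<forall>\<^sub>F n in sequentially. \<tau>' + e < s n" using order_tendstoD(1)[OF s, of "\<tau>' + e"] e by auto
      ultimately show ?thesis
      proof eventually_elim
        case (elim n)
        have se: "s n - (s n - e) = e" by simp
        have "3 * (s n - (s n - e)) - norm ((g (s n) (Z n) - of_real (X (s n)))\<^sup>2) \<le> (Im (g r (Z n)))\<^sup>2"
        proof (rule Im_lower_bound[where M = M])
          show "norm ((g (s n) (Z n) - of_real (X (s n)))\<^sup>2) + 5 * (s n - (s n - e)) < (1 / (2 * M + 1))\<^sup>2"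
            using elim(1) e unfolding se d_def[symmetric] by argo
        qed (use elim \<tau>' e al M r in auto)
        then show ?case using elim(1) e(1) unfolding se by argo
      qed
    qed
    have "sqrt e \<le> norm (g r z - of_real (X r))" if r: "0 \<le> r" "r < \<tau>'" for r
    proof -
      have "isCont (g r) z" using g_isCont[of r z] killed_alive[OF \<tau>'(2)] r lt \<tau> by auto
      then have "(\<lambda>n. g r (Z n)) \<longlonglongrightarrow> g r z" using z(1) by (rule isCont_tendsto_compose)
      then have "(\<lambda>n. (Im (g r (Z n)))\<^sup>2) \<longlonglongrightarrow> (Im (g r z))\<^sup>2" by (intro tendsto_intros)
      then have "e \<le> (Im (g r z))\<^sup>2"
        by (rule tendsto_lowerbound[OF _ ev[OF r]]) simp
      then have "sqrt e \<le> \<bar>Im (g r z - of_real (X r))\<bar>" by (simp add: real_le_lsqrt real_sqrt_le_iff real_le_rsqrt sqrt_le_D real_sqrt_abs[symmetric] del: real_sqrt_abs)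
      then show ?thesis using abs_Im_le_cmod order_trans by blast
    qed
    moreover obtain r where "0 \<le> r" "r < \<tau>'" "norm (g r z - of_real (X r)) < sqrt e"
      using killed_small[OF \<tau>'(2), of "sqrt e" 0] e \<tau>' by auto
    ultimately show False by (meson not_le)
  qed
  then show ?thesis using \<tau>' by simp
qed

lemma killed_limit_exists:
  assumes \<tau>: "0 < \<tau>" "\<tau> < T" and s: "s \<longlonglongrightarrow> \<tau>"
    and al: "\<And>n. 0 \<le> s n" "\<And>n. s n < T" "\<And>n. alive (s n) (Z n)" "\<And>n. 0 < Im (Z n)"
    and small: "(\<lambda>n. g (s n) (Z n) - of_real (X (s n))) \<longlonglongrightarrow> 0"
  obtains z r where "strict_mono (r :: nat \<Rightarrow> nat)" "(Z \<circ> r) \<longlonglongrightarrow> z" "0 < Im z" "killed \<tau> z"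
proof -
  obtain c m R where cmR: "0 < c" "0 < m"
    "\<And>s z. s \<in> {\<tau> / 2..(\<tau> + T) / 2} \<Longrightarrow> 0 < Im z \<Longrightarrow> alive s z \<Longrightarrow> norm (g s z - of_real (X s)) < c \<Longrightarrow> m \<le> Im z \<and> norm z \<le> R"
    using near_collision_bounds[of "\<tau> / 2" "(\<tau> + T) / 2"] \<tau> by (auto simp: field_simps)
  have "\<forall>\<^sub>F n in sequentially. \<tau> / 2 < s n" "\<forall>\<^sub>F n in sequentially. s n < (\<tau> + T) / 2"
    "\<forall>\<^sub>F n in sequentially. dist (g (s n) (Z n) - of_real (X (s n))) 0 < c"
    using order_tendstoD(1)[OF s, of "\<tau> / 2"] order_tendstoD(2)[OF s, of "(\<tau> + T) / 2"] \<tau> tendstoD[OF small cmR(1)]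
    by auto
  then have "\<forall>\<^sub>F n in sequentially. m \<le> Im (Z n) \<and> norm (Z n) \<le> R"
  proof eventually_elim
    case (elim n)
    then show ?case using cmR(3)[of "s n" "Z n"] al[of n] by simp
  qed
  then obtain N where N: "\<And>n. N \<le> n \<Longrightarrow> m \<le> Im (Z n) \<and> norm (Z n) \<le> R"
    by (auto simp: eventually_sequentially)
  define S where "S = {z. m \<le> Im z} \<inter> cball 0 R"
  have "compact S" unfolding S_def
    by (intro closed_Int_compact closed_halfspace_Im_ge compact_cball)
  moreover have "\<forall>n. Z (n + N) \<in> S" using N by (auto simp: S_def)
  ultimately obtain z r where zr: "z \<in> S" "strict_mono r" "((\<lambda>n. Z (n + N)) \<circ> r) \<longlonglongrightarrow> z"
    using compact_imp_seq_compact[of S] unfolding seq_compact_def by metis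
  define r' where "r' n = r n + N" for n
  have r': "strict_mono r'" using zr(2) by (auto simp: r'_def strict_mono_def)
  have lim: "(Z \<circ> r') \<longlonglongrightarrow> z" using zr(3) by (simp add: o_def r'_def)
  have Imz: "0 < Im z" using zr(1) cmR by (simp add: S_def)
  have "killed \<tau> z"
  proof (rule killed_limit[OF \<tau> _ lim Imz])
    show "(s \<circ> r') \<longlonglongrightarrow> \<tau>" using LIMSEQ_subseq_LIMSEQ[OF s r'] .
    show "(\<lambda>n. g ((s \<circ> r') n) ((Z \<circ> r') n) - of_real (X ((s \<circ> r') n))) \<longlonglongrightarrow> 0"
      using LIMSEQ_subseq_LIMSEQ[OF small r'] by (simp add: o_def)
  qed (use al in auto)
  then show ?thesis using that[OF r' lim Imz] by blast
qed

text \<open>The backward flow exists in the upper half-plane since it increases the imaginary part; the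
  vector field is made globally Lipschitz by truncating the imaginary part from below.\<close>

lemma g_surj:
  assumes \<tau>: "0 \<le> \<tau>" "\<tau> < T" and w: "0 < Im w"
  obtains z where "0 < Im z" "alive \<tau> z" "g \<tau> z = w"
proof -
  define m where "m = Im w"
  define P where "P x = Complex (Re x) (max (Im x) m)" for x
  define f where "f t x = - 2 / (P x - of_real (X (\<tau> - t)))" for t x
  have m: "0 < m" using w by (simp add: m_def)
  have Pge: "m \<le> norm (P x - of_real a)" for x a
    using abs_Im_le_cmod[of "P x - of_real a"] by (simp add: P_def)
  have Pne: "P x - of_real a \<noteq> 0" for x a using Pge[of x a] m by auto
  have Plip: "norm (P x - P y) \<le> norm (x - y)" for x y
  proof -
    have "\<bar>max (Im x) m - max (Im y) m\<bar> \<le> \<bar>Im x - Im y\<bar>" by auto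
    then have "(max (Im x) m - max (Im y) m)\<^sup>2 \<le> (Im x - Im y)\<^sup>2" by (simp add: abs_le_square_iff)
    then show ?thesis by (simp add: P_def cmod_def real_sqrt_le_iff)
  qed
  have Pcont: "continuous_on UNIV P"
    unfolding P_def Complex_eq max_def[symmetric] by (intro continuous_intros)
  obtain U where U: "U 0 = w"
    "\<And>t. t \<in> {0..\<tau>} \<Longrightarrow> (U has_vector_derivative f t (U t)) (at t within {0..\<tau>})"
  proof (rule picard_global[of \<tau> "2 / m\<^sup>2" f w])
    show "continuous_on ({0..\<tau>} \<times> UNIV) (\<lambda>(t, x). f t x)"
      unfolding f_def case_prod_unfold using Pne \<tau>
      by (intro continuous_intros continuous_on_compose2[OF Pcont] continuous_on_compose2[OF X_cont'[OF \<tau>(2)]]) auto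
    fix t x y
    let ?a = "P x - of_real (X (\<tau> - t))" and ?b = "P y - of_real (X (\<tau> - t))"
    have "f t x - f t y = 2 * (P x - P y) / (?a * ?b)"
      unfolding f_def using Pne[of x "X (\<tau> - t)"] Pne[of y "X (\<tau> - t)"] by (simp add: divide_simps)
    then have "norm (f t x - f t y) = 2 * norm (P x - P y) / (norm ?a * norm ?b)"
      by (simp only: norm_divide norm_mult norm_numeral)
    also have "\<dots> \<le> 2 * norm (x - y) / (m * m)"
      using Plip m Pge by (intro frac_le mult_mono) auto
    finally show "norm (f t x - f t y) \<le> 2 / m\<^sup>2 * norm (x - y)" by (simp add: power2_eq_square)
  qed (use \<tau> m in auto)
  have ImU: "m \<le> Im (U t)" if t: "t \<in> {0..\<tau>}" for t
  proof -
    have "Im (U 0) \<le> Im (U t)"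
    proof (rule DERIV_nonneg_imp_increasing_open[of 0 t "\<lambda>t. Im (U t)"])
      show "0 \<le> t" using t by simp
      have D: "((\<lambda>t. Im (U t)) has_vector_derivative Im (f r (U r))) (at r within {0..\<tau>})" if "r \<in> {0..\<tau>}" for r
        using bounded_linear.has_vector_derivative[OF bounded_linear_Im U(2)[OF that]] .
      show "continuous_on {0..t} (\<lambda>t. Im (U t))"
        by (rule continuous_on_subset[OF continuous_on_vector_derivative[OF D]]) (use t in auto)
      fix r assume r: "0 < r" "r < t"
      have "((\<lambda>t. Im (U t)) has_real_derivative Im (f r (U r))) (at r)"
        using D[of r] r t at_within_Icc_at[of 0 r \<tau>] by (auto simp: has_real_derivative_iff_has_vector_derivative)
      moreover have "0 \<le> Im (f r (U r))"
        using m by (simp add: f_def P_def Im_divide) 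
      ultimately show "\<exists>y. ((\<lambda>t. Im (U t)) has_real_derivative y) (at r) \<and> 0 \<le> y" by blast
    qed
    then show ?thesis using U(1) by (simp add: m_def)
  qed
  have PU: "P (U t) = U t" if "t \<in> {0..\<tau>}" for t
    using ImU[OF that] by (simp add: P_def max_absorb1 complex_eq_iff)
  \<comment> \<open>Reversing time turns the backward flow started at \<open>w\<close> into a
    forward solution that ends at \<open>w\<close>.\<close>
  define u where "u s = U (\<tau> - s)" for s
  have "loewner_solution X (U \<tau>) \<tau> u"
    unfolding loewner_solution_def
  proof (intro conjI ballI)
    show "u 0 = U \<tau>" by (simp add: u_def)
    fix s assume s: "s \<in> {0..\<tau>}"
    then have s': "\<tau> - s \<in> {0..\<tau>}" by auto
    show "u s \<noteq> of_real (X s)" using ImU[OF s'] m by (auto simp: u_def)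
    have "((U \<circ> (\<lambda>s. \<tau> - s)) has_vector_derivative ((- 1) *\<^sub>R f (\<tau> - s) (U (\<tau> - s)))) (at s within {0..\<tau>})"
    proof (rule vector_diff_chain_within)
      show "((\<lambda>s. \<tau> - s) has_vector_derivative - 1) (at s within {0..\<tau>})"
        by (auto intro!: derivative_eq_intros)
      have "(\<lambda>s. \<tau> - s) ` {0..\<tau>} = {0..\<tau>}" by (auto simp: image_iff intro: bexI[of _ "\<tau> - _"])
      then show "(U has_vector_derivative f (\<tau> - s) (U (\<tau> - s))) (at (\<tau> - s) within (\<lambda>s. \<tau> - s) ` {0..\<tau>})"
        using U(2)[OF s'] by simp
    qed
    then show "(u has_vector_derivative 2 / (u s - of_real (X s))) (at s within {0..\<tau>})"
      using PU[OF s'] by (simp add: u_def[abs_def] f_def o_def)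
  qed
  then show ?thesis
    using that[of "U \<tau>"] loewner_map_eq[OF _ X_cont'[OF \<tau>(2)] \<tau>(1), of "U \<tau>" u] ImU[of \<tau>] m \<tau> U(1)
    by (force simp: loewner_alive_def u_def)
qed

text \<open>Pull back points X_\<tau> + \<i> / (n + 1) under the map at time \<open>\<tau>\<close>;
  their preimages have vanishing gaps at \<open>\<tau>\<close> and accumulate at a swallowed
  point.\<close>

lemma killed_point_exists:
  assumes \<tau>: "0 < \<tau>" "\<tau> < T"
  obtains z where "0 < Im z" "killed \<tau> z"
proof -
  have "\<exists>z. 0 < Im z \<and> alive \<tau> z \<and> g \<tau> z = Complex (X \<tau>) (inverse (real (Suc n)))" for n
    using g_surj[of \<tau> "Complex (X \<tau>) (inverse (real (Suc n)))"] \<tau> by auto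
  then obtain Z where Z: "\<And>n. 0 < Im (Z n)" "\<And>n. alive \<tau> (Z n)" "\<And>n. g \<tau> (Z n) = Complex (X \<tau>) (inverse (real (Suc n)))"
    by metis
  have "(\<lambda>n. g \<tau> (Z n) - of_real (X \<tau>)) = (\<lambda>n. \<i> * of_real (inverse (real (Suc n))))"
    unfolding Z Complex_eq by simp
  moreover have "(\<lambda>n. \<i> * complex_of_real (inverse (real (Suc n)))) \<longlonglongrightarrow> \<i> * of_real 0"
    by (intro tendsto_intros LIMSEQ_inverse_real_of_nat)
  ultimately have "(\<lambda>n. g \<tau> (Z n) - of_real (X \<tau>)) \<longlonglongrightarrow> 0" by simp
  then show ?thesis
    using killed_limit_exists[of \<tau> "\<lambda>_. \<tau>" Z] \<tau> Z that by (metis less_imp_le tendsto_const)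
qed

text \<open>The tip of the growing curve, described as the point swallowed at exactly that time
  instead of as a boundary limit of the inverse map. \<open>killed_point_exists\<close> and
  \<open>killed_unique\<close> justify the description.\<close>

definition trace :: "real \<Rightarrow> complex" where
  "trace t = (if t = 0 then of_real (X 0) else (THE z. 0 < Im z \<and> killed t z))"

lemma trace_killed: "0 < \<tau> \<Longrightarrow> \<tau> < T \<Longrightarrow> 0 < Im (trace \<tau>) \<and> killed \<tau> (trace \<tau>)"
proof -
  assume \<tau>: "0 < \<tau>" "\<tau> < T"
  then obtain z where "0 < Im z" "killed \<tau> z" by (rule killed_point_exists)
  then have "\<exists>!z. 0 < Im z \<and> killed \<tau> z" using killed_unique by blast
  from theI'[OF this] show ?thesis using \<tau> by (simp add: trace_def)
qed

lemma trace_eq: "0 < Im z \<Longrightarrow> killed \<tau> z \<Longrightarrow> trace \<tau> = z"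
  using killed_unique[of \<tau> "trace \<tau>" z] trace_killed[of \<tau>] by (auto simp: killed_def)

lemma killed_time_unique: "killed a z \<Longrightarrow> killed b z \<Longrightarrow> a = b"
  unfolding killed_def by (metis atLeastLessThan_iff less_imp_le linorder_neqE_linordered_idom)

lemma trace_inj: "inj_on trace {0..<T}"
proof (rule inj_onI)
  fix a b assume a: "a \<in> {0..<T}" and b: "b \<in> {0..<T}" and eq: "trace a = trace b"
  have "Im (trace t) = 0 \<longleftrightarrow> t = 0" if "t \<in> {0..<T}" for t
    using trace_killed[of t] that by (cases "t = 0") (auto simp: trace_def)
  from this[OF a] this[OF b] have "a = 0 \<longleftrightarrow> b = 0" using eq by simp
  then show "a = b"
    using a b eq trace_killed[of a] trace_killed[of b] killed_time_unique
    by (cases "a = 0"; cases "b = 0") (auto simp: less_le)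
qed

lemma hull_eq_trace:
  assumes t: "t \<in> {0..<T}"
  shows "loewner_hull X t = trace ` {0<..t}"
proof (intro set_eqI iffI)
  fix z assume "z \<in> loewner_hull X t"
  then have z: "0 < Im z" "\<not> alive t z" by (auto simp: loewner_hull_def)
  then have "z \<noteq> of_real (X 0)" by auto
  then obtain \<tau> where "\<tau> \<in> {0<..t}" "killed \<tau> z" using killed_exists[of z t] z t by auto
  then show "z \<in> trace ` {0<..t}" using trace_eq[OF z(1)] by blast
next
  fix z assume "z \<in> trace ` {0<..t}"
  then obtain \<tau> where \<tau>: "\<tau> \<in> {0<..t}" "z = trace \<tau>" by blast
  then have "0 < Im z" "killed \<tau> z" using trace_killed[of \<tau>] t by auto
  then show "z \<in> loewner_hull X t"
    using alive_mono[of t z \<tau>] \<tau> by (auto simp: loewner_hull_def killed_def)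
qed

text \<open>At time 0, \<open>killed_square\<close> with s = 0 bounds the distance to the starting
  point by sqrt (5 s). At a positive time, tips staying away from \<open>trace \<tau>\<close> would
  accumulate at a point swallowed at \<open>\<tau>\<close>, which by uniqueness is
  \<open>trace \<tau>\<close> itself.\<close>

lemma trace_continuous: "continuous_on {0..<T} trace"
  unfolding continuous_on_sequentially
proof (intro allI ballI impI, elim conjE)
  fix t :: "nat \<Rightarrow> real" and \<tau> assume \<tau>: "\<tau> \<in> {0..<T}" and t: "\<forall>n. t n \<in> {0..<T}" and lim: "t \<longlonglongrightarrow> \<tau>"
  show "(trace \<circ> t) \<longlonglongrightarrow> trace \<tau>"
  proof (cases "\<tau> = 0")
    case True
    obtain M where M: "0 \<le> M" "\<And>s. s \<in> {0..T / 2} \<Longrightarrow> \<bar>X' s\<bar> \<le> M" using X'_bddE[of "T / 2"] T_pos by auto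
    define d where "d = (1 / (2 * M + 1))\<^sup>2"
    have d: "0 < d" using M by (simp add: d_def)
    have est: "norm (trace s - of_real (X 0)) \<le> sqrt (5 * s)" if s: "0 \<le> s" "s < T / 2" "5 * s < d" for s
    proof (cases "s = 0")
      case False
      then have s': "0 < s" using s by simp
      have k: "killed s (trace s)" using trace_killed[of s] s' s T_pos by auto
      have "norm ((g 0 (trace s) - of_real (X 0))\<^sup>2 + of_real (4 * (s - 0))) \<le> s - 0"
        using s s' M by (intro killed_square[OF k, where M = M]) (auto simp: d_def[symmetric])
      moreover have "g 0 (trace s) = trace s"
        using trace_killed[of s] s s' T_pos by (intro g_0) auto
      ultimately have "norm ((trace s - of_real (X 0))\<^sup>2) \<le> 5 * s"
        using Re_sq_le(2)[of "(trace s - of_real (X 0))\<^sup>2" s] by simp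
      then show ?thesis by (simp add: norm_power real_le_rsqrt)
    qed (simp add: trace_def)
    have "(\<lambda>n. (trace \<circ> t) n - of_real (X 0)) \<longlonglongrightarrow> 0"
    proof (rule Lim_null_comparison)
      have "\<forall>\<^sub>F n in sequentially. t n < min (T / 2) (d / 5)"
        using order_tendstoD(2)[OF lim, of "min (T / 2) (d / 5)"] True T_pos d by auto
      then show "\<forall>\<^sub>F n in sequentially. norm ((trace \<circ> t) n - of_real (X 0)) \<le> sqrt (5 * t n)"
      proof eventually_elim
        case (elim n)
        then show ?case using est[of "t n"] t by simp
      qed
      show "(\<lambda>n. sqrt (5 * t n)) \<longlonglongrightarrow> 0"
        using tendsto_real_sqrt[OF tendsto_mult_left[OF lim, of 5]] True by simp
    qed
    moreover have "trace \<tau> = of_real (X 0)" using True by (simp add: trace_def)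
    ultimately show ?thesis by (simp only: LIM_zero_iff)
  next
    case False
    then have \<tau>0: "0 < \<tau>" "\<tau> < T" using \<tau> by auto
    show ?thesis
    proof (rule ccontr)
      assume "\<not> (trace \<circ> t) \<longlonglongrightarrow> trace \<tau>"
      then obtain e where e: "0 < e" "\<not> (\<forall>\<^sub>F n in sequentially. dist ((trace \<circ> t) n) (trace \<tau>) < e)"
        by (auto simp: tendsto_iff)
      have pos: "\<forall>\<^sub>F n in sequentially. 0 < t n" using order_tendstoD(1)[OF lim \<tau>0(1)] .
      have "\<exists>\<^sub>F n in sequentially. e \<le> dist (trace (t n)) (trace \<tau>) \<and> 0 < t n"
      proof (rule ccontr)
        assume "\<not> ?thesis"
        then have "\<forall>\<^sub>F n in sequentially. \<not> (e \<le> dist (trace (t n)) (trace \<tau>) \<and> 0 < t n)"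
          by (simp add: frequently_def)
        with pos have "\<forall>\<^sub>F n in sequentially. dist ((trace \<circ> t) n) (trace \<tau>) < e"
          by eventually_elim auto
        then show False using e(2) by simp
      qed
      then obtain r where r: "strict_mono (r :: nat \<Rightarrow> nat)" "\<And>n. e \<le> dist (trace (t (r n))) (trace \<tau>) \<and> 0 < t (r n)"
        by (metis (mono_tags, lifting) frequently_sequentially infinite_enumerate infinite_nat_iff_unbounded_le mem_Collect_eq)
      have tr: "(\<lambda>n. t (r n)) \<longlonglongrightarrow> \<tau>" using LIMSEQ_subseq_LIMSEQ[OF lim r(1)] by (simp add: o_def)
      define Z where "Z n = trace (t (r n))" for n
      have Z: "0 < Im (Z n)" "killed (t (r n)) (Z n)" for n
        using trace_killed[of "t (r n)"] r(2) t by (auto simp: Z_def)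
      \<comment> \<open>Each tip is dead at its own time, so near collisions are taken slightly
        earlier, when it is still alive and \<open>killed_limit_exists\<close> applies.\<close>
      have "\<exists>s. t (r n) - inverse (real (Suc n)) \<le> s \<and> 0 \<le> s \<and> s < t (r n) \<and> norm (g s (Z n) - of_real (X s)) < inverse (real (Suc n))" for n
        using killed_small[OF Z(2), of "inverse (real (Suc n))" "t (r n) - inverse (real (Suc n))" n] by force
      then obtain s where s: "\<And>n. t (r n) - inverse (real (Suc n)) \<le> s n" "\<And>n. 0 \<le> s n" "\<And>n. s n < t (r n)"
        "\<And>n. norm (g (s n) (Z n) - of_real (X (s n))) < inverse (real (Suc n))" by metis
      have slim: "s \<longlonglongrightarrow> \<tau>"
      proof (rule tendsto_sandwich)
        show "(\<lambda>n. t (r n) - inverse (real (Suc n))) \<longlonglongrightarrow> \<tau>"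
          using tendsto_diff[OF tr LIMSEQ_inverse_real_of_nat] by simp
        show "\<forall>\<^sub>F n in sequentially. s n \<le> t (r n)"
          using s(3) less_imp_le by (intro always_eventually allI) blast
      qed (use s tr in auto)
      have small: "(\<lambda>n. g (s n) (Z n) - of_real (X (s n))) \<longlonglongrightarrow> 0"
        by (rule Lim_null_comparison[OF _ LIMSEQ_inverse_real_of_nat], intro always_eventually allI less_imp_le s(4))
      have al: "s n < T" "alive (s n) (Z n)" for n
        using Z(2)[of n] s(3)[of n] killed_alive[OF Z(2) s(3)] by (simp_all add: killed_def)
      obtain z q where zq: "strict_mono (q :: nat \<Rightarrow> nat)" "(Z \<circ> q) \<longlonglongrightarrow> z" "0 < Im z" "killed \<tau> z"
        by (rule killed_limit_exists[OF \<tau>0 slim s(2) al Z(1) small])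
      have "z = trace \<tau>" using trace_eq[OF zq(3,4)] by simp
      then have "\<forall>\<^sub>F n in sequentially. dist ((Z \<circ> q) n) (trace \<tau>) < e" using tendstoD[OF zq(2) e(1)] by simp
      then have "\<forall>\<^sub>F n in sequentially. False"
        by eventually_elim (use r(2) in \<open>auto simp: Z_def not_less[symmetric]\<close>)
      then show False by simp
    qed
  qed
qed

end

section \<open>Conservation laws\<close>

text \<open>Recovers the polynomial of critical points from its values at the zeros and poles of the
  quotient; these values are what the flow is shown to control.\<close>

lemma lagrange_interpolation:
  fixes p :: "'a::field poly"
  assumes V: "finite V" and deg: "degree p < card V"
  shows "poly p w = (\<Sum>v\<in>V. poly p v * (\<Prod>l\<in>V - {v}. (w - l) / (v - l)))"
proof -
  define q where "q = (\<Sum>v\<in>V. smult (poly p v) (\<Prod>l\<in>V - {v}. smult (inverse (v - l)) [:- l, 1:]))"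
  have poly_q: "poly q w = (\<Sum>v\<in>V. poly p v * (\<Prod>l\<in>V - {v}. (w - l) / (v - l)))" for w
    unfolding q_def poly_sum poly_prod poly_smult by (simp add: divide_inverse mult.commute)
  have "degree q \<le> card V - 1"
    unfolding q_def
  proof (rule degree_sum_le[OF V], rule order_trans[OF degree_smult_le], rule order_trans[OF degree_prod_sum_le])
    fix v assume v: "v \<in> V"
    show "finite (V - {v})" using V by simp
    have "sum (degree \<circ> (\<lambda>l. smult (inverse (v - l)) [:- l, 1:])) (V - {v}) \<le> sum (\<lambda>_. 1) (V - {v})"
      by (intro sum_mono) (auto intro: order_trans[OF degree_smult_le])
    then show "sum (degree \<circ> (\<lambda>l. smult (inverse (v - l)) [:- l, 1:])) (V - {v}) \<le> card V - 1"
      using v V by simp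
  qed
  then have "degree (p - q) < card V"
    using deg by (intro degree_diff_less) auto
  moreover have "poly (p - q) v = 0" if v: "v \<in> V" for v
  proof -
    have "(\<Prod>l\<in>V - {u}. (v - l) / (u - l)) = (if u = v then 1 else 0)" if "u \<in> V" for u
    proof (cases "u = v")
      case False
      then have "v \<in> V - {u}" using v by simp
      then show ?thesis using V False by (auto simp: prod_zero_iff)
    next
      case True
      have "(\<Prod>l\<in>V - {v}. (v - l) / (v - l)) = 1" by (rule prod.neutral) auto
      then show ?thesis using True by simp
    qed
    then have "poly q v = (\<Sum>u\<in>V. poly p u * (if u = v then 1 else 0))"
      unfolding poly_q by (intro sum.cong) auto
    also have "\<dots> = poly p v" using v V by (simp add: if_distrib sum.delta cong: if_cong)
    finally show ?thesis by simp
  qed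
  ultimately have "p - q = 0"
    using card_mono[OF poly_roots_finite, of "p - q" V] card_poly_roots_bound[of "p - q"]
    by (metis (mono_tags, lifting) mem_Collect_eq not_le order_trans subsetI)
  then have "poly p w = poly q w" by simp
  also note poly_q
  finally show ?thesis .
qed

text \<open>The equation f' = c f instead of f' / f = c, so that \<open>f\<close> may vanish: in the
  conserved products a factor is identically 0 when the point is itself an atom.\<close>

definition has_log_derivative :: "real \<Rightarrow> (real \<Rightarrow> complex) \<Rightarrow> (real \<Rightarrow> complex) \<Rightarrow> bool" where
  "has_log_derivative t f c \<longleftrightarrow> continuous_on {0..t} c \<and>
     (\<forall>s\<in>{0..t}. (f has_vector_derivative c s * f s) (at s within {0..t}))"

lemma has_log_derivative_1: "has_log_derivative t (\<lambda>_. k) (\<lambda>_. 0)"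
  by (auto simp: has_log_derivative_def)

lemma has_log_derivative_mult:
  assumes f: "has_log_derivative t f c" and h: "has_log_derivative t h d"
  shows "has_log_derivative t (\<lambda>s. f s * h s) (\<lambda>s. c s + d s)"
  unfolding has_log_derivative_def
proof (intro conjI ballI)
  show "continuous_on {0..t} (\<lambda>s. c s + d s)"
    using f h by (auto simp: has_log_derivative_def intro!: continuous_intros)
  fix s assume s: "s \<in> {0..t}"
  have "(f has_vector_derivative c s * f s) (at s within {0..t})" "(h has_vector_derivative d s * h s) (at s within {0..t})"
    using f h s by (auto simp: has_log_derivative_def)
  from has_vector_derivative_mult[OF this]
  show "((\<lambda>s. f s * h s) has_vector_derivative (c s + d s) * (f s * h s)) (at s within {0..t})"
    by (rule has_vector_derivative_subset_eq) (auto simp: algebra_simps)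
qed

lemma has_log_derivative_prod:
  assumes "finite I" "\<And>i. i \<in> I \<Longrightarrow> has_log_derivative t (f i) (c i)"
  shows "has_log_derivative t (\<lambda>s. \<Prod>i\<in>I. f i s) (\<lambda>s. \<Sum>i\<in>I. c i s)"
  using assms
proof (induction rule: finite_induct)
  case empty
  then show ?case using has_log_derivative_1[of t 1] by simp
next
  case (insert i I)
  then show ?case using has_log_derivative_mult[of t "f i" "c i"] by simp
qed

text \<open>The constants \<open>k\<close> and \<open>l\<close> allow a comparison up to constant
  factors, so that a quotient identity can be propagated in cross-multiplied form.\<close>

lemma has_log_derivative_unique:
  assumes f: "has_log_derivative t f c" and h: "has_log_derivative t h d"
    and cd: "\<And>s. s \<in> {0..t} \<Longrightarrow> c s = d s" and s: "s \<in> {0..t}" and 0: "f 0 * k = h 0 * l"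
  shows "f s * k = h s * l"
proof -
  have c: "continuous_on {0..t} c" and d: "continuous_on {0..t} d"
    using f h by (auto simp: has_log_derivative_def)
  have "f s = f 0 * exp (integral {0..s} c)"
    by (rule linear_ode_exp[OF c _ s]) (use f in \<open>auto simp: has_log_derivative_def\<close>)
  moreover have "h s = h 0 * exp (integral {0..s} d)"
    by (rule linear_ode_exp[OF d _ s]) (use h in \<open>auto simp: has_log_derivative_def\<close>)
  moreover have "integral {0..s} c = integral {0..s} d"
    using cd s by (intro integral_cong) auto
  ultimately show ?thesis using 0 by simp
qed

section \<open>Logarithmic derivatives along the flow, and the invariants of the chain\<close>

context loewner_driver
begin

lemma X_complex_deriv:
  assumes "t < T" "s \<in> {0..t}"
  shows "((\<lambda>s. complex_of_real (X s)) has_vector_derivative of_real (X' s)) (at s within {0..t})"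
proof -
  have "(X has_vector_derivative X' s) (at s within {0..t})"
    by (rule has_vector_derivative_within_subset[OF X_deriv]) (use assms in auto)
  then show ?thesis
    using bounded_linear.has_vector_derivative[OF bounded_linear_of_real] by blast
qed

lemma diff_log_derivative:
  assumes a: "alive t a" and b: "alive t b" and t: "t < T"
  shows "has_log_derivative t (\<lambda>s. g s a - g s b)
     (\<lambda>s. - 2 / ((g s a - of_real (X s)) * (g s b - of_real (X s))))"
  unfolding has_log_derivative_def
proof (intro conjI ballI)
  have ne: "g s a - of_real (X s) \<noteq> 0" "g s b - of_real (X s) \<noteq> 0" if "s \<in> {0..t}" for s
    using g_neq' assms that by auto
  show "continuous_on {0..t} (\<lambda>s. - 2 / ((g s a - of_real (X s)) * (g s b - of_real (X s))))"
    using assms ne by (intro continuous_intros g_cont X_cont') auto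
  fix s assume s: "s \<in> {0..t}"
  have eq: "2 / p - 2 / q = - 2 / (p * q) * (p - q)" if "p \<noteq> 0" "q \<noteq> 0" for p q :: complex
    using that by (simp add: divide_simps)
  show "((\<lambda>s. g s a - g s b) has_vector_derivative
      - 2 / ((g s a - of_real (X s)) * (g s b - of_real (X s))) * (g s a - g s b)) (at s within {0..t})"
    using has_vector_derivative_diff[OF g_deriv[OF a t s] g_deriv[OF b t s]] eq[OF ne[OF s]]
    by (elim has_vector_derivative_subset_eq) auto
qed

lemma gap_log_derivative:
  assumes a: "alive t a" and t: "t < T" and X': "continuous_on {0..t} X'"
  shows "has_log_derivative t (\<lambda>s. g s a - of_real (X s))
     (\<lambda>s. (2 / (g s a - of_real (X s)) - of_real (X' s)) / (g s a - of_real (X s)))"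
  unfolding has_log_derivative_def
proof (intro conjI ballI)
  have ne: "g s a - of_real (X s) \<noteq> 0" if "s \<in> {0..t}" for s
    using g_neq' assms that by auto
  show "continuous_on {0..t} (\<lambda>s. (2 / (g s a - of_real (X s)) - of_real (X' s)) / (g s a - of_real (X s)))"
    using assms ne by (intro continuous_intros g_cont X_cont') auto
  fix s assume s: "s \<in> {0..t}"
  show "((\<lambda>s. g s a - of_real (X s)) has_vector_derivative
      (2 / (g s a - of_real (X s)) - of_real (X' s)) / (g s a - of_real (X s)) * (g s a - of_real (X s))) (at s within {0..t})"
    using has_vector_derivative_diff[OF g_deriv[OF a t s] X_complex_deriv[OF t s]] ne[OF s]
    by (elim has_vector_derivative_subset_eq) auto
qed

end

locale sle_data =
  fixes x0 :: real and Y :: "real set" and A :: "complex set" and \<kappa> :: complex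
  assumes finY: "finite Y" and x0Y: "x0 \<notin> Y" and finA: "finite A"
    and A_nonreal: "\<And>a. a \<in> A \<Longrightarrow> Im a \<noteq> 0" and A_cnj: "A \<inter> cnj ` A = {}"
    and cardYA: "card Y + 3 = 2 * card A" and \<kappa>: "\<kappa> \<noteq> 0"
begin

definition U :: "complex set" where "U = A \<union> cnj ` A"
definition S :: "complex set" where "S = complex_of_real ` Y \<union> U"
definition charge :: "complex \<Rightarrow> real" where
  "charge a = (if a \<in> complex_of_real ` Y then 2 else if a \<in> U then - 2 else 0)"
text \<open>The residue of B' / B at a zero or pole of B.\<close>

definition sgnA :: "complex \<Rightarrow> complex" where "sgnA a = (if a \<in> A then 1 else - 1)"

lemma finU: "finite U" and finS: "finite S"
  using finA finY by (auto simp: U_def S_def)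

lemma U_nonreal: "a \<in> U \<Longrightarrow> Im a \<noteq> 0"
  using A_nonreal by (auto simp: U_def)

lemma cnj_U: "cnj ` U = U"
  by (auto simp: U_def image_Un image_image)

lemma cardU: "card U = 2 * card A"
  unfolding U_def using A_cnj finA by (simp add: card_Un_disjoint card_image inj_on_def)

lemma YU_disjoint: "complex_of_real ` Y \<inter> U = {}"
  using U_nonreal by force

lemma sum_charge: "(\<Sum>a\<in>S. of_real (charge a) * f a) = (\<Sum>y\<in>Y. 2 * f (of_real y)) - (\<Sum>l\<in>U. 2 * f l)"
  for f :: "complex \<Rightarrow> complex"
proof -
  have "(\<Sum>a\<in>S. of_real (charge a) * f a) = (\<Sum>a\<in>complex_of_real ` Y. of_real (charge a) * f a) + (\<Sum>a\<in>U. of_real (charge a) * f a)"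
    unfolding S_def using finY finU YU_disjoint by (intro sum.union_disjoint) auto
  also have "(\<Sum>a\<in>complex_of_real ` Y. of_real (charge a) * f a) = (\<Sum>y\<in>Y. 2 * f (of_real y))"
    by (subst sum.reindex) (auto simp: charge_def inj_on_def)
  also have "(\<Sum>a\<in>U. of_real (charge a) * f a) = (\<Sum>l\<in>U. - (2 * f l))"
    using YU_disjoint by (intro sum.cong) (auto simp: charge_def)
  finally show ?thesis by (simp add: sum_negf)
qed

lemma sum_U_sgn: "(\<Sum>a\<in>U. sgnA a * f a) = (\<Sum>a\<in>A. f a) - (\<Sum>a\<in>A. f (cnj a))"
  for f :: "complex \<Rightarrow> complex"
proof -
  have "(\<Sum>a\<in>U. sgnA a * f a) = (\<Sum>a\<in>A. sgnA a * f a) + (\<Sum>a\<in>cnj ` A. sgnA a * f a)"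
    unfolding U_def using finA A_cnj by (intro sum.union_disjoint) auto
  also have "(\<Sum>a\<in>A. sgnA a * f a) = (\<Sum>a\<in>A. f a)"
    by (intro sum.cong) (auto simp: sgnA_def)
  also have "(\<Sum>a\<in>cnj ` A. sgnA a * f a) = (\<Sum>a\<in>cnj ` A. - f a)"
    using A_cnj by (intro sum.cong) (auto simp: sgnA_def)
  also have "\<dots> = (\<Sum>a\<in>A. - f (cnj a))"
    by (subst sum.reindex) (auto simp: inj_on_def)
  finally show ?thesis by (simp add: sum_negf)
qed

end

text \<open>The clause \<open>initial\<close> says that B' / B, with residues \<open>sgnA\<close>,
  has the critical points as its zeros. It records this at the points of \<open>U\<close> only,
  where a single term of the Wronskian survives; these values determine the polynomial.\<close>

locale sle_chain = sle_data x0 Y A \<kappa> + loewner_driver X X' T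
  for x0 Y A \<kappa> X X' T +
  assumes X0: "X 0 = x0"
    and alive_U: "\<And>a t. a \<in> U \<Longrightarrow> 0 \<le> t \<Longrightarrow> t < T \<Longrightarrow> loewner_alive X t a"
    and X'_eq: "\<And>t. t \<in> {0..<T} \<Longrightarrow> X' t = Re (\<Sum>a\<in>S. of_real (charge a) / (of_real (X t) - loewner_map X t a))"
    and initial: "\<And>\<zeta>. \<zeta> \<in> U \<Longrightarrow>
       (\<zeta> - of_real x0) * (\<Prod>y\<in>Y. \<zeta> - of_real y) = \<kappa> * sgnA \<zeta> * (\<Prod>l\<in>U - {\<zeta>}. \<zeta> - l)"
begin

lemma alive_Y: "y \<in> Y \<Longrightarrow> 0 \<le> t \<Longrightarrow> t < T \<Longrightarrow> alive t (of_real y)"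
  using alive_real[of y t] X0 x0Y by auto

lemma alive_S: "a \<in> S \<Longrightarrow> 0 \<le> t \<Longrightarrow> t < T \<Longrightarrow> alive t a"
  using alive_Y alive_U by (auto simp: S_def)

lemma X'_complex:
  assumes t: "t \<in> {0..<T}"
  shows "of_real (X' t) = (\<Sum>y\<in>Y. 2 / (of_real (X t) - g t (of_real y))) - (\<Sum>l\<in>U. 2 / (of_real (X t) - g t l))"
proof -
  let ?f = "\<lambda>a. 1 / (of_real (X t) - g t a)"
  have t': "0 \<le> t" "t < T" using t by auto
  have cf: "cnj (?f a) = ?f (cnj a)" if "a \<in> S" for a
    using g_cnj[OF alive_S[OF that t']] t' by simp
  have sum_eq: "(\<Sum>a\<in>S. of_real (charge a) / (of_real (X t) - g t a)) = (\<Sum>y\<in>Y. 2 * ?f (of_real y)) - (\<Sum>l\<in>U. 2 * ?f l)"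
    using sum_charge[of ?f] by simp
  have "cnj (\<Sum>l\<in>U. 2 * ?f l) = (\<Sum>l\<in>U. 2 * ?f (cnj l))"
    using cf by (simp only: cnj_sum complex_cnj_mult complex_cnj_numeral) (intro sum.cong, auto simp: S_def)
  also have "\<dots> = (\<Sum>l\<in>cnj ` U. 2 * ?f l)"
    by (subst sum.reindex) (auto simp: inj_on_def)
  finally have U: "cnj (\<Sum>l\<in>U. 2 * ?f l) = (\<Sum>l\<in>U. 2 * ?f l)" by (simp add: cnj_U)
  have "cnj (\<Sum>y\<in>Y. 2 * ?f (of_real y)) = (\<Sum>y\<in>Y. 2 * ?f (of_real y))"
    using cf[of "of_real _"] by (simp only: cnj_sum complex_cnj_mult complex_cnj_numeral) (intro sum.cong, auto simp: S_def)
  then have "cnj (\<Sum>a\<in>S. of_real (charge a) / (of_real (X t) - g t a)) = (\<Sum>a\<in>S. of_real (charge a) / (of_real (X t) - g t a))"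
    unfolding sum_eq using U by simp
  then have "of_real (X' t) = (\<Sum>a\<in>S. of_real (charge a) / (of_real (X t) - g t a))"
    using X'_eq[OF t] by (metis Reals_cnj_iff of_real_Re)
  then show ?thesis unfolding sum_eq by simp
qed

lemma X'_cont: "t < T \<Longrightarrow> continuous_on {0..t} X'"
proof -
  assume t: "t < T"
  have "continuous_on {0..t} (\<lambda>t. Re (\<Sum>a\<in>S. of_real (charge a) / (of_real (X t) - g t a)))"
  proof (cases "0 \<le> t")
    case True
    show ?thesis
      using g_neq'[OF alive_S[OF _ True t]] t by (intro continuous_intros g_cont alive_S True X_cont') fastforce+
  qed simp
  then show ?thesis by (rule continuous_on_eq) (use t X'_eq in auto)
qed

text \<open>Both sides have the same logarithmic derivative. In that of g_t(\<zeta>) - X_t the drift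
  appears, and the charges 2 and -2 make it cancel the contributions of all other factors.\<close>

lemma residue_invariant:
  assumes \<zeta>: "\<zeta> \<in> U" and t: "0 \<le> t" "t < T"
  shows "(g t \<zeta> - of_real (X t)) * (\<Prod>y\<in>Y. g t \<zeta> - g t (of_real y)) = \<kappa> * sgnA \<zeta> * (\<Prod>l\<in>U - {\<zeta>}. g t \<zeta> - g t l)"
proof -
  let ?w = "\<lambda>s a. g s a - of_real (X s)"
  have al: "alive t a" if "a \<in> S" for a using alive_S[OF that t] .
  have ne: "?w s a \<noteq> 0" if "s \<in> {0..t}" "a \<in> S" for s a
    using g_neq'[OF al[OF that(2)] that(1) t(2)] by simp
  have US: "a \<in> U \<Longrightarrow> a \<in> S" and YS: "y \<in> Y \<Longrightarrow> complex_of_real y \<in> S" for a y by (auto simp: S_def)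
  have num: "has_log_derivative t (\<lambda>s. ?w s \<zeta> * (\<Prod>y\<in>Y. g s \<zeta> - g s (of_real y)))
      (\<lambda>s. (2 / ?w s \<zeta> - of_real (X' s)) / ?w s \<zeta> + (\<Sum>y\<in>Y. - 2 / (?w s \<zeta> * ?w s (of_real y))))"
    using \<zeta> by (intro has_log_derivative_mult has_log_derivative_prod gap_log_derivative diff_log_derivative finY al X'_cont t) (auto simp: US YS)
  have den: "has_log_derivative t (\<lambda>s. \<Prod>l\<in>U - {\<zeta>}. g s \<zeta> - g s l) (\<lambda>s. \<Sum>l\<in>U - {\<zeta>}. - 2 / (?w s \<zeta> * ?w s l))"
    using \<zeta> finU by (intro has_log_derivative_prod diff_log_derivative al t) (auto simp: US)
  have g0: "g 0 a = a" if "a \<in> S" for a using g_0 alive_neq[OF al[OF that] t(1)] by auto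
  have "(?w t \<zeta> * (\<Prod>y\<in>Y. g t \<zeta> - g t (of_real y))) * 1 = (\<Prod>l\<in>U - {\<zeta>}. g t \<zeta> - g t l) * (\<kappa> * sgnA \<zeta>)"
  proof (rule has_log_derivative_unique[OF num den])
    show "?w 0 \<zeta> * (\<Prod>y\<in>Y. g 0 \<zeta> - g 0 (of_real y)) * 1 = (\<Prod>l\<in>U - {\<zeta>}. g 0 \<zeta> - g 0 l) * (\<kappa> * sgnA \<zeta>)"
      using initial[OF \<zeta>] \<zeta> by (simp add: g0 US YS X0 mult_ac)
    fix s assume s: "s \<in> {0..t}"
    have w: "?w s \<zeta> \<noteq> 0" using ne[OF s] \<zeta> US by auto
    have X'eq: "of_real (X' s) = (\<Sum>l\<in>U. 2 / ?w s l) - (\<Sum>y\<in>Y. 2 / ?w s (of_real y))"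
    proof -
      have "2 / (of_real (X s) - a) = - (2 / (a - of_real (X s)))" for a :: complex
        by (metis minus_diff_eq minus_divide_right)
      then show ?thesis using X'_complex[of s] s t by (simp add: sum_negf)
    qed
    \<comment> \<open>The term of \<open>\<zeta>\<close> in the drift cancels the Loewner velocity
      of \<open>\<zeta>\<close>; the remaining terms match the product over
      \<open>U - {\<zeta>}\<close>.\<close>
    have "(\<Sum>l\<in>U. 2 / ?w s l) = 2 / ?w s \<zeta> + (\<Sum>l\<in>U - {\<zeta>}. 2 / ?w s l)"
      using finU \<zeta> by (rule sum.remove)
    then have "2 / ?w s \<zeta> - of_real (X' s) - (\<Sum>y\<in>Y. 2 / ?w s (of_real y)) = - (\<Sum>l\<in>U - {\<zeta>}. 2 / ?w s l)"
      unfolding X'eq by simp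
    then have "(2 / ?w s \<zeta> - of_real (X' s) - (\<Sum>y\<in>Y. 2 / ?w s (of_real y))) / ?w s \<zeta> = (- (\<Sum>l\<in>U - {\<zeta>}. 2 / ?w s l)) / ?w s \<zeta>"
      by simp
    then show "(2 / ?w s \<zeta> - of_real (X' s)) / ?w s \<zeta> + (\<Sum>y\<in>Y. - 2 / (?w s \<zeta> * ?w s (of_real y))) =
        (\<Sum>l\<in>U - {\<zeta>}. - 2 / (?w s \<zeta> * ?w s l))"
      by (simp add: diff_divide_distrib sum_divide_distrib sum_negf mult.commute)
  qed (use t in auto)
  then show ?thesis by (simp add: mult_ac)
qed

lemma g_inj_U: "0 \<le> t \<Longrightarrow> t < T \<Longrightarrow> inj_on (g t) U"
  using g_inj alive_U by (auto simp: inj_on_def)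

text \<open>Partial fractions of the logarithmic derivative of \<open>\<Prod>(w - \<zeta>\<^sub>t) / \<Prod>(w - \<zeta>\<^sub>t\<^sup>*)\<close>: its zeros remain
  the critical points.\<close>

lemma wronskian_identity:
  assumes t: "0 \<le> t" "t < T"
  shows "(w - of_real (X t)) * (\<Prod>y\<in>Y. w - g t (of_real y)) = \<kappa> * (\<Sum>\<zeta>\<in>U. sgnA \<zeta> * (\<Prod>l\<in>U - {\<zeta>}. w - g t l))"
proof -
  define p where "p = [:- of_real (X t), 1:] * (\<Prod>y\<in>Y. [:- g t (of_real y), 1:])"
  have poly_p: "poly p w = (w - of_real (X t)) * (\<Prod>y\<in>Y. w - g t (of_real y))" for w
    unfolding p_def poly_mult poly_prod by simp
  have "degree (\<Prod>y\<in>Y. [:- g t (of_real y), 1:]) \<le> (\<Sum>y\<in>Y. 1)"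
    using degree_prod_sum_le[OF finY, of "\<lambda>y. [:- g t (of_real y), 1:]"] by (simp add: o_def)
  then have "degree p \<le> 1 + card Y"
    unfolding p_def by (intro order_trans[OF degree_mult_le] add_mono) auto
  \<comment> \<open>The left side has degree at most \<open>card Y + 1\<close>, while there are 2
    \<open>card A\<close> = \<open>card Y + 3\<close> nodes.\<close>
  then have deg: "degree p < card (g t ` U)"
    using cardYA cardU g_inj_U[OF t] by (simp add: card_image)
  have "poly p w = (\<Sum>v\<in>g t ` U. poly p v * (\<Prod>l\<in>g t ` U - {v}. (w - l) / (v - l)))"
    by (rule lagrange_interpolation[OF _ deg]) (use finU in simp)
  also have "\<dots> = (\<Sum>\<zeta>\<in>U. poly p (g t \<zeta>) * (\<Prod>l\<in>g t ` U - {g t \<zeta>}. (w - l) / (g t \<zeta> - l)))"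
    using g_inj_U[OF t] by (simp add: sum.reindex)
  also have "\<dots> = (\<Sum>\<zeta>\<in>U. \<kappa> * (sgnA \<zeta> * (\<Prod>l\<in>U - {\<zeta>}. w - g t l)))"
  proof (rule sum.cong)
    fix \<zeta> assume \<zeta>: "\<zeta> \<in> U"
    have "g t ` U - {g t \<zeta>} = g t ` (U - {\<zeta>})"
      using g_inj_U[OF t] \<zeta> by (auto simp: inj_on_def)
    then have "(\<Prod>l\<in>g t ` U - {g t \<zeta>}. (w - l) / (g t \<zeta> - l)) = (\<Prod>l\<in>U - {\<zeta>}. (w - g t l) / (g t \<zeta> - g t l))"
      using inj_on_subset[OF g_inj_U[OF t], of "U - {\<zeta>}"] by (simp add: prod.reindex)
    moreover have "(\<Prod>l\<in>U - {\<zeta>}. g t \<zeta> - g t l) \<noteq> 0"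
      using g_inj_U[OF t] \<zeta> finU by (auto simp: inj_on_def)
    ultimately show "poly p (g t \<zeta>) * (\<Prod>l\<in>g t ` U - {g t \<zeta>}. (w - l) / (g t \<zeta> - l)) = \<kappa> * (sgnA \<zeta> * (\<Prod>l\<in>U - {\<zeta>}. w - g t l))"
      using residue_invariant[OF \<zeta> t] by (simp add: poly_p prod_dividef)
  qed simp
  finally show ?thesis by (simp add: poly_p sum_distrib_left)
qed

text \<open>Put w = X_t in the Wronskian identity and divide by the product over \<open>U\<close>:
  the logarithmic derivative of the evolved quotient vanishes at the driver.\<close>

lemma critical_sum:
  assumes t: "0 \<le> t" "t < T"
  shows "(\<Sum>\<zeta>\<in>U. sgnA \<zeta> / (g t \<zeta> - of_real (X t))) = 0"
proof -
  let ?x = "complex_of_real (X t)"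
  have ne: "?x - g t l \<noteq> 0" if "l \<in> U" for l using g_neq[OF alive_U[OF that t] t] by auto
  have "(\<Sum>\<zeta>\<in>U. sgnA \<zeta> * (\<Prod>l\<in>U - {\<zeta>}. ?x - g t l)) = 0"
    using wronskian_identity[OF t, of ?x] \<kappa> by simp
  moreover have "sgnA \<zeta> * (\<Prod>l\<in>U - {\<zeta>}. ?x - g t l) = - (\<Prod>l\<in>U. ?x - g t l) * (sgnA \<zeta> / (g t \<zeta> - ?x))" if \<zeta>: "\<zeta> \<in> U" for \<zeta>
  proof -
    have "(\<Prod>l\<in>U. ?x - g t l) = (?x - g t \<zeta>) * (\<Prod>l\<in>U - {\<zeta>}. ?x - g t l)"
      using finU \<zeta> by (rule prod.remove)
    then show ?thesis using ne[OF \<zeta>] by (simp add: divide_simps) (simp add: algebra_simps)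
  qed
  ultimately have "- (\<Prod>l\<in>U. ?x - g t l) * (\<Sum>\<zeta>\<in>U. sgnA \<zeta> / (g t \<zeta> - ?x)) = 0"
    by (simp add: sum_distrib_left)
  then show ?thesis using ne finU by auto
qed

text \<open>This is the invariance of B along the flow, cross-multiplied so that zeros and poles are
  allowed. The logarithmic derivatives of the two products differ by the sum in
  \<open>critical_sum\<close> times -2 / (g_s(z) - X_s), that is, by 0.\<close>

lemma conserved:
  assumes z: "alive t z" and t: "0 \<le> t" "t < T"
  shows "(\<Prod>a\<in>A. g t z - g t a) * (\<Prod>a\<in>A. z - cnj a) = (\<Prod>a\<in>A. g t z - g t (cnj a)) * (\<Prod>a\<in>A. z - a)"
proof -
  let ?w = "\<lambda>s a. g s a - of_real (X s)"
  have al: "alive t a" "alive t (cnj a)" if "a \<in> A" for a using alive_U[OF _ t] that by (auto simp: U_def)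
  have num: "has_log_derivative t (\<lambda>s. \<Prod>a\<in>A. g s z - g s a) (\<lambda>s. \<Sum>a\<in>A. - 2 / (?w s z * ?w s a))"
    by (intro has_log_derivative_prod diff_log_derivative al z t finA)
  have den: "has_log_derivative t (\<lambda>s. \<Prod>a\<in>A. g s z - g s (cnj a)) (\<lambda>s. \<Sum>a\<in>A. - 2 / (?w s z * ?w s (cnj a)))"
    by (intro has_log_derivative_prod diff_log_derivative al(2) z t finA)
  have g0: "g 0 a = a" if "alive t a" for a using g_0 alive_neq[OF that t(1)] by auto
  show ?thesis
  proof (rule has_log_derivative_unique[OF num den])
    show "(\<Prod>a\<in>A. g 0 z - g 0 a) * (\<Prod>a\<in>A. z - cnj a) = (\<Prod>a\<in>A. g 0 z - g 0 (cnj a)) * (\<Prod>a\<in>A. z - a)"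
      using al z by (simp add: g0 mult.commute cong: prod.cong)
    fix s assume s: "s \<in> {0..t}"
    have "(\<Sum>a\<in>A. 1 / ?w s a) - (\<Sum>a\<in>A. 1 / ?w s (cnj a)) = 0"
      using critical_sum[of s] s t sum_U_sgn[of "\<lambda>a. 1 / ?w s a"] by simp
    then have "- 2 / ?w s z * (\<Sum>a\<in>A. 1 / ?w s a) = - 2 / ?w s z * (\<Sum>a\<in>A. 1 / ?w s (cnj a))"
      by simp
    then show "(\<Sum>a\<in>A. - 2 / (?w s z * ?w s a)) = (\<Sum>a\<in>A. - 2 / (?w s z * ?w s (cnj a)))"
      by (simp add: sum_distrib_left)
  qed (use t in auto)
qed

lemma killed_level:
  assumes k: "killed \<tau> z"
  shows "norm (\<Prod>a\<in>A. z - a) = norm (\<Prod>a\<in>A. z - cnj a)"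
proof -
  have \<tau>: "0 < \<tau>" "\<tau> < T" using k by (auto simp: killed_def)
  have al: "alive \<tau> a" "alive \<tau> (cnj a)" if "a \<in> A" for a using alive_U[of _ \<tau>] that \<tau> by (auto simp: U_def)
  have lim: "((\<lambda>s. g s z - g s a) \<longlongrightarrow> of_real (X \<tau>) - g \<tau> a) (at_left \<tau>)" if a: "alive \<tau> a" for a
  proof -
    have "((\<lambda>s. g s a - of_real (X s)) \<longlongrightarrow> g \<tau> a - of_real (X \<tau>)) (at \<tau> within {0..\<tau>})"
      using continuous_on_diff[OF g_cont[OF a \<tau>(2)] continuous_on_of_real[OF X_cont'[OF \<tau>(2)]]] \<tau>
      by (auto simp: continuous_on_def)
    then have "((\<lambda>s. g s a - of_real (X s)) \<longlongrightarrow> g \<tau> a - of_real (X \<tau>)) (at_left \<tau>)"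
      using at_within_Icc_at_left[OF \<tau>(1)] by simp
    from tendsto_diff[OF killed_tendsto[OF k] this] show ?thesis by simp
  qed
  let ?\<alpha> = "\<Prod>a\<in>A. of_real (X \<tau>) - g \<tau> a" and ?\<beta> = "\<Prod>a\<in>A. of_real (X \<tau>) - g \<tau> (cnj a)"
  have l1: "((\<lambda>s. (\<Prod>a\<in>A. g s z - g s a) * (\<Prod>a\<in>A. z - cnj a)) \<longlongrightarrow> ?\<alpha> * (\<Prod>a\<in>A. z - cnj a)) (at_left \<tau>)"
    by (intro tendsto_intros lim al)
  have l2: "((\<lambda>s. (\<Prod>a\<in>A. g s z - g s (cnj a)) * (\<Prod>a\<in>A. z - a)) \<longlongrightarrow> ?\<beta> * (\<Prod>a\<in>A. z - a)) (at_left \<tau>)"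
    by (intro tendsto_intros lim al(2))
  have ev: "\<forall>\<^sub>F s in at_left \<tau>. (\<Prod>a\<in>A. g s z - g s a) * (\<Prod>a\<in>A. z - cnj a) = (\<Prod>a\<in>A. g s z - g s (cnj a)) * (\<Prod>a\<in>A. z - a)"
    using eventually_at_left_real[OF \<tau>(1)]
  proof eventually_elim
    case (elim s)
    then show ?case using conserved[of s z] killed_alive[OF k, of s] \<tau> by auto
  qed
  have "?\<alpha> * (\<Prod>a\<in>A. z - cnj a) = ?\<beta> * (\<Prod>a\<in>A. z - a)"
    by (rule tendsto_unique[OF trivial_limit_at_left_real Lim_transform_eventually[OF l1 ev] l2])
  \<comment> \<open>The two limiting factors are conjugate because \<open>X \<tau>\<close> is real,
    and they are nonzero because the atoms are still alive at \<open>\<tau>\<close>, so their moduli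
    cancel.\<close>
  moreover have "?\<beta> = cnj ?\<alpha>"
    using g_cnj[OF al(1)] \<tau> by simp
  moreover have "of_real (X \<tau>) - g \<tau> a \<noteq> 0" if "a \<in> A" for a
    using g_neq[OF al(1)[OF that]] \<tau> by auto
  then have "?\<alpha> \<noteq> 0" using finA by simp
  ultimately show ?thesis
    by (metis complex_mod_cnj mult_cancel_left norm_eq_zero norm_mult)
qed

end

section \<open>A priori bounds\<close>

text \<open>In the coordinate \<open>1 / z\<close>, an upper bound for the imaginary part on a circle bounds the
  function by the Schwarz lemma, applied after a map of the half-plane \<open>Im w < M\<close> to the disc.\<close>

lemma exterior_Schwarz_bound:
  fixes f :: "complex \<Rightarrow> complex"
  assumes r: "0 < r" and hol: "f holomorphic_on {z. r < norm z}" and lim: "(f \<longlongrightarrow> 0) at_infinity"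
    and Im: "\<And>z. norm z = 2 * r \<Longrightarrow> Im (f z) \<le> B" and B: "0 \<le> B" and z: "4 * r \<le> norm z"
  shows "norm (f z) \<le> 2 * (B + 1)"
proof -
  define M where "M = B + 1"
  have M: "0 < M" "B < M" using B by (auto simp: M_def)
  \<comment> \<open>The singularity at 0, that is at infinity for \<open>f\<close>, is removable
    because \<open>f\<close> tends to 0 there.\<close>
  define \<Phi> where "\<Phi> w = (if w = 0 then 0 else f (1 / w))" for w
  let ?D = "ball (0::complex) (1 / r)"
  have inD: "r < norm (1 / w)" if "w \<in> ?D" "w \<noteq> 0" for w
    using that r by (simp add: norm_divide field_simps)
  have hol0: "\<Phi> holomorphic_on (?D - {0})"
  proof -
    have "(f \<circ> (\<lambda>w. 1 / w)) holomorphic_on (?D - {0})"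
      by (rule holomorphic_on_compose_gen[OF _ hol]) (use inD in \<open>auto intro!: holomorphic_intros\<close>)
    then show ?thesis by (rule holomorphic_transform) (auto simp: \<Phi>_def)
  qed
  have "(\<Phi> \<longlongrightarrow> \<Phi> 0) (at 0)"
  proof (rule Lim_transform_eventually)
    show "((\<lambda>w. f (1 / w)) \<longlongrightarrow> \<Phi> 0) (at 0)"
      using filterlim_compose[OF lim filterlim_inverse_at_infinity] by (simp add: \<Phi>_def inverse_eq_divide)
    show "\<forall>\<^sub>F w in at 0. f (1 / w) = \<Phi> w"
      using eventually_neq_at_within[of 0 0 UNIV] by eventually_elim (simp add: \<Phi>_def)
  qed
  then have "isCont \<Phi> 0" by (simp add: isCont_def)
  moreover have "isCont \<Phi> w" if "w \<in> ?D - {0}" for w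
    using holomorphic_on_imp_continuous_on[OF hol0] that
    by (meson continuous_on_eq_continuous_at open_Diff open_ball closed_singleton)
  ultimately have "continuous_on ?D \<Phi>"
    by (metis Diff_iff continuous_at_imp_continuous_on singletonD)
  then have hol\<Phi>: "\<Phi> holomorphic_on ?D"
    by (rule no_isolated_singularity[OF _ hol0]) auto
  define \<rho> where "\<rho> = 1 / (2 * r)"
  have \<rho>: "0 < \<rho>" "\<rho> < 1 / r" using r by (auto simp: \<rho>_def field_simps)
  \<comment> \<open>The modulus of exp (-\<i> \<Phi>) is exp (Im \<Phi>), so the maximum principle
    carries the bound on the imaginary part from the circle to the disc.\<close>
  have Im\<Phi>: "Im (\<Phi> w) < M" if w: "norm w < \<rho>" for w
  proof -
    have "norm (exp (- \<i> * \<Phi> w)) \<le> exp B"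
    proof (rule maximum_modulus_frontier[of "\<lambda>w. exp (- \<i> * \<Phi> w)" "ball 0 \<rho>"])
      show "(\<lambda>w. exp (- \<i> * \<Phi> w)) holomorphic_on interior (ball 0 \<rho>)"
        using \<rho> by (auto intro!: holomorphic_intros holomorphic_on_subset[OF hol\<Phi>])
      show "continuous_on (closure (ball 0 \<rho>)) (\<lambda>w. exp (- \<i> * \<Phi> w))"
        using \<rho> by (auto intro!: continuous_intros continuous_on_subset[OF holomorphic_on_imp_continuous_on[OF hol\<Phi>]])
      fix v :: complex assume "v \<in> frontier (ball 0 \<rho>)"
      then have v: "norm v = \<rho>" using \<rho> by (auto simp: frontier_def)
      then have "norm (1 / v) = 2 * r" "v \<noteq> 0" using r \<rho> by (auto simp: norm_divide \<rho>_def)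
      then show "norm (exp (- \<i> * \<Phi> v)) \<le> exp B" using Im[of "1 / v"] by (simp add: \<Phi>_def)
    qed (use w in auto)
    then show ?thesis using M by simp
  qed
  \<comment> \<open>The Moebius map w / (2 \<i> M - w) sends the half-plane Im w < M to the unit
    disc and fixes 0.\<close>
  define \<phi> where "\<phi> w = \<Phi> w / (2 * \<i> * of_real M - \<Phi> w)" for w
  have lt: "norm (\<Phi> w) < norm (2 * \<i> * of_real M - \<Phi> w)" if "norm w < \<rho>" for w
  proof -
    have "0 < 4 * M * (M - Im (\<Phi> w))" using Im\<Phi>[OF that] M by simp
    then have "(Re (\<Phi> w))\<^sup>2 + (Im (\<Phi> w))\<^sup>2 < (Re (\<Phi> w))\<^sup>2 + (2 * M - Im (\<Phi> w))\<^sup>2"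
      by (simp add: power2_eq_square algebra_simps)
    then show ?thesis by (simp add: cmod_def)
  qed
  have ne: "2 * \<i> * of_real M - \<Phi> w \<noteq> 0" if "norm w < \<rho>" for w
    using lt[OF that] norm_ge_zero[of "\<Phi> w"] by auto
  define \<psi> where "\<psi> w = \<phi> (of_real \<rho> * w)" for w
  have nr: "norm (of_real \<rho> * w) < \<rho>" if "norm w < 1" for w :: complex
    using that \<rho> by (simp add: norm_mult)
  have schwarz: "norm (\<psi> w) \<le> norm w" if "norm w < 1" for w
  proof (rule Schwarz_Lemma(1)[OF _ _ _ that])
    have "(\<phi> \<circ> (\<lambda>w. of_real \<rho> * w)) holomorphic_on ball 0 1"
    proof (rule holomorphic_on_compose_gen[of _ _ _ "ball 0 \<rho>"])
      show "\<phi> holomorphic_on ball 0 \<rho>"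
        unfolding \<phi>_def using ne \<rho> by (auto intro!: holomorphic_intros holomorphic_on_subset[OF hol\<Phi>])
    qed (use nr in \<open>auto intro!: holomorphic_intros\<close>)
    then show "\<psi> holomorphic_on ball 0 1" by (simp add: \<psi>_def[abs_def] o_def)
    show "\<psi> 0 = 0" by (simp add: \<psi>_def \<phi>_def \<Phi>_def)
    fix w :: complex assume "norm w < 1"
    then show "norm (\<psi> w) < 1" using lt[OF nr] ne[OF nr] by (simp add: \<psi>_def \<phi>_def norm_divide)
  qed
  have z0: "z \<noteq> 0" using z r by auto
  define w where "w = 1 / z"
  have w: "norm w \<le> 1 / (4 * r)" "w \<noteq> 0" using z r z0 by (auto simp: w_def norm_divide frac_le)
  \<comment> \<open>The Schwarz lemma holds outside radius 2 r; the extra factor 2 in the hypothesis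
    on \<open>z\<close> gives 1/2, so that the equation can be solved for \<Phi> with a
    bound.\<close>
  have "norm (w / of_real \<rho>) \<le> 1 / 2" using w r by (simp add: \<rho>_def norm_divide norm_mult field_simps)
  then have half: "norm (\<phi> w) \<le> 1 / 2" using schwarz[of "w / of_real \<rho>"] \<rho> by (simp add: \<psi>_def)
  have "norm w < \<rho>" using w r by (auto simp: \<rho>_def intro: order_le_less_trans) (smt (verit) frac_less2)
  then have ph: "\<Phi> w = \<phi> w * (2 * \<i> * of_real M - \<Phi> w)" using ne by (simp add: \<phi>_def)
  have "norm (\<Phi> w) = norm (\<phi> w) * norm (2 * \<i> * of_real M - \<Phi> w)" by (subst ph) (rule norm_mult)
  also have "\<dots> \<le> 1 / 2 * (2 * M + norm (\<Phi> w))"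
    using half M norm_triangle_ineq4[of "2 * \<i> * of_real M" "\<Phi> w"]
    by (intro mult_mono) (auto simp: norm_mult)
  finally have "norm (\<Phi> w) \<le> 2 * M" by simp
  then show ?thesis using w z0 by (simp add: \<Phi>_def w_def M_def)
qed

text \<open>\<open>\<eta>\<close> is the curve to be grown, \<open>x1\<close> its other endpoint,
  and \<open>K\<close> contains the remaining curves. \<open>level\<close> states that the set |B| =
  1 in the upper half-plane is covered by these; \<open>initial_residue\<close> supplies
  \<open>initial\<close> of the chain.\<close>

locale sle_geometry = sle_data x0 Y A \<kappa> for x0 Y A \<kappa> +
  fixes \<eta> :: "real \<Rightarrow> complex" and x1 :: real and K :: "complex set"
  assumes arc: "arc \<eta>" and start: "pathstart \<eta> = of_real x0" and finish: "pathfinish \<eta> = of_real x1"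
    and x1: "x1 \<in> Y" and Im_arc: "\<And>s. s \<in> {0<..<1} \<Longrightarrow> 0 < Im (\<eta> s)"
    and K: "closed K" "path_image \<eta> \<inter> K = {}"
    and level: "\<And>z. 0 < Im z \<Longrightarrow> norm (\<Prod>a\<in>A. z - a) = norm (\<Prod>a\<in>A. z - cnj a) \<Longrightarrow> z \<in> path_image \<eta> \<union> K"
    and initial_residue: "\<And>\<zeta>. \<zeta> \<in> U \<Longrightarrow>
       (\<zeta> - of_real x0) * (\<Prod>y\<in>Y. \<zeta> - of_real y) = \<kappa> * sgnA \<zeta> * (\<Prod>l\<in>U - {\<zeta>}. \<zeta> - l)"

locale sle_solution = sle_geometry x0 Y A \<kappa> \<eta> x1 K + sle_chain x0 Y A \<kappa> X X' T
  for x0 Y A \<kappa> \<eta> x1 K X X' T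

context sle_geometry
begin

definition arc_bound :: real where
  "arc_bound = (SOME r. 0 < r \<and> path_image \<eta> \<subseteq> ball 0 r)"

lemma arc_bound: "0 < arc_bound" "path_image \<eta> \<subseteq> ball 0 arc_bound"
proof -
  have "\<exists>r. 0 < r \<and> path_image \<eta> \<subseteq> ball 0 r"
    using bounded_subset_ballD[OF compact_imp_bounded[OF compact_path_image[OF arc_imp_path[OF arc]]], of 0] by auto
  from someI_ex[OF this] show "0 < arc_bound" "path_image \<eta> \<subseteq> ball 0 arc_bound" by (auto simp: arc_bound_def)
qed

text \<open>The Schwarz bound applies outside radius 4 \<open>arc_bound\<close>, where the flow
  moves points by at most 2 (4 \<open>arc_bound\<close> + 1); the sum bounds the images of the two
  real points at this radius.\<close>

definition driver_bound :: real where "driver_bound = 4 * arc_bound + 2 * (4 * arc_bound + 1)"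

end

section \<open>Confinement of the trace, and bounds uniform in time\<close>

context sle_solution
begin

text \<open>The trace is connected, starts on \<open>\<eta>\<close> and is covered by the disjoint
  closed sets \<open>path_image \<eta>\<close> and \<open>K\<close>.\<close>

lemma trace_in_arc:
  assumes t: "t \<in> {0..<T}"
  shows "trace t \<in> path_image \<eta>"
proof (rule ccontr)
  assume neg: "trace t \<notin> path_image \<eta>"
  have x0: "of_real x0 \<in> path_image \<eta>" using start pathstart_in_path_image[of \<eta>] by simp
  have sub: "trace s \<in> path_image \<eta> \<union> K" if s: "s \<in> {0..<T}" for s
  proof (cases "s = 0")
    case True
    then show ?thesis using x0 by (simp add: trace_def X0)
  next
    case False
    then show ?thesis using level killed_level trace_killed[of s] s by auto
  qed
  have conn: "connected (trace ` {0..<T})"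
    by (intro connected_continuous_image trace_continuous convex_connected) auto
  have "path_image \<eta> \<inter> trace ` {0..<T} = {} \<or> K \<inter> trace ` {0..<T} = {}"
  proof (rule connected_closedD[OF conn])
    show "path_image \<eta> \<inter> K \<inter> trace ` {0..<T} = {}" using K by auto
    show "trace ` {0..<T} \<subseteq> path_image \<eta> \<union> K" using sub by blast
    show "closed (path_image \<eta>)" by (simp add: closed_arc_image arc)
  qed (rule K)
  moreover have "trace 0 \<in> path_image \<eta>" using x0 by (simp add: trace_def X0)
  then have "path_image \<eta> \<inter> trace ` {0..<T} \<noteq> {}" using T_pos by auto
  ultimately show False using sub[OF t] neg t by auto
qed

lemma alive_off_trace:
  assumes t: "0 \<le> t" "t < T" and z: "z \<notin> trace ` {0..t}" "cnj z \<notin> trace ` {0..t}"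
  shows "alive t z"
proof -
  have up: "alive t z" if z: "0 < Im z" "z \<notin> trace ` {0..t}" for z
  proof (rule ccontr)
    assume na: "\<not> alive t z"
    have "z \<noteq> of_real (X 0)" using z by auto
    then obtain \<tau> where "\<tau> \<in> {0<..t}" "killed \<tau> z" using killed_exists[OF _ t na] by blast
    then show False using trace_eq[OF z(1)] z(2) by fastforce
  qed
  consider "0 < Im z" | "0 < Im (cnj z)" | "Im z = 0" by fastforce
  then show ?thesis
  proof cases
    case 1
    then show ?thesis using up z by blast
  next
    case 2
    then show ?thesis using up[OF 2 z(2)] by simp
  next
    case 3
    then have zr: "z = of_real (Re z)" by (simp add: complex_eq_iff)
    have "z \<noteq> of_real (X 0)" using z(1) t by (auto simp: trace_def image_iff)
    then have "Re z \<noteq> X 0" using zr by metis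
    then show ?thesis using alive_real[OF _ t] zr by metis
  qed
qed

lemma alive_exterior:
  assumes t: "0 \<le> t" "t < T" and z: "arc_bound \<le> norm z"
  shows "alive t z"
proof (rule alive_off_trace[OF t])
  have "w \<notin> trace ` {0..t}" if "norm w = norm z" for w
    using trace_in_arc t z arc_bound(2) that by (fastforce simp: subset_iff)
  then show "z \<notin> trace ` {0..t}" "cnj z \<notin> trace ` {0..t}" by auto
qed

text \<open>While the solution keeps distance \<open>R\<close> from the driver it moves by at most 2
  t / R. A start far enough out cannot lose this distance: at the first time of doing so it would
  have moved by at most 2 t.\<close>

lemma g_near_infinity:
  assumes t: "0 \<le> t" "t < T"
  shows "((\<lambda>z. g t z - z) \<longlongrightarrow> 0) at_infinity"
proof -
  have "compact (X ` {0..t})" using X_cont'[OF t(2)] by (intro compact_continuous_image) auto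
  then obtain k where k: "\<And>s. s \<in> {0..t} \<Longrightarrow> \<bar>X s\<bar> \<le> k"
    using compact_imp_bounded bounded_iff by (metis image_eqI real_norm_def)
  have bound: "norm (g t z - z) \<le> 2 * t / R"
    if R: "1 \<le> R" and z: "arc_bound + k + R + 2 * t + 1 < norm z" for z R
  proof -
    have k0: "0 \<le> k" using k[of 0] t by auto
    have al: "alive t z" using alive_exterior[OF t] z k0 R t by auto
    have z0: "g 0 z = z" using g_0 alive_neq[OF al t(1)] by auto
    have contg: "continuous_on {0..t} (\<lambda>s. norm (g s z - of_real (X s)))"
      by (intro continuous_intros g_cont[OF al t(2)] X_cont' t)
    have step: "norm (g s z - z) \<le> 2 / R * s" if s: "s \<in> {0..t}" and far: "\<And>q. q \<in> {0..s} \<Longrightarrow> R \<le> norm (g q z - of_real (X q))" for s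
    proof -
      have "norm (g s z - g 0 z - (s - 0) *\<^sub>R 0) \<le> 2 / R * (s - 0)"
      proof (rule vector_mean_value_bound)
        fix q assume q: "q \<in> {0..s}"
        show "((\<lambda>s. g s z) has_vector_derivative 2 / (g q z - of_real (X q))) (at q within {0..s})"
          using q s by (intro has_vector_derivative_within_subset[OF g_deriv[OF al t(2)]]) auto
        show "norm (2 / (g q z - of_real (X q)) - 0) \<le> 2 / R"
          using far[OF q] R by (simp add: norm_divide frac_le)
      qed (use s in auto)
      then show ?thesis using z0 by simp
    qed
    have far: "R < norm (g s z - of_real (X s))" if s: "s \<in> {0..t}" for s
    proof (rule ccontr)
      assume neg: "\<not> R < norm (g s z - of_real (X s))"
      define B where "B = {q \<in> {0..t}. norm (g q z - of_real (X q)) \<le> R}"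
      have "closed B" unfolding B_def by (intro continuous_on_closed_Collect_le contg continuous_intros)
      moreover have "bounded B" by (rule bounded_subset[of "{0..t}"]) (auto simp: B_def)
      moreover have "B \<noteq> {}" using neg s by (auto simp: B_def)
      ultimately obtain q where q: "q \<in> B" "\<And>p. p \<in> B \<Longrightarrow> q \<le> p"
        using compact_attains_inf[of B] by (auto simp: compact_eq_bounded_closed)
      have q0: "0 < q"
      proof -
        have "R < norm (z - of_real (X 0))"
          using norm_triangle_ineq2[of z "of_real (X 0)"] k[of 0] z t arc_bound(1) by simp
        then show ?thesis using q(1) z0 by (cases "q = 0") (auto simp: B_def)
      qed
      have "R \<le> norm (g p z - of_real (X p))" if p: "p \<in> {0..q}" for p
      proof (rule continuous_ge_on_closure[of "{0..<q}" "\<lambda>p. norm (g p z - of_real (X p))"])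
        show "continuous_on (closure {0..<q}) (\<lambda>p. norm (g p z - of_real (X p)))"
          using q0 q(1) by (auto intro!: continuous_on_subset[OF contg] simp: B_def)
        show "p \<in> closure {0..<q}" using p q0 by simp
        fix r assume "r \<in> {0..<q}"
        then show "R \<le> norm (g r z - of_real (X r))" using q(1) q(2)[of r] by (force simp: B_def)
      qed
      then have "norm (g q z - z) \<le> 2 / R * q" using q(1) by (intro step) (auto simp: B_def)
      also have "\<dots> \<le> 2 * t"
      proof (rule mult_mono)
        show "2 / R \<le> 2" using R by (simp add: divide_le_eq)
      qed (use q(1) in \<open>auto simp: B_def\<close>)
      finally have "norm (g q z - z) \<le> 2 * t" .
      moreover have "norm z \<le> norm (g q z - z) + norm (g q z - of_real (X q)) + norm (complex_of_real (X q))"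
        using norm_triangle_ineq4[of "g q z" "g q z - z"] norm_triangle_ineq[of "g q z - of_real (X q)" "of_real (X q)"]
        by (simp add: algebra_simps)
      ultimately show False using q(1) k[of q] z arc_bound(1) by (auto simp: B_def)
    qed
    then show ?thesis using step[of t] t by (auto intro: less_imp_le)
  qed
  show ?thesis
    unfolding tendsto_iff dist_norm
  proof (intro allI impI)
    fix e :: real assume e: "0 < e"
    define R where "R = max 1 (2 * t / e + 1)"
    have R: "1 \<le> R" "2 * t / R < e"
      using e t by (auto simp: R_def field_simps max_def split: if_splits)
    show "\<forall>\<^sub>F z in at_infinity. norm (g t z - z - 0) < e"
      unfolding eventually_at_infinity
    proof (intro exI[of _ "arc_bound + k + R + 2 * t + 2"] allI impI)
      fix z :: complex assume "arc_bound + k + R + 2 * t + 2 \<le> norm z"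
      then show "norm (g t z - z - 0) < e" using bound[OF R(1), of z] R(2) by simp
    qed
  qed
qed

text \<open>The imaginary part decreases in modulus along the flow, so on the circle of radius 2
  \<open>arc_bound\<close> the displacement has imaginary part at most twice the radius. The Schwarz
  bound makes this a bound on the displacement that does not depend on \<open>t\<close>.\<close>

lemma g_exterior_bound:
  assumes t: "0 \<le> t" "t < T" and z: "4 * arc_bound \<le> norm z"
  shows "norm (g t z - z) \<le> 2 * (4 * arc_bound + 1)"
proof (rule exterior_Schwarz_bound[OF arc_bound(1) _ g_near_infinity[OF t] _ _ z])
  show "(\<lambda>z. g t z - z) holomorphic_on {z. arc_bound < norm z}"
    by (intro holomorphic_intros g_holomorphic t) (use alive_exterior[OF t] in auto)
  fix z :: complex assume z: "norm z = 2 * arc_bound"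
  then have "\<bar>Im (g t z)\<bar> \<le> \<bar>Im z\<bar>" using arc_bound(1) by (intro Im_g_le alive_exterior t) auto
  then show "Im (g t z - z) \<le> 4 * arc_bound" using abs_Im_le_cmod[of z] z by simp
qed (use arc_bound in auto)

text \<open>A real point is never hit by the driver before \<open>T\<close>, so the sign of its gap
  is constant by the intermediate value theorem.\<close>

lemma real_order:
  assumes t: "0 \<le> t" "t < T" and b: "b \<noteq> x0"
  shows "x0 < b \<longleftrightarrow> X t < Re (g t (of_real b))"
proof -
  have al: "alive t (of_real b)" using alive_real[of b t] t b X0 by auto
  have z0: "g 0 (of_real b) = of_real b" using g_0 alive_neq[OF al t(1)] by auto
  define h where "h s = Re (g s (of_real b)) - X s" for s
  have cont: "continuous_on {0..t} h" unfolding h_def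
    by (intro continuous_intros g_cont[OF al t(2)] X_cont' t)
  have ne: "h s \<noteq> 0" if "s \<in> {0..t}" for s
  proof
    assume "h s = 0"
    then have "g s (of_real b) = of_real (X s)"
      using g_real[OF alive_mono[OF al], of s] that t by (simp add: h_def)
    then show False using g_neq'[OF al that t(2)] by simp
  qed
  have h0: "h 0 = b - x0" by (simp add: h_def z0 X0)
  have "\<not> (h 0 < 0 \<and> 0 < h t)" "\<not> (0 < h 0 \<and> h t < 0)"
    using IVT'[of h 0 0 t] IVT2'[of h t 0 0] cont ne t by (auto simp: less_le)
  then show ?thesis using ne[of 0] ne[of t] t h0 unfolding h_def[of t] by auto
qed

text \<open>The driver stays between the images of the real points at distance 4
  \<open>arc_bound\<close> from 0, whose displacement is bounded.\<close>

lemma driver_bounded: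
  assumes t: "0 \<le> t" "t < T"
  shows "\<bar>X t\<bar> < driver_bound"
proof -
  have x0: "\<bar>x0\<bar> < arc_bound"
    using start pathstart_in_path_image[of \<eta>] arc_bound(2) by (auto simp: subset_iff)
  define b where "b = 4 * arc_bound"
  have b: "0 < b" "\<bar>x0\<bar> < b" "driver_bound = b + 2 * (4 * arc_bound + 1)" "4 * arc_bound \<le> b" "x0 < b" "- b < x0"
    using x0 arc_bound(1) by (auto simp: b_def driver_bound_def)
  have n: "norm (g t (of_real b) - of_real b) \<le> 2 * (4 * arc_bound + 1)"
    "norm (g t (of_real (- b)) - of_real (- b)) \<le> 2 * (4 * arc_bound + 1)"
    by (rule g_exterior_bound[OF t]; unfold norm_of_real; use b in simp)+
  have "Re (g t (of_real b)) \<le> driver_bound"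
    using order_trans[OF complex_Re_le_cmod n(1)] b by simp
  moreover have "- driver_bound \<le> Re (g t (of_real (- b)))"
    using order_trans[OF abs_Re_le_cmod n(2)] b by simp
  moreover have "X t < Re (g t (of_real b))"
    using real_order[OF t, of b] b by auto
  moreover have "\<not> X t < Re (g t (of_real (- b)))" "X t \<noteq> Re (g t (of_real (- b)))"
  proof -
    show "\<not> X t < Re (g t (of_real (- b)))"
      using real_order[OF t, of "- b"] b by auto
    have al: "alive t (of_real (- b))"
      by (rule alive_exterior[OF t]) (unfold norm_of_real, use b arc_bound(1) in simp)
    show "X t \<noteq> Re (g t (of_real (- b)))"
      using g_real[OF al t(2,1)] g_neq[OF al t] by metis
  qed
  ultimately show ?thesis by auto
qed

lemma g_exterior_real_bound:
  assumes t: "0 \<le> t" "t < T" and b: "b = 4 * arc_bound \<or> b = - (4 * arc_bound)"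
  shows "\<bar>Re (g t (of_real b))\<bar> \<le> driver_bound"
proof -
  have nb: "norm (complex_of_real b) = 4 * arc_bound" unfolding norm_of_real using b arc_bound(1) by auto
  have "\<bar>Re (g t (of_real b) - of_real b)\<bar> \<le> 2 * (4 * arc_bound + 1)"
    by (rule order_trans[OF abs_Re_le_cmod g_exterior_bound[OF t]]) (unfold nb, rule order_refl)
  then show ?thesis using b arc_bound(1) by (auto simp: driver_bound_def)
qed

text \<open>Let p and q be the distances from the driver to the images of 4 \<open>arc_bound\<close>
  and its negative. The square of p + q grows at rate 4 (p + q)^2 / (p q), which is at least 16,
  while p + q is at most 2 \<open>driver_bound\<close>.\<close>

lemma time_bounded: "T \<le> driver_bound\<^sup>2 / 4"
proof (rule dense_le_bounded[OF T_pos])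
  fix t assume t: "0 < t" "t < T"
  define b where "b = 4 * arc_bound"
  have x0: "\<bar>x0\<bar> < arc_bound"
    using start pathstart_in_path_image[of \<eta>] arc_bound(2) by (auto simp: subset_iff)
  have b: "0 < b" "x0 < b" "- b < x0" using x0 arc_bound(1) by (auto simp: b_def)
  define u where "u s = Re (g s (of_real b))" for s
  define v where "v s = Re (g s (of_real (- b)))" for s
  have al: "alive t (of_real b)" "alive t (of_real (- b))"
    using alive_real[of b t] alive_real[of "- b" t] b t X0 by auto
  have ord: "X s < u s \<and> v s < X s" if s: "s \<in> {0..t}" for s
  proof -
    have s': "0 \<le> s" "s < T" using s t by auto
    have a2: "alive s (of_real (- b))" using alive_mono[OF al(2)] s by auto
    have "X s \<noteq> v s" using g_real[OF a2 s'(2,1)] g_neq[OF a2 s'] by (metis v_def)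
    then show ?thesis using real_order[OF s', of b] real_order[OF s', of "- b"] b by (auto simp: u_def v_def)
  qed
  have der: "((\<lambda>s. Re (g s (of_real a))) has_real_derivative 2 / (Re (g s (of_real a)) - X s)) (at s within {0..t})"
    if a: "alive t (of_real a)" and s: "s \<in> {0..t}" for a s
  proof -
    have "g s (of_real a) = of_real (Re (g s (of_real a)))"
      using g_real[OF alive_mono[OF a], of s] s t by auto
    then have "2 / (g s (of_real a) - of_real (X s)) = of_real (2 / (Re (g s (of_real a)) - X s))"
      by (metis of_real_diff of_real_divide of_real_numeral)
    then have "Re (2 / (g s (of_real a) - of_real (X s))) = 2 / (Re (g s (of_real a)) - X s)" by (metis Re_complex_of_real)
    then show ?thesis
      using bounded_linear.has_vector_derivative[OF bounded_linear_Re g_deriv[OF a t(2) s]]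
      by (simp add: has_real_derivative_iff_has_vector_derivative)
  qed
  define h where "h s = (u s - v s)\<^sup>2 - 16 * s" for s
  have hder: "(h has_real_derivative 2 * (u s - v s) * (2 / (u s - X s) - 2 / (v s - X s)) - 16) (at s within {0..t})"
    if s: "s \<in> {0..t}" for s
  proof -
    have "(u has_real_derivative 2 / (u s - X s)) (at s within {0..t})" "(v has_real_derivative 2 / (v s - X s)) (at s within {0..t})"
      using der[OF al(1) s] der[OF al(2) s] by (simp_all add: u_def[abs_def] v_def[abs_def])
    then show ?thesis unfolding h_def by (auto intro!: derivative_eq_intros)
  qed
  have pos: "0 \<le> 2 * (u s - v s) * (2 / (u s - X s) - 2 / (v s - X s)) - 16" if s: "s \<in> {0..t}" for s
  proof -
    define p where "p = u s - X s"
    define q where "q = X s - v s"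
    have pq: "0 < p" "0 < q" using ord[OF s] by (auto simp: p_def q_def)
    have e: "u s - v s = p + q" "u s - X s = p" "v s - X s = - q" by (simp_all add: p_def q_def)
    have "2 * (p + q) * (2 / p - 2 / (- q)) - 16 = 4 * (p - q)\<^sup>2 / (p * q)"
      using pq by (simp add: field_simps power2_eq_square)
    moreover have "0 \<le> 4 * (p - q)\<^sup>2 / (p * q)" using pq by simp
    ultimately show ?thesis unfolding e by simp
  qed
  have "h 0 \<le> h t"
  proof (rule DERIV_nonneg_imp_increasing_open[of 0 t h])
    fix s assume s: "0 < s" "s < t"
    then show "\<exists>y. (h has_real_derivative y) (at s) \<and> 0 \<le> y"
      using hder[of s] pos[of s] at_within_Icc_at[of 0 s t] by auto
  next
    show "continuous_on {0..t} h"
      unfolding continuous_on_eq_continuous_within using hder DERIV_continuous by blast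
  qed (use t in auto)
  moreover have "0 \<le> h 0" by (simp add: h_def)
  ultimately have "0 \<le> h t" by linarith
  then have "16 * t \<le> (u t - v t)\<^sup>2" by (simp add: h_def)
  also have "\<dots> \<le> (2 * driver_bound)\<^sup>2"
  proof -
    have hb: "b = 4 * arc_bound \<or> b = - (4 * arc_bound)" "- b = 4 * arc_bound \<or> - b = - (4 * arc_bound)"
      by (auto simp: b_def)
    have "\<bar>u t\<bar> \<le> driver_bound" "\<bar>v t\<bar> \<le> driver_bound"
      unfolding u_def v_def
      using g_exterior_real_bound[OF _ t(2) hb(1)] g_exterior_real_bound[OF _ t(2) hb(2)] t by simp_all
    then have "\<bar>u t - v t\<bar> \<le> \<bar>2 * driver_bound\<bar>" by auto
    then show ?thesis by (simp only: abs_le_square_iff)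
  qed
  finally show "t \<le> driver_bound\<^sup>2 / 4" by (simp add: power2_eq_square)
qed

end

section \<open>Existence of a maximal chain\<close>

lemma loewner_solution_driver_cong:
  "(\<And>s. s \<in> {0..t} \<Longrightarrow> X s = X' s) \<Longrightarrow> loewner_solution X z t u \<longleftrightarrow> loewner_solution X' z t u"
  by (simp add: loewner_solution_def cong: conj_cong)

lemma loewner_solution_driver_cong_fun:
  "(\<And>s. s \<in> {0..t} \<Longrightarrow> X s = X' s) \<Longrightarrow> loewner_solution X z t = loewner_solution X' z t"
  by (rule ext) (rule loewner_solution_driver_cong)

lemma loewner_alive_driver_cong:
  "(\<And>s. s \<in> {0..t} \<Longrightarrow> X s = X' s) \<Longrightarrow> loewner_alive X t z \<longleftrightarrow> loewner_alive X' t z"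
  unfolding loewner_alive_def by (subst loewner_solution_driver_cong_fun) auto

lemma loewner_map_driver_cong:
  "(\<And>s. s \<in> {0..t} \<Longrightarrow> X s = X' s) \<Longrightarrow> loewner_map X t z = loewner_map X' t z"
  unfolding loewner_map_def by (subst loewner_solution_driver_cong_fun) auto

text \<open>Completeness of the state space, which \<open>picard_global\<close> requires.\<close>

instance bcontfun :: (metric_space, banach) banach ..

text \<open>The driving function and the images of the atoms evolve together by an ordinary differential
  equation. As the number of atoms is not a type, the state space is the Banach space of bounded
  continuous functions on the line: the value at \<open>0\<close> is the driving function, the values at
  \<open>1, 2, \<dots>\<close> are the images of the atoms, and hat functions interpolate between them.\<close>

definition bump :: "nat \<Rightarrow> complex \<Rightarrow> real \<Rightarrow>\<^sub>C complex" where
  "bump n z = Bcontfun (\<lambda>x. of_real (max 0 (1 - \<bar>x - real n\<bar>)) * z)"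

definition coord :: "(real \<Rightarrow>\<^sub>C complex) \<Rightarrow> nat \<Rightarrow> complex" where
  "coord v n = apply_bcontfun v (real n)"

lemma apply_bump: "apply_bcontfun (bump n z) x = of_real (max 0 (1 - \<bar>x - real n\<bar>)) * z"
proof -
  have "norm (of_real (max 0 (1 - \<bar>x - real n\<bar>)) * z) \<le> 1 * norm z" for x
    unfolding norm_mult norm_of_real by (intro mult_right_mono) auto
  then have "bounded (range (\<lambda>x. of_real (max 0 (1 - \<bar>x - real n\<bar>)) * z))"
    by (auto simp: bounded_iff intro!: exI[of _ "norm z"])
  moreover have "continuous_on UNIV (\<lambda>x. of_real (max 0 (1 - \<bar>x - real n\<bar>)) * z)"
    by (intro continuous_intros)
  ultimately show ?thesis unfolding bump_def by (simp add: Bcontfun_inverse bcontfun_def)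
qed

lemma coord_bump: "coord (bump n z) m = (if m = n then z else 0)"
proof (cases "m = n")
  case False
  then have "1 \<le> \<bar>real m - real n\<bar>" by linarith
  then show ?thesis using False by (simp add: coord_def apply_bump)
qed (simp add: coord_def apply_bump)

lemma norm_bump: "norm (bump n z) \<le> norm z"
proof (rule norm_bound)
  fix x
  have "norm (of_real (max 0 (1 - \<bar>x - real n\<bar>)) * z) \<le> 1 * norm z"
    unfolding norm_mult norm_of_real by (intro mult_right_mono) auto
  then show "norm (apply_bcontfun (bump n z) x) \<le> norm z" by (simp add: apply_bump)
qed

lemma bounded_linear_bump: "bounded_linear (bump n)"
proof (rule bounded_linear_intro[where K = 1])
  show "bump n (z + w) = bump n z + bump n w" for z w
    by (rule bcontfun_eqI) (simp add: apply_bump distrib_left)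
  show "bump n (r *\<^sub>R z) = r *\<^sub>R bump n z" for r z
    by (rule bcontfun_eqI) (simp add: apply_bump)
  show "norm (bump n z) \<le> norm z * 1" for z using norm_bump by simp
qed

lemma bump_diff: "bump n z - bump n w = bump n (z - w)"
  using linear_diff[OF bounded_linear.linear[OF bounded_linear_bump]] by simp

lemma norm_coord: "norm (coord v n) \<le> norm v"
  unfolding coord_def by (rule norm_bounded)

lemma coord_diff: "coord (v - w) n = coord v n - coord w n"
  by (simp add: coord_def)

lemma bounded_linear_coord: "bounded_linear (\<lambda>v. coord v n)"
  by (rule bounded_linear_intro[where K = 1]) (use norm_coord in \<open>auto simp: coord_def\<close>)

lemma coord_add: "coord (v + w) n = coord v n + coord w n"
  by (simp add: coord_def)

lemma coord_0: "coord 0 n = 0"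
  by (simp add: coord_def)

lemma coord_sum: "coord (\<Sum>i\<in>I. f i) n = (\<Sum>i\<in>I. coord (f i) n)"
  by (induction I rule: infinite_finite_induct) (simp_all add: coord_add coord_0)

section \<open>The coupled equation for the driver and the atoms\<close>

context sle_data
begin

definition enum :: "nat \<Rightarrow> complex" where "enum = (SOME e. bij_betw e {..<card S} S)"

lemma enum: "bij_betw enum {..<card S} S"
proof -
  have "\<exists>e. bij_betw e {..<card S} S"
    using ex_bij_betw_nat_finite[OF finS] by (simp add: atLeast0LessThan)
  then show ?thesis unfolding enum_def by (rule someI_ex)
qed

lemma enum_S: "i < card S \<Longrightarrow> enum i \<in> S" and enum_ex: "a \<in> S \<Longrightarrow> \<exists>i<card S. a = enum i"
  using enum by (auto simp: bij_betw_def)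

lemma sum_enum: "(\<Sum>i<card S. f (enum i)) = (\<Sum>a\<in>S. f a)"
  using sum.reindex_bij_betw[OF enum] .

lemma x0_S: "of_real x0 \<notin> S"
  using x0Y U_nonreal[of "of_real x0"] by (auto simp: S_def)

definition state :: "complex \<Rightarrow> (nat \<Rightarrow> complex) \<Rightarrow> real \<Rightarrow>\<^sub>C complex" where
  "state x u = bump 0 x + (\<Sum>i<card S. bump (Suc i) (u i))"

lemma apply_state: "coord (state x u) 0 = x" "i < card S \<Longrightarrow> coord (state x u) (Suc i) = u i"
  by (simp_all add: state_def coord_add coord_sum coord_bump if_distrib cong: if_cong)

definition drift :: "real \<Rightarrow> (real \<Rightarrow>\<^sub>C complex) \<Rightarrow> complex" where
  "drift \<delta> v = (\<Sum>i<card S. of_real (charge (enum i)) * trunc_inverse \<delta> (coord v 0 - coord v (Suc i)))"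

text \<open>Taking the real part of the drift keeps the driving coordinate real without any use of
  symmetry; truncation makes the field globally Lipschitz.\<close>

definition field :: "real \<Rightarrow> (real \<Rightarrow>\<^sub>C complex) \<Rightarrow> real \<Rightarrow>\<^sub>C complex" where
  "field \<delta> v = state (of_real (Re (drift \<delta> v))) (\<lambda>i. 2 * trunc_inverse \<delta> (coord v (Suc i) - coord v 0))"

lemma abs_charge: "\<bar>charge a\<bar> \<le> 2"
  by (simp add: charge_def)

text \<open>A gap of two coordinates doubles 3 / \<delta>^2, charges and velocities bring another 2,
  so the drift and the velocities give 12 \<open>card S\<close> / \<delta>^2 each. The added 1 makes
  positivity of the constant immediate.\<close>

lemma field_lipschitz:
  assumes \<delta>: "0 < \<delta>"
  shows "norm (field \<delta> v - field \<delta> w) \<le> (24 * real (card S) / \<delta>\<^sup>2 + 1) * norm (v - w)"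
proof -
  have comp: "norm (coord v n - coord w n) \<le> norm (v - w)" for n
    using norm_coord[of "v - w" n] by (simp add: coord_diff)
  have t: "norm (trunc_inverse \<delta> (coord v m - coord v n) - trunc_inverse \<delta> (coord w m - coord w n)) \<le> 6 / \<delta>\<^sup>2 * norm (v - w)" for m n
  proof -
    have "norm (trunc_inverse \<delta> (coord v m - coord v n) - trunc_inverse \<delta> (coord w m - coord w n)) \<le> 3 / \<delta>\<^sup>2 * norm ((coord v m - coord v n) - (coord w m - coord w n))"
      by (rule trunc_inverse_lipschitz[OF \<delta>])
    also have "(coord v m - coord v n) - (coord w m - coord w n) = (coord v m - coord w m) - (coord v n - coord w n)" by simp
    finally have "norm (trunc_inverse \<delta> (coord v m - coord v n) - trunc_inverse \<delta> (coord w m - coord w n)) \<le> 3 / \<delta>\<^sup>2 * norm ((coord v m - coord w m) - (coord v n - coord w n))" .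
    also have "\<dots> \<le> 3 / \<delta>\<^sup>2 * (norm (v - w) + norm (v - w))"
      using norm_triangle_ineq4[of "coord v m - coord w m" "coord v n - coord w n"] comp[of m] comp[of n]
      by (intro mult_left_mono) auto
    finally show ?thesis by simp
  qed
  have d: "norm (drift \<delta> v - drift \<delta> w) \<le> (\<Sum>i<card S. 2 * (6 / \<delta>\<^sup>2 * norm (v - w)))"
    unfolding drift_def sum_subtractf[symmetric]
  proof (rule sum_norm_le)
    fix i
    have "norm (complex_of_real (charge (enum i)) * trunc_inverse \<delta> (coord v 0 - coord v (Suc i)) - complex_of_real (charge (enum i)) * trunc_inverse \<delta> (coord w 0 - coord w (Suc i)))
      = \<bar>charge (enum i)\<bar> * norm (trunc_inverse \<delta> (coord v 0 - coord v (Suc i)) - trunc_inverse \<delta> (coord w 0 - coord w (Suc i)))"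
      by (simp add: right_diff_distrib[symmetric] norm_mult)
    also have "\<dots> \<le> 2 * (6 / \<delta>\<^sup>2 * norm (v - w))"
      using abs_charge t by (intro mult_mono) auto
    finally show "norm (complex_of_real (charge (enum i)) * trunc_inverse \<delta> (coord v 0 - coord v (Suc i)) - complex_of_real (charge (enum i)) * trunc_inverse \<delta> (coord w 0 - coord w (Suc i)))
      \<le> 2 * (6 / \<delta>\<^sup>2 * norm (v - w))" .
  qed
  have "field \<delta> v - field \<delta> w = bump 0 (of_real (Re (drift \<delta> v - drift \<delta> w))) +
      (\<Sum>i<card S. bump (Suc i) (2 * (trunc_inverse \<delta> (coord v (Suc i) - coord v 0) - trunc_inverse \<delta> (coord w (Suc i) - coord w 0))))"
    unfolding field_def state_def by (simp add: bump_diff[symmetric] sum_subtractf right_diff_distrib)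
  also have "norm \<dots> \<le> norm (drift \<delta> v - drift \<delta> w) + (\<Sum>i<card S. 2 * (6 / \<delta>\<^sup>2 * norm (v - w)))"
  proof (rule norm_triangle_mono)
    show "norm (bump 0 (of_real (Re (drift \<delta> v - drift \<delta> w)))) \<le> norm (drift \<delta> v - drift \<delta> w)"
      by (rule order_trans[OF norm_bump]) (unfold norm_of_real, rule abs_Re_le_cmod)
    show "norm (\<Sum>i<card S. bump (Suc i) (2 * (trunc_inverse \<delta> (coord v (Suc i) - coord v 0) - trunc_inverse \<delta> (coord w (Suc i) - coord w 0))))
        \<le> (\<Sum>i<card S. 2 * (6 / \<delta>\<^sup>2 * norm (v - w)))"
    proof (rule sum_norm_le)
      fix i
      show "norm (bump (Suc i) (2 * (trunc_inverse \<delta> (coord v (Suc i) - coord v 0) - trunc_inverse \<delta> (coord w (Suc i) - coord w 0)))) \<le> 2 * (6 / \<delta>\<^sup>2 * norm (v - w))"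
        by (rule order_trans[OF norm_bump], unfold norm_mult norm_numeral, rule mult_left_mono[OF t]) simp
    qed
  qed
  also have "\<dots> \<le> (24 * real (card S) / \<delta>\<^sup>2) * norm (v - w)"
  proof -
    have sum_eq: "(\<Sum>i<card S. 2 * (6 / \<delta>\<^sup>2 * norm (v - w))) = 12 * real (card S) / \<delta>\<^sup>2 * norm (v - w)" by simp
    have split: "24 * a / b * c = 12 * a / b * c + 12 * a / b * c" for a b c :: real by simp
    show ?thesis unfolding sum_eq split by (rule add_right_mono[OF d[unfolded sum_eq]])
  qed
  also have "\<dots> \<le> (24 * real (card S) / \<delta>\<^sup>2 + 1) * norm (v - w)"
    by (intro mult_right_mono) auto
  finally show ?thesis .
qed

definition chain_upto :: "real \<Rightarrow> (real \<Rightarrow> real) \<Rightarrow> bool" where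
  "chain_upto t X \<longleftrightarrow> 0 \<le> t \<and> X 0 = x0 \<and> (\<forall>a\<in>S. loewner_alive X t a) \<and>
     (\<forall>s\<in>{0..t}. (X has_vector_derivative
        Re (\<Sum>a\<in>S. of_real (charge a) / (of_real (X s) - loewner_map X s a))) (at s within {0..t}))"

definition state_solution :: "real \<Rightarrow> real \<Rightarrow> (real \<Rightarrow> real \<Rightarrow>\<^sub>C complex) \<Rightarrow> bool" where
  "state_solution \<delta> t V \<longleftrightarrow> V 0 = state (of_real x0) enum \<and>
     (\<forall>s\<in>{0..t}. (V has_vector_derivative field \<delta> (V s)) (at s within {0..t}))"

lemma chain_upto_cont: "chain_upto t X \<Longrightarrow> continuous_on {0..t} X"
  unfolding chain_upto_def by (elim conjE) (rule continuous_on_vector_derivative, blast)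

lemma state_solution_mono: "state_solution \<delta> t V \<Longrightarrow> s \<le> t \<Longrightarrow> state_solution \<delta> s V"
  unfolding state_solution_def
  using has_vector_derivative_within_subset[of V _ _ "{0..t}" "{0..s}"] by auto

lemma state_solution_exists:
  assumes "0 < \<delta>" "0 \<le> t"
  obtains V where "state_solution \<delta> t V"
proof (rule picard_global[of t "24 * real (card S) / \<delta>\<^sup>2 + 1" "\<lambda>_. field \<delta>" "state (of_real x0) enum"])
  have "continuous_on UNIV (field \<delta>)"
  proof (rule lipschitz_on_continuous_on[of "24 * real (card S) / \<delta>\<^sup>2 + 1"], rule lipschitz_onI)
    show "dist (field \<delta> v) (field \<delta> w) \<le> (24 * real (card S) / \<delta>\<^sup>2 + 1) * dist v w" for v w
      unfolding dist_norm by (rule field_lipschitz[OF assms(1)])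
  qed simp
  then show "continuous_on ({0..t} \<times> UNIV) (\<lambda>(t, x). field \<delta> x)"
    unfolding case_prod_unfold by (rule continuous_on_compose2) (auto intro!: continuous_intros)
  show "0 < 24 * real (card S) / \<delta>\<^sup>2 + 1" by (smt (verit) divide_nonneg_nonneg of_nat_0_le_iff zero_le_power2)
  fix V assume "V 0 = state (of_real x0) enum"
    "\<And>s. s \<in> {0..t} \<Longrightarrow> (V has_vector_derivative field \<delta> (V s)) (at s within {0..t})"
  then show thesis using that[of V] unfolding state_solution_def by blast
qed (use assms field_lipschitz[OF assms(1)] in auto)

lemma state_solution_unique:
  assumes \<delta>: "0 < \<delta>" and V: "state_solution \<delta> t V" and W: "state_solution \<delta> t W" and s: "s \<in> {0..t}"
  shows "V s = W s"
proof -
  let ?L = "24 * real (card S) / \<delta>\<^sup>2 + 1"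
  have L: "0 < ?L" by (smt (verit) divide_nonneg_nonneg of_nat_0_le_iff zero_le_power2)
  have "norm (V s - W s) \<le> 2 * norm (V 0 - W 0) * exp (2 * ?L * s)"
    by (rule gronwall_weighted[where b = t and d' = "\<lambda>s. field \<delta> (V s) - field \<delta> (W s)"])
      (use V W s L field_lipschitz[OF \<delta>] in \<open>auto simp: state_solution_def intro!: has_vector_derivative_diff\<close>)
  then show ?thesis using V W by (simp add: state_solution_def)
qed

text \<open>Where all gaps are at least \<open>\<delta>\<close>, truncation is invisible. Together
  with \<open>state_solution_chain_upto\<close> this translates between chains and solutions of a
  Lipschitz equation.\<close>

lemma chain_upto_state_solution:
  assumes X: "chain_upto t X" and \<delta>: "0 < \<delta>"
    and gap: "\<And>a s. a \<in> S \<Longrightarrow> s \<in> {0..t} \<Longrightarrow> \<delta> \<le> norm (loewner_map X s a - of_real (X s))"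
  shows "state_solution \<delta> t (\<lambda>s. state (of_real (X s)) (\<lambda>i. loewner_map X s (enum i)))"
  unfolding state_solution_def
proof (intro conjI ballI)
  have t: "0 \<le> t" using X by (simp add: chain_upto_def)
  have Xc: "continuous_on {0..t} X" using X by (rule chain_upto_cont)
  have sol: "loewner_solution X a t (\<lambda>s. loewner_map X s a)" if "a \<in> S" for a
    using X that Xc t by (intro loewner_map_solution) (auto simp: chain_upto_def)
  have "state (of_real (X 0)) (\<lambda>i. loewner_map X 0 (enum i)) = state (of_real x0) enum"
    using sol enum_S X by (auto simp: state_def chain_upto_def loewner_solution_def intro!: sum.cong)
  then show "state (of_real (X 0)) (\<lambda>i. loewner_map X 0 (enum i)) = state (of_real x0) enum" .
  fix s assume s: "s \<in> {0..t}"
  let ?V = "\<lambda>s. state (of_real (X s)) (\<lambda>i. loewner_map X s (enum i))"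
  have gap': "\<delta> \<le> norm (of_real (X s) - loewner_map X s a)" if "a \<in> S" for a
    using gap[OF that s] by (simp add: norm_minus_commute)
  have "drift \<delta> (?V s) = (\<Sum>i<card S. of_real (charge (enum i)) / (of_real (X s) - loewner_map X s (enum i)))"
    unfolding drift_def using trunc_inverse_eq[OF \<delta> gap'[OF enum_S]] by (intro sum.cong) (auto simp: apply_state)
  then have dr: "drift \<delta> (?V s) = (\<Sum>a\<in>S. of_real (charge a) / (of_real (X s) - loewner_map X s a))"
    by (simp add: sum_enum[of "\<lambda>a. of_real (charge a) / (of_real (X s) - loewner_map X s a)"])
  define k where "k = Re (drift \<delta> (?V s))"
  have field_eq: "field \<delta> (?V s) = bump 0 (of_real k) + (\<Sum>i<card S. bump (Suc i) (2 / (loewner_map X s (enum i) - of_real (X s))))"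
    unfolding field_def k_def[symmetric] unfolding state_def[of "of_real k"]
    using trunc_inverse_eq[OF \<delta> gap[OF enum_S s]] by (auto simp: apply_state intro!: sum.cong)
  have D0: "((\<lambda>s. complex_of_real (X s)) has_vector_derivative of_real k) (at s within {0..t})"
  proof -
    have "(X has_vector_derivative k) (at s within {0..t})"
      unfolding k_def dr using X s unfolding chain_upto_def by blast
    from bounded_linear.has_vector_derivative[OF bounded_linear_of_real this] show ?thesis .
  qed
  show "(?V has_vector_derivative field \<delta> (?V s)) (at s within {0..t})"
    unfolding field_eq unfolding state_def
    using sol[OF enum_S] s
    by (intro has_vector_derivative_add bounded_linear.has_vector_derivative[OF bounded_linear_bump] D0 has_vector_derivative_sum)
      (auto simp: loewner_solution_def)
qed

lemma state_solution_chain_upto: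
  assumes V: "state_solution \<delta> t V" and \<delta>: "0 < \<delta>" and t: "0 \<le> t"
    and gap: "\<And>i s. i < card S \<Longrightarrow> s \<in> {0..t} \<Longrightarrow> \<delta> \<le> norm (coord (V s) (Suc i) - coord (V s) 0)"
  shows "chain_upto t (\<lambda>s. Re (coord (V s) 0))"
proof -
  define X where "X s = Re (coord (V s) 0)" for s
  have D: "((\<lambda>s. coord (V s) n) has_vector_derivative coord (field \<delta> (V s)) n) (at s within {0..t})" if "s \<in> {0..t}" for s n
    using bounded_linear.has_vector_derivative[OF bounded_linear_coord] V that by (auto simp: state_solution_def)
  have D0: "((\<lambda>s. coord (V s) 0) has_vector_derivative of_real (Re (drift \<delta> (V s)))) (at s within {0..t})" if "s \<in> {0..t}" for s
    using D[OF that, of 0] by (simp add: field_def apply_state)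
  have V0: "coord (V 0) 0 = of_real x0" "\<And>i. i < card S \<Longrightarrow> coord (V 0) (Suc i) = enum i"
    using V by (simp_all add: state_solution_def apply_state)
  \<comment> \<open>The driving coordinate has real velocity and a real start, hence remains real;
    its real part can serve as the driver.\<close>
  have "((\<lambda>s. Im (coord (V s) 0)) has_vector_derivative 0) (at s within {0..t})" if "s \<in> {0..t}" for s
    using bounded_linear.has_vector_derivative[OF bounded_linear_Im D0[OF that]] by simp
  then obtain k where k: "\<And>s. s \<in> {0..t} \<Longrightarrow> Im (coord (V s) 0) = k"
    using has_vector_derivative_zero_constant[of "{0..t}" "\<lambda>s. Im (coord (V s) 0)"] by auto
  then have "k = 0" using k[of 0] V0 t by simp
  then have VX: "coord (V s) 0 = of_real (X s)" if "s \<in> {0..t}" for s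
    using k[OF that] by (simp add: X_def complex_eq_iff)
  have DX: "(X has_vector_derivative Re (drift \<delta> (V s))) (at s within {0..t})" if "s \<in> {0..t}" for s
    using bounded_linear.has_vector_derivative[OF bounded_linear_Re D0[OF that]] by (simp add: X_def[abs_def])
  have Xc: "continuous_on {0..t} X" using DX by (rule continuous_on_vector_derivative)
  have sol: "loewner_solution X (enum i) t (\<lambda>s. coord (V s) (Suc i))" if i: "i < card S" for i
    unfolding loewner_solution_def
  proof (intro conjI ballI)
    fix s assume s: "s \<in> {0..t}"
    show "coord (V s) (Suc i) \<noteq> of_real (X s)" using gap[OF i s] VX[OF s] \<delta> by auto
    show "((\<lambda>s. coord (V s) (Suc i)) has_vector_derivative 2 / (coord (V s) (Suc i) - of_real (X s))) (at s within {0..t})"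
      using D[OF s, of "Suc i"] trunc_inverse_eq[OF \<delta> gap[OF i s]] VX[OF s] i by (simp add: field_def apply_state)
  qed (use V0 i in auto)
  have map: "loewner_map X s (enum i) = coord (V s) (Suc i)" if "i < card S" "s \<in> {0..t}" for i s
    using loewner_map_eq[OF loewner_solution_mono[OF sol[OF that(1)]], of s] continuous_on_subset[OF Xc, of "{0..s}"] that by auto
  have "chain_upto t X"
    unfolding chain_upto_def
  proof (intro conjI ballI)
    show "X 0 = x0" using V0 by (simp add: X_def)
    show "loewner_alive X t a" if "a \<in> S" for a
      using sol enum_ex[OF that] by (auto simp: loewner_alive_def)
    fix s assume s: "s \<in> {0..t}"
    have "drift \<delta> (V s) = (\<Sum>i<card S. of_real (charge (enum i)) / (of_real (X s) - loewner_map X s (enum i)))"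
      unfolding drift_def
    proof (rule sum.cong)
      fix i assume "i \<in> {..<card S}"
      then have i: "i < card S" by simp
      have "\<delta> \<le> norm (coord (V s) 0 - coord (V s) (Suc i))" using gap[OF i s] by (simp add: norm_minus_commute)
      then show "of_real (charge (enum i)) * trunc_inverse \<delta> (coord (V s) 0 - coord (V s) (Suc i)) = of_real (charge (enum i)) / (of_real (X s) - loewner_map X s (enum i))"
        using trunc_inverse_eq[OF \<delta>] map[OF i s] VX[OF s] by simp
    qed simp
    then have "drift \<delta> (V s) = (\<Sum>a\<in>S. of_real (charge a) / (of_real (X s) - loewner_map X s a))"
      by (simp add: sum_enum[of "\<lambda>a. of_real (charge a) / (of_real (X s) - loewner_map X s a)"])
    then show "(X has_vector_derivative Re (\<Sum>a\<in>S. of_real (charge a) / (of_real (X s) - loewner_map X s a))) (at s within {0..t})"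
      using DX[OF s] by simp
  qed (rule t)
  then show ?thesis by (simp add: X_def[abs_def])
qed

lemma chain_upto_gap:
  assumes X: "chain_upto t X"
  obtains \<delta> where "0 < \<delta>" "\<And>a s. a \<in> S \<Longrightarrow> s \<in> {0..t} \<Longrightarrow> \<delta> \<le> norm (loewner_map X s a - of_real (X s))"
proof -
  have t: "0 \<le> t" using X by (simp add: chain_upto_def)
  have Xc: "continuous_on {0..t} X" using X by (rule chain_upto_cont)
  have "\<exists>d>0. \<forall>s\<in>{0..t}. d \<le> norm (loewner_map X s a - of_real (X s))" if a: "a \<in> S" for a
  proof -
    have "loewner_solution X a t (\<lambda>s. loewner_map X s a)"
      using X a Xc t by (intro loewner_map_solution) (auto simp: chain_upto_def)
    then obtain d where "0 < d" "\<And>s. s \<in> {0..t} \<Longrightarrow> d \<le> norm (loewner_map X s a - of_real (X s))"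
      using loewner_solution_gap[OF _ Xc t] by blast
    then show ?thesis by blast
  qed
  then obtain d where d: "\<And>a. a \<in> S \<Longrightarrow> 0 < d a" "\<And>a s. a \<in> S \<Longrightarrow> s \<in> {0..t} \<Longrightarrow> d a \<le> norm (loewner_map X s a - of_real (X s))"
    by metis
  show ?thesis
  proof (rule that[of "Min (insert 1 (d ` S))"])
    show "0 < Min (insert 1 (d ` S))" using finS d by (subst Min_gr_iff) auto
    fix a s assume "a \<in> S" "s \<in> {0..t}"
    then show "Min (insert 1 (d ` S)) \<le> norm (loewner_map X s a - of_real (X s))"
      using finS d(2)[of a s] by (intro order_trans[OF Min_le[of _ "d a"]]) auto
  qed
qed

lemma chain_upto_unique:
  assumes X: "chain_upto t X" and Z: "chain_upto t Z" and s: "s \<in> {0..t}"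
  shows "X s = Z s"
proof -
  obtain d where d: "0 < d" "\<And>a s. a \<in> S \<Longrightarrow> s \<in> {0..t} \<Longrightarrow> d \<le> norm (loewner_map X s a - of_real (X s))"
    by (rule chain_upto_gap[OF X]) blast
  obtain e where e: "0 < e" "\<And>a s. a \<in> S \<Longrightarrow> s \<in> {0..t} \<Longrightarrow> e \<le> norm (loewner_map Z s a - of_real (Z s))"
    by (rule chain_upto_gap[OF Z]) blast
  have de: "0 < min d e" using d e by simp
  have "state_solution (min d e) t (\<lambda>s. state (of_real (X s)) (\<lambda>i. loewner_map X s (enum i)))"
    by (rule chain_upto_state_solution[OF X de]) (use d(2) in \<open>simp add: min.coboundedI1\<close>)
  moreover have "state_solution (min d e) t (\<lambda>s. state (of_real (Z s)) (\<lambda>i. loewner_map Z s (enum i)))"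
    by (rule chain_upto_state_solution[OF Z de]) (use e(2) in \<open>simp add: min.coboundedI2\<close>)
  ultimately have "state (of_real (X s)) (\<lambda>i. loewner_map X s (enum i)) = state (of_real (Z s)) (\<lambda>i. loewner_map Z s (enum i))"
    by (rule state_solution_unique[OF de _ _ s])
  then have "coord (state (of_real (X s)) (\<lambda>i. loewner_map X s (enum i))) 0 = coord (state (of_real (Z s)) (\<lambda>i. loewner_map Z s (enum i))) 0"
    by simp
  then show ?thesis by (simp add: apply_state)
qed

lemma chain_upto_0: "chain_upto 0 (\<lambda>_. x0)"
  unfolding chain_upto_def
proof (intro conjI ballI)
  fix a assume "a \<in> S"
  then have "a \<noteq> of_real x0" using x0_S by auto
  then show "loewner_alive (\<lambda>_. x0) 0 a" by (subst loewner_alive_0)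
next
  fix s :: real assume "s \<in> {0..0}"
  then have s: "s = 0" by simp
  show "((\<lambda>_. x0) has_vector_derivative
      Re (\<Sum>a\<in>S. of_real (charge a) / (of_real x0 - loewner_map (\<lambda>_. x0) s a))) (at s within {0..0})"
    unfolding s has_vector_derivative_def
    by (simp only: atLeastAtMost_singleton has_derivative_within_singleton_iff bounded_linear_scaleR_left)
qed simp_all

text \<open>While all gaps are at least \<open>\<delta>\<close>, a gap changes at speed at most (2 +
  2 \<open>card S\<close>) / \<delta>, hence by at most \<delta> / 2 during this time. A gap that
  starts at \<open>2 * \<delta>\<close> therefore cannot fall to \<open>\<delta>\<close>.\<close>

definition step :: "real \<Rightarrow> real" where
  "step \<delta> = \<delta>\<^sup>2 / (2 * (2 + 2 * real (card S)))"

lemma step_pos: "0 < \<delta> \<Longrightarrow> 0 < step \<delta>"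
  unfolding step_def by (intro divide_pos_pos) auto

text \<open>The length of the extension depends on the gaps at the final time only, not on those in
  the past. This is what turns gaps bounded below along a sequence of times into a contradiction
  with maximality.\<close>

lemma chain_upto_extend:
  assumes X: "chain_upto t X" and \<delta>: "0 < \<delta>"
    and far: "\<And>a. a \<in> S \<Longrightarrow> 2 * \<delta> \<le> norm (loewner_map X t a - of_real (X t))"
  obtains Z where "chain_upto (t + step \<delta>) Z"
proof -
  have t: "0 \<le> t" using X by (simp add: chain_upto_def)
  obtain d where d: "0 < d" "\<And>a s. a \<in> S \<Longrightarrow> s \<in> {0..t} \<Longrightarrow> d \<le> norm (loewner_map X s a - of_real (X s))"
    by (rule chain_upto_gap[OF X]) blast
  \<comment> \<open>The truncation level must respect the gaps on the whole past interval, which may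
    have been smaller than \<open>\<delta>\<close>.\<close>
  define e where "e = min d \<delta>"
  have e: "0 < e" "e \<le> \<delta>" "e \<le> d" using d \<delta> by (auto simp: e_def)
  define h where "h = step \<delta>"
  have h: "0 < h" using step_pos[OF \<delta>] by (simp add: h_def)
  obtain V where V: "state_solution e (t + h) V"
    using state_solution_exists[OF e(1), of "t + h"] t h by auto
  have "state_solution e t (\<lambda>s. state (of_real (X s)) (\<lambda>i. loewner_map X s (enum i)))"
    by (rule chain_upto_state_solution[OF X e(1)]) (use d(2) e(3) order_trans in blast)
  then have VX: "V s = state (of_real (X s)) (\<lambda>i. loewner_map X s (enum i))" if "s \<in> {0..t}" for s
    using state_solution_unique[OF e(1) state_solution_mono[OF V] _ that] h by auto
  define p where "p i s = coord (V s) (Suc i) - coord (V s) 0" for i s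
  have p': "(p i has_vector_derivative (2 * trunc_inverse e (p i s) - of_real (Re (drift e (V s))))) (at s within {0..t + h})"
    if i: "i < card S" and s: "s \<in> {0..t + h}" for i s
  proof -
    have D: "((\<lambda>s. coord (V s) n) has_vector_derivative coord (field e (V s)) n) (at s within {0..t + h})" for n
      using bounded_linear.has_vector_derivative[OF bounded_linear_coord] V s by (auto simp: state_solution_def)
    show ?thesis
      using has_vector_derivative_diff[OF D[of "Suc i"] D[of 0]] i by (simp add: p_def[abs_def] field_def apply_state)
  qed
  have pcont: "continuous_on {0..t + h} (p i)" if "i < card S" for i
    using p'[OF that] by (rule continuous_on_vector_derivative)
  have pt: "2 * \<delta> \<le> norm (p i t)" if i: "i < card S" for i
    using far[OF enum_S[OF i]] VX[of t] t i by (simp add: p_def apply_state)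
  have main: "\<delta> < norm (p i s)" if i: "i < card S" and s: "s \<in> {t..t + h}" for i s
  proof (rule ccontr)
    assume neg: "\<not> \<delta> < norm (p i s)"
    define B where "B = (\<Union>i<card S. {s \<in> {t..t + h}. norm (p i s) \<le> \<delta>})"
    have "closed {s \<in> {t..t + h}. norm (p i s) \<le> \<delta>}" if "i < card S" for i
    proof (rule continuous_on_closed_Collect_le)
      show "continuous_on {t..t + h} (\<lambda>s. norm (p i s))"
        using t by (intro continuous_on_norm continuous_on_subset[OF pcont[OF that]]) auto
    qed (auto intro: continuous_on_const)
    then have "closed B" unfolding B_def by (intro closed_UN) auto
    moreover have "bounded B" by (rule bounded_subset[of "{t..t + h}"]) (auto simp: B_def)
    moreover have "s \<in> B" unfolding B_def using neg s i by (intro UN_I[of i]) auto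
    then have "B \<noteq> {}" by auto
    ultimately obtain q where q: "q \<in> B" "\<And>r. r \<in> B \<Longrightarrow> q \<le> r"
      using compact_attains_inf[of B] by (auto simp: compact_eq_bounded_closed)
    obtain j where j: "j < card S" "q \<in> {t..t + h}" "norm (p j q) \<le> \<delta>" using q(1) by (auto simp: B_def)
    have tq: "t < q" using pt[OF j(1)] j(2,3) \<delta> by (cases "q = t") auto
    have ge: "\<delta> \<le> norm (p k r)" if k: "k < card S" and r: "r \<in> {t..q}" for k r
    proof (rule continuous_ge_on_closure[of "{t..<q}" "\<lambda>r. norm (p k r)"])
      show "continuous_on (closure {t..<q}) (\<lambda>r. norm (p k r))"
        using tq t j(2) by (auto intro!: continuous_intros continuous_on_subset[OF pcont[OF k]])
      show "r \<in> closure {t..<q}" using r tq by simp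
      fix r assume r: "r \<in> {t..<q}"
      show "\<delta> \<le> norm (p k r)"
      proof (rule ccontr)
        assume "\<not> \<delta> \<le> norm (p k r)"
        then have "r \<in> B" unfolding B_def using k r j(2) by (intro UN_I[of k]) auto
        then show False using q(2)[of r] r by auto
      qed
    qed
    have trunc_inverse_le: "norm (trunc_inverse e w) \<le> 1 / \<delta>" if "\<delta> \<le> norm w" for w
      using trunc_inverse_eq[OF e(1), of w] that e(2) \<delta> by (simp add: norm_divide frac_le)
    have speed: "norm (2 * trunc_inverse e (p j r) - of_real (Re (drift e (V r))) - 0) \<le> (2 + 2 * real (card S)) / \<delta>"
      if r: "r \<in> {t..q}" for r
    proof -
      have "norm (drift e (V r)) \<le> (\<Sum>k<card S. 2 * (1 / \<delta>))"
        unfolding drift_def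
      proof (rule sum_norm_le)
        fix k assume "k \<in> {..<card S}"
        then have "\<delta> \<le> norm (coord (V r) 0 - coord (V r) (Suc k))" using ge[OF _ r, of k] by (simp add: p_def norm_minus_commute)
        then have "\<bar>charge (enum k)\<bar> * norm (trunc_inverse e (coord (V r) 0 - coord (V r) (Suc k))) \<le> 2 * (1 / \<delta>)"
          using abs_charge trunc_inverse_le by (intro mult_mono) auto
        then show "norm (complex_of_real (charge (enum k)) * trunc_inverse e (coord (V r) 0 - coord (V r) (Suc k))) \<le> 2 * (1 / \<delta>)"
          by (simp add: norm_mult)
      qed
      then have "norm (complex_of_real (Re (drift e (V r)))) \<le> 2 * real (card S) / \<delta>"
        using abs_Re_le_cmod[of "drift e (V r)"] by (simp add: mult.commute)
      moreover have "norm (2 * trunc_inverse e (p j r)) \<le> 2 / \<delta>"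
        using trunc_inverse_le[OF ge[OF j(1) r]] by (simp add: norm_mult)
      ultimately show ?thesis
        using norm_triangle_ineq4[of "2 * trunc_inverse e (p j r)" "of_real (Re (drift e (V r)))"] by (simp add: add_divide_distrib)
    qed
    have "norm (p j q - p j t - (q - t) *\<^sub>R 0) \<le> (2 + 2 * real (card S)) / \<delta> * (q - t)"
    proof (rule vector_mean_value_bound[OF _ _ speed])
      fix r assume "r \<in> {t..q}"
      then show "(p j has_vector_derivative 2 * trunc_inverse e (p j r) - of_real (Re (drift e (V r)))) (at r within {t..q})"
        using j t by (intro has_vector_derivative_within_subset[OF p'[OF j(1)]]) auto
    qed (use tq in auto)
    also have "\<dots> \<le> (2 + 2 * real (card S)) / \<delta> * h"
      using j(2) \<delta> by (intro mult_left_mono) auto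
    also have "\<dots> = \<delta> / 2"
    proof -
      have "k / \<delta> * (\<delta>\<^sup>2 / (2 * k)) = \<delta> / 2" if "0 < k" for k
        using \<delta> that by (simp add: field_simps power2_eq_square)
      moreover have "0 < 2 + 2 * real (card S)" by simp
      ultimately show ?thesis unfolding h_def step_def by blast
    qed
    finally have "norm (p j q - p j t) \<le> \<delta> / 2" by simp
    moreover have "norm (p j t) \<le> norm (p j q) + norm (p j q - p j t)"
      using norm_triangle_ineq4[of "p j q" "p j q - p j t"] by simp
    ultimately show False using pt[OF j(1)] j(3) \<delta> by linarith
  qed
  have "e \<le> norm (coord (V s) (Suc i) - coord (V s) 0)" if i: "i < card S" and s: "s \<in> {0..t + h}" for i s
  proof (cases "s \<le> t")
    case True
    then show ?thesis using VX[of s] d(2)[OF enum_S[OF i], of s] e(3) s i by (auto simp: apply_state)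
  next
    case False
    then show ?thesis using main[OF i, of s] s e(2) by (simp add: p_def)
  qed
  then have "chain_upto (t + h) (\<lambda>s. Re (coord (V s) 0))"
    using t h by (intro state_solution_chain_upto[OF V e(1)]) auto
  then show ?thesis using that by (simp add: h_def)
qed

lemma chain_upto_cong:
  assumes "chain_upto t X" "\<And>s. s \<in> {0..t} \<Longrightarrow> X s = Z s"
  shows "chain_upto t Z"
  unfolding chain_upto_def
proof (intro conjI ballI)
  show "0 \<le> t" using assms by (simp add: chain_upto_def)
  then show "Z 0 = x0" using assms(1) assms(2)[of 0] by (simp add: chain_upto_def)
  show "loewner_alive Z t a" if "a \<in> S" for a
    using assms that loewner_alive_driver_cong[of t X Z a] by (simp add: chain_upto_def)
  fix s assume s: "s \<in> {0..t}"
  have "loewner_map X s a = loewner_map Z s a" for a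
    using s by (intro loewner_map_driver_cong assms) auto
  then have eq: "(\<Sum>a\<in>S. of_real (charge a) / (of_real (X s) - loewner_map X s a)) =
      (\<Sum>a\<in>S. of_real (charge a) / (of_real (Z s) - loewner_map Z s a))"
    by (simp only: assms(2)[OF s])
  have "(X has_vector_derivative Re (\<Sum>a\<in>S. of_real (charge a) / (of_real (Z s) - loewner_map Z s a))) (at s within {0..t})"
    unfolding eq[symmetric] using assms(1) s unfolding chain_upto_def by blast
  then show "(Z has_vector_derivative Re (\<Sum>a\<in>S. of_real (charge a) / (of_real (Z s) - loewner_map Z s a))) (at s within {0..t})"
    by (rule has_vector_derivative_transform[OF s, rotated]) (simp add: assms)
qed

lemma chain_upto_mono:
  assumes X: "chain_upto t X" and s: "0 \<le> s" "s \<le> t"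
  shows "chain_upto s X"
  unfolding chain_upto_def
proof (intro conjI ballI)
  show "X 0 = x0" using X by (simp add: chain_upto_def)
  show "loewner_alive X s a" if "a \<in> S" for a
    using X that loewner_alive_mono[OF _ s(2)] by (auto simp: chain_upto_def)
  fix r assume "r \<in> {0..s}"
  then show "(X has_vector_derivative Re (\<Sum>a\<in>S. of_real (charge a) / (of_real (X r) - loewner_map X r a))) (at r within {0..s})"
    using X s by (intro has_vector_derivative_within_subset[of X _ r "{0..t}" "{0..s}"]) (auto simp: chain_upto_def)
qed (rule s)

end

text \<open>Maximality of \<open>T\<close> in the form in which it is used: whenever all gaps at a
  time \<open>t\<close> are at least \<open>2 * \<delta>\<close>, the remaining lifetime is at least
  \<open>step \<delta>\<close>.\<close>

locale sle_maximal = sle_solution x0 Y A \<kappa> \<eta> x1 K X X' T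
  for x0 Y A \<kappa> \<eta> x1 K X X' T +
  assumes blowup: "\<And>\<delta> t. 0 < \<delta> \<Longrightarrow> t \<in> {0..<T} \<Longrightarrow>
      (\<And>a. a \<in> S \<Longrightarrow> 2 * \<delta> \<le> norm (loewner_map X t a - of_real (X t))) \<Longrightarrow> t + step \<delta> \<le> T"

section \<open>From chains on closed intervals to the maximal chain\<close>

context sle_geometry
begin

lemma chain_upto_solution:
  assumes T: "0 < T" and X: "\<And>t. t \<in> {0..<T} \<Longrightarrow> chain_upto t X"
  shows "sle_solution x0 Y A \<kappa> \<eta> x1 K X (\<lambda>s. Re (\<Sum>a\<in>S. of_real (charge a) / (of_real (X s) - loewner_map X s a))) T"
proof -
  let ?D = "\<lambda>s. Re (\<Sum>a\<in>S. of_real (charge a) / (of_real (X s) - loewner_map X s a))"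
  have 1: "(X has_vector_derivative ?D s) (at s within {0..<T})" if s: "s \<in> {0..<T}" for s
  proof -
    define t where "t = (s + T) / 2"
    have t: "s < t" "t < T" "0 \<le> t" using s by (auto simp: t_def)
    have "(X has_vector_derivative ?D s) (at s within {0..t})"
      using X[of t] t s by (auto simp: chain_upto_def simp del: Re_sum)
    moreover have "at s within {0..t} = at s within {0..<T}"
      by (rule at_within_nhd[of s "{..<t}"]) (use t s in auto)
    ultimately show ?thesis by simp
  qed
  have 2: "\<exists>M. \<forall>s\<in>{0..t}. \<bar>?D s\<bar> \<le> M" if t: "t \<in> {0..<T}" for t
  proof -
    have Xc: "continuous_on {0..t} X" by (rule chain_upto_cont[OF X[OF t]])
    have sol: "loewner_solution X a t (\<lambda>s. loewner_map X s a)" if "a \<in> S" for a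
      using X[OF t] that Xc t by (intro loewner_map_solution) (auto simp: chain_upto_def)
    have "continuous_on {0..t} (\<lambda>s. of_real (charge a) / (of_real (X s) - loewner_map X s a))" if a: "a \<in> S" for a
    proof (intro continuous_intros Xc loewner_solution_cont[OF sol[OF a]] ballI)
      fix s assume "s \<in> {0..t}"
      then have "loewner_map X s a \<noteq> of_real (X s)" using sol[OF a] by (simp add: loewner_solution_def)
      then show "of_real (X s) - loewner_map X s a \<noteq> 0" by auto
    qed
    then have "continuous_on {0..t} ?D" by (intro continuous_on_Re continuous_on_sum) auto
    then have "compact (?D ` {0..t})" by (intro compact_continuous_image) auto
    then have "bounded (?D ` {0..t})" by (rule compact_imp_bounded)
    then obtain M where "\<forall>y\<in>?D ` {0..t}. norm y \<le> M" unfolding bounded_iff by blast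
    then have "\<forall>s\<in>{0..t}. \<bar>?D s\<bar> \<le> M" by (simp del: Re_sum)
    then show ?thesis by blast
  qed
  have 3: "loewner_alive X t a" if "a \<in> U" "0 \<le> t" "t < T" for a t
    using X[of t] that by (auto simp: chain_upto_def S_def)
  have "X 0 = x0" using X[of 0] T by (auto simp: chain_upto_def)
  then show ?thesis
    by unfold_locales (use T 1 2 3 initial_residue in auto)
qed

definition solvable :: "real set" where "solvable = {t. \<exists>X. chain_upto t X}"
definition max_time :: real where "max_time = Sup solvable"
text \<open>The chosen chain depends on \<open>t\<close>; by \<open>chain_upto_unique\<close> the
  choices agree, so that the values fit together to one driver.\<close>

definition max_driver :: "real \<Rightarrow> real" where "max_driver t = (SOME X. chain_upto t X) t"

text \<open>A chain up to \<open>t\<close> is a solution on the half-open interval before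
  \<open>t\<close>, to which \<open>time_bounded\<close> applies with \<open>t\<close> as
  lifetime.\<close>

lemma solvable_bdd: "bdd_above solvable"
proof (rule bdd_aboveI)
  fix t assume "t \<in> solvable"
  then obtain X where X: "chain_upto t X" by (auto simp: solvable_def)
  show "t \<le> driver_bound\<^sup>2 / 4"
  proof (cases "t = 0")
    case False
    then have t: "0 < t" using X by (simp add: chain_upto_def)
    have "chain_upto s X" if "s \<in> {0..<t}" for s using chain_upto_mono[OF X] that by auto
    from sle_solution.time_bounded[OF chain_upto_solution[OF t this]] show ?thesis by simp
  qed simp
qed

lemma max_time_pos: "0 < max_time"
proof -
  obtain \<delta> where \<delta>: "0 < \<delta>" "\<And>a s. a \<in> S \<Longrightarrow> s \<in> {0..0} \<Longrightarrow> \<delta> \<le> norm (loewner_map (\<lambda>_. x0) s a - of_real x0)"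
    by (rule chain_upto_gap[OF chain_upto_0]) blast
  obtain Z where "chain_upto (0 + step (\<delta> / 2)) Z"
    by (rule chain_upto_extend[OF chain_upto_0, of "\<delta> / 2"]) (use \<delta> in auto)
  then have "step (\<delta> / 2) \<in> solvable" by (auto simp: solvable_def)
  then have "step (\<delta> / 2) \<le> max_time" unfolding max_time_def by (rule cSup_upper[OF _ solvable_bdd])
  then show ?thesis using step_pos[of "\<delta> / 2"] \<delta> by simp
qed

lemma max_driver_chain:
  assumes t: "t \<in> {0..<max_time}"
  shows "chain_upto t max_driver"
proof -
  have ne: "solvable \<noteq> {}" using chain_upto_0 by (auto simp: solvable_def)
  obtain r where r: "r \<in> solvable" "t < r"
    using less_cSup_iff[OF ne solvable_bdd, of t] t by (auto simp: max_time_def)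
  then obtain X where X: "chain_upto r X" by (auto simp: solvable_def)
  have Xs: "chain_upto s X" if "s \<in> {0..t}" for s using chain_upto_mono[OF X] that r by auto
  have "X s = max_driver s" if s: "s \<in> {0..t}" for s
  proof -
    have "chain_upto s (SOME X. chain_upto s X)" by (rule someI[where P = "chain_upto s", OF Xs[OF s]])
    then show ?thesis unfolding max_driver_def using s by (intro chain_upto_unique[OF Xs[OF s]]) auto
  qed
  then show ?thesis using chain_upto_cong[OF Xs[of t]] t by auto
qed

lemma maximal_exists: "\<exists>X X' T. sle_maximal x0 Y A \<kappa> \<eta> x1 K X X' T"
proof -
  have sol: "sle_solution x0 Y A \<kappa> \<eta> x1 K max_driver
      (\<lambda>s. Re (\<Sum>a\<in>S. of_real (charge a) / (of_real (max_driver s) - loewner_map max_driver s a))) max_time"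
    by (rule chain_upto_solution[OF max_time_pos max_driver_chain])
  moreover have "t + step \<delta> \<le> max_time"
    if \<delta>: "0 < \<delta>" and t: "t \<in> {0..<max_time}"
      and far: "\<And>a. a \<in> S \<Longrightarrow> 2 * \<delta> \<le> norm (loewner_map max_driver t a - of_real (max_driver t))" for \<delta> t
  proof -
    obtain Z where "chain_upto (t + step \<delta>) Z"
      by (rule chain_upto_extend[OF max_driver_chain[OF t] \<delta> far])
    then show ?thesis unfolding max_time_def by (intro cSup_upper solvable_bdd) (auto simp: solvable_def)
  qed
  ultimately have "sle_maximal x0 Y A \<kappa> \<eta> x1 K max_driver
      (\<lambda>s. Re (\<Sum>a\<in>S. of_real (charge a) / (of_real (max_driver s) - loewner_map max_driver s a))) max_time"
    by (intro sle_maximal.intro sle_maximal_axioms.intro) auto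
  then show ?thesis by blast
qed

end

section \<open>Exhaustion of the curve\<close>

context sle_solution
begin

text \<open>Outside radius \<open>driver_bound\<close> + 1 the distance to the driver is at least 1
  and the speed at most 2. Follow the solution from its last time inside this disc, or from time 0.
  The bound is uniform up to \<open>T\<close> and supplies the hypothesis of Montel's
  theorem.\<close>

lemma g_bounded:
  assumes al: "alive t z" and t: "0 \<le> t" "t < T"
  shows "norm (g t z) \<le> norm z + driver_bound + 1 + 2 * T"
proof -
  let ?B = "driver_bound + 1"
  have B: "0 \<le> ?B" using driver_bounded[of 0] T_pos by auto
  have z0: "g 0 z = z" using g_0 alive_neq[OF al t(1)] by auto
  have contg: "continuous_on {0..t} (\<lambda>s. norm (g s z))"
    by (intro continuous_on_norm g_cont[OF al t(2)])
  have run: "norm (g t z) \<le> norm (g q z) + 2 * T"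
    if q: "q \<in> {0..t}" and far: "\<And>s. s \<in> {q..t} \<Longrightarrow> ?B \<le> norm (g s z)" for q
  proof -
    have "norm (g t z - g q z - (t - q) *\<^sub>R 0) \<le> 2 * (t - q)"
    proof (rule vector_mean_value_bound)
      fix s assume s: "s \<in> {q..t}"
      show "((\<lambda>s. g s z) has_vector_derivative 2 / (g s z - of_real (X s))) (at s within {q..t})"
        using q s by (intro has_vector_derivative_within_subset[OF g_deriv[OF al t(2)]]) auto
      have "\<bar>X s\<bar> < driver_bound" using s q t by (intro driver_bounded) auto
      then have "1 \<le> norm (g s z - of_real (X s))"
        using far[OF s] norm_triangle_ineq2[of "g s z" "of_real (X s)"] by simp
      then show "norm (2 / (g s z - of_real (X s)) - 0) \<le> 2"
        by (simp add: norm_divide divide_le_eq)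
    qed (use q in auto)
    then have "norm (g t z - g q z) \<le> 2 * T" using q t by simp
    then show ?thesis using norm_triangle_sub[of "g t z" "g q z"] by linarith
  qed
  define S where "S = {s \<in> {0..t}. norm (g s z) \<le> ?B}"
  show ?thesis
  proof (cases "S = {}")
    case True
    have far: "?B \<le> norm (g s z)" if "s \<in> {0..t}" for s
      using True that unfolding S_def by force
    have "norm (g t z) \<le> norm (g 0 z) + 2 * T"
      by (rule run) (use t far in auto)
    then show ?thesis using z0 B by simp
  next
    case False
    have "closed S" unfolding S_def
      by (rule continuous_on_closed_Collect_le[OF contg]) auto
    moreover have "bounded S" by (rule bounded_subset[of "{0..t}"]) (auto simp: S_def)
    ultimately obtain q where q: "q \<in> S" "\<And>p. p \<in> S \<Longrightarrow> p \<le> q"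
      using compact_attains_sup[of S] False by (auto simp: compact_eq_bounded_closed)
    have qt: "q \<in> {0..t}" using q(1) by (simp add: S_def)
    have *: "norm (g t z) \<le> ?B + 2 * T"
    proof (cases "q = t")
      case True
      then show ?thesis using q(1) T_pos by (simp add: S_def)
    next
      case False
      have "norm (g t z) \<le> norm (g q z) + 2 * T"
      proof (rule run[OF qt])
        fix s assume s: "s \<in> {q..t}"
        show "?B \<le> norm (g s z)"
        proof (rule continuous_ge_on_closure[of "{q<..t}" "\<lambda>s. norm (g s z)"])
          show "continuous_on (closure {q<..t}) (\<lambda>s. norm (g s z))"
            using qt False by (auto intro!: continuous_on_subset[OF contg])
          show "s \<in> closure {q<..t}" using s qt False by simp
          fix r assume "r \<in> {q<..t}"
          then show "?B \<le> norm (g r z)" using q(2)[of r] qt by (force simp: S_def)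
        qed
      qed
      then show ?thesis using q(1) by (simp add: S_def)
    qed
    then show ?thesis using norm_ge_zero[of z] by linarith
  qed
qed

definition arc_time :: "real \<Rightarrow> real" where
  "arc_time t = the_inv_into {0..1} \<eta> (trace t)"

lemma arc_inj: "inj_on \<eta> {0..1}" and arc_cont: "continuous_on {0..1} \<eta>"
  using arc by (auto simp: arc_def path_def)

lemma arc_time_eq: "t \<in> {0..<T} \<Longrightarrow> \<eta> (arc_time t) = trace t \<and> arc_time t \<in> {0..1}"
  using trace_in_arc[of t] f_the_inv_into_f[OF arc_inj, of "trace t"] the_inv_into_into[OF arc_inj, of "trace t" "{0..1}"]
  by (auto simp: arc_time_def path_image_def)

lemma arc_time_0: "arc_time 0 = 0"
proof -
  have "\<eta> 0 = trace 0" using start by (simp add: pathstart_def trace_def X0)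
  then show ?thesis unfolding arc_time_def using the_inv_into_f_f[OF arc_inj, of 0] by auto
qed

lemma arc_time_inj: "inj_on arc_time {0..<T}"
proof (rule inj_onI)
  fix a b assume a: "a \<in> {0..<T}" and b: "b \<in> {0..<T}" and "arc_time a = arc_time b"
  then have "trace a = trace b" using arc_time_eq[OF a] arc_time_eq[OF b] by metis
  then show "a = b" using trace_inj a b by (auto dest: inj_onD)
qed

lemma arc_time_cont: "continuous_on {0..<T} arc_time"
proof -
  have "continuous_on (path_image \<eta>) (the_inv_into {0..1} \<eta>)"
    unfolding path_image_def by (rule continuous_on_inv_into[OF arc_cont _ arc_inj]) auto
  then have "continuous_on {0..<T} (the_inv_into {0..1} \<eta> \<circ> trace)"
    by (intro continuous_on_compose trace_continuous) (rule continuous_on_subset, auto intro: trace_in_arc)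
  then show ?thesis by (simp add: arc_time_def[abs_def] o_def)
qed

lemma arc_time_pos: "t \<in> {0<..<T} \<Longrightarrow> 0 < arc_time t \<and> arc_time t < 1"
proof -
  assume t: "t \<in> {0<..<T}"
  have "0 < Im (trace t)" using trace_killed[of t] t by auto
  then have "trace t \<noteq> of_real x0" "trace t \<noteq> of_real x1" by auto
  moreover have "\<eta> 0 = of_real x0" "\<eta> 1 = of_real x1" using start finish by (auto simp: pathstart_def pathfinish_def)
  ultimately have "arc_time t \<noteq> 0" "arc_time t \<noteq> 1" using arc_time_eq[of t] t by auto
  then show ?thesis using arc_time_eq[of t] t by auto
qed

text \<open>An injective continuous function on an interval is monotone, and this one starts at its
  minimum 0.\<close>

lemma arc_time_less:
  assumes "0 \<le> s" "s < t" "t < T"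
  shows "arc_time s < arc_time t"
proof (cases "s = 0")
  case True
  then show ?thesis using arc_time_0 arc_time_pos[of t] assms by auto
next
  case False
  then have s: "0 < arc_time s" using arc_time_pos[of s] assms by auto
  have sub: "{0..t} \<subseteq> {0..<T}" using assms by auto
  have "(arc_time 0 < arc_time s \<and> arc_time s < arc_time t) \<or> (arc_time t < arc_time s \<and> arc_time s < arc_time 0)"
    using False assms
    by (intro continuous_inj_imp_mono continuous_on_subset[OF arc_time_cont sub] inj_on_subset[OF arc_time_inj sub]) auto
  then show ?thesis using arc_time_0 s by linarith
qed

text \<open>The parameter up to which the arc is traced before \<open>T\<close>; it is approached
  but not attained.\<close>

definition arc_end :: real where "arc_end = Sup (arc_time ` {0..<T})"

lemma arc_time_bdd: "bdd_above (arc_time ` {0..<T})"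
  using arc_time_eq by (auto intro!: bdd_aboveI[of _ 1])

lemma arc_time_lt_end:
  assumes t: "t \<in> {0..<T}"
  shows "arc_time t < arc_end"
proof -
  have "arc_time t < arc_time ((t + T) / 2)" using t by (intro arc_time_less) auto
  also have "\<dots> \<le> arc_end" unfolding arc_end_def by (intro cSup_upper arc_time_bdd imageI) (use t in auto)
  finally show ?thesis .
qed

lemma arc_end: "0 < arc_end" "arc_end \<le> 1"
proof -
  show "0 < arc_end" using arc_time_lt_end[of 0] arc_time_0 T_pos by simp
  show "arc_end \<le> 1" unfolding arc_end_def
    using T_pos arc_time_eq by (intro cSup_least) auto
qed

lemma arc_time_image: "arc_time ` {0..<T} = {0..<arc_end}"
proof (intro set_eqI iffI)
  fix s assume "s \<in> arc_time ` {0..<T}"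
  then show "s \<in> {0..<arc_end}" using arc_time_lt_end arc_time_eq by fastforce
next
  fix s assume s: "s \<in> {0..<arc_end}"
  then obtain t where t: "t \<in> {0..<T}" "s < arc_time t"
    using less_cSup_iff[OF _ arc_time_bdd, of s] T_pos by (auto simp: arc_end_def)
  have "\<exists>r\<ge>0. r \<le> t \<and> arc_time r = s"
    using s t arc_time_0 by (intro IVT' continuous_on_subset[OF arc_time_cont]) auto
  then show "s \<in> arc_time ` {0..<T}" using t by fastforce
qed

lemma arc_time_tendsto: "(arc_time \<longlongrightarrow> arc_end) (at_left T)"
proof (rule order_tendstoI)
  fix a assume "a < arc_end"
  then obtain t where t: "t \<in> {0..<T}" "a < arc_time t"
    using less_cSup_iff[OF _ arc_time_bdd, of a] T_pos by (auto simp: arc_end_def)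
  have "\<forall>\<^sub>F s in at_left T. s \<in> {t<..<T}" using t by (intro eventually_at_left_real) auto
  then show "\<forall>\<^sub>F s in at_left T. a < arc_time s"
  proof eventually_elim
    case (elim s)
    then show ?case using arc_time_less[of t s] t by auto
  qed
next
  fix a assume a: "arc_end < a"
  have "\<forall>\<^sub>F s in at_left T. s \<in> {0<..<T}" using T_pos by (intro eventually_at_left_real) auto
  then show "\<forall>\<^sub>F s in at_left T. arc_time s < a"
  proof eventually_elim
    case (elim s)
    then show ?case using arc_time_lt_end[of s] a by auto
  qed
qed

lemma trace_image: "trace ` {0..<T} = \<eta> ` {0..<arc_end}"
proof -
  have "trace ` {0..<T} = (\<lambda>t. \<eta> (arc_time t)) ` {0..<T}"
    using arc_time_eq by (intro image_cong) auto
  also have "\<dots> = \<eta> ` arc_time ` {0..<T}" by (simp only: image_image)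
  finally show ?thesis by (simp only: arc_time_image)
qed

lemma trace_tendsto: "(trace \<longlongrightarrow> \<eta> arc_end) (at_left T)"
proof -
  have "((\<lambda>t. \<eta> (arc_time t)) \<longlongrightarrow> \<eta> arc_end) (at_left T)"
  proof (rule continuous_within_tendsto_compose[where f = \<eta> and x = arc_time and a = arc_end and S = "{0..1}"])
    show "continuous (at arc_end within {0..1}) \<eta>"
      using arc_cont arc_end by (auto simp: continuous_on_eq_continuous_within)
    have "\<forall>\<^sub>F s in at_left T. s \<in> {0<..<T}" using T_pos by (intro eventually_at_left_real) auto
    then show "\<forall>\<^sub>F s in at_left T. arc_time s \<in> {0..1}"
      by eventually_elim (use arc_time_eq in auto)
  qed (rule arc_time_tendsto)
  moreover have "\<forall>\<^sub>F s in at_left T. s \<in> {0<..<T}" using T_pos by (intro eventually_at_left_real) auto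
  then have "\<forall>\<^sub>F s in at_left T. \<eta> (arc_time s) = trace s"
    by eventually_elim (use arc_time_eq in auto)
  ultimately show ?thesis by (rule Lim_transform_eventually)
qed

lemma trace_closure: "closure (trace ` {0..<T}) = \<eta> ` {0..arc_end}"
proof
  have "closed (\<eta> ` {0..arc_end})"
    using arc_end by (intro compact_imp_closed compact_continuous_image continuous_on_subset[OF arc_cont]) auto
  then show "closure (trace ` {0..<T}) \<subseteq> \<eta> ` {0..arc_end}"
    unfolding trace_image by (intro closure_minimal image_mono) auto
  have "\<eta> ` closure {0..<arc_end} \<subseteq> closure (\<eta> ` {0..<arc_end})"
    using arc_end by (intro image_closure_subset[of _ \<eta>] continuous_on_subset[OF arc_cont] closure_subset) auto
  then show "\<eta> ` {0..arc_end} \<subseteq> closure (trace ` {0..<T})"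
    unfolding trace_image using arc_end by simp
qed

text \<open>If the arc were not exhausted, the maps \<open>g\<^sub>t\<close> would form a normal family of nonvanishing
  functions \<open>g\<^sub>t - X\<^sub>t\<close> on the connected complement of the traced piece and its mirror image; by
  Hurwitz no atom can collide with the driving function.\<close>

lemma no_collision_before_end:
  assumes lt: "arc_end < 1"
  obtains t \<delta> where "t \<longlonglongrightarrow> T" "0 < \<delta>" "\<And>n::nat. t n \<in> {0..<T}"
    "\<And>n a. a \<in> S \<Longrightarrow> \<delta> \<le> norm (g (t n) a - of_real (X (t n)))"
proof -
  define P where "P = \<eta> ` {0..arc_end}"
  define \<Omega> where "\<Omega> = - (P \<union> cnj ` P)"
  have compP: "compact P" unfolding P_def
    using arc_end by (intro compact_continuous_image continuous_on_subset[OF arc_cont]) auto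
  have op: "open \<Omega>" unfolding \<Omega>_def
    using compP by (intro open_Compl closed_Un compact_imp_closed compact_continuous_image continuous_intros) auto
  define \<eta>1 where "\<eta>1 = subpath 0 arc_end \<eta>"
  have arc1: "arc \<eta>1" unfolding \<eta>1_def using arc arc_end by (intro arc_subpath_arc) auto
  have pi1: "path_image \<eta>1 = P" using arc_end by (simp add: \<eta>1_def P_def path_image_subpath)
  have st1: "pathstart \<eta>1 = of_real x0" using start by (simp add: \<eta>1_def pathstart_def subpath_def)
  define \<eta>2 where "\<eta>2 = reversepath (cnj \<circ> \<eta>1)"
  have arc2: "arc \<eta>2" unfolding \<eta>2_def
    by (intro arc_reversepath) (use arc1 in \<open>auto simp: arc_def path_def inj_on_def intro!: continuous_intros continuous_on_cnj\<close>)
  have pi2: "path_image \<eta>2 = cnj ` P" by (simp add: \<eta>2_def path_image_compose pi1)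
  have ImP: "0 < Im z \<or> z = of_real x0" if z: "z \<in> P" for z
  proof -
    obtain s where s: "s \<in> {0..arc_end}" "z = \<eta> s" using z by (auto simp: P_def)
    show ?thesis
    proof (cases "s = 0")
      case True
      then show ?thesis using s start by (simp add: pathstart_def)
    next
      case False
      then show ?thesis using s lt Im_arc[of s] by auto
    qed
  qed
  \<comment> \<open>The traced piece and its mirror image meet in \<open>x0\<close> only, since the
    piece stops before the second real endpoint. They form an arc, and the complement of an arc in
    the plane is connected. A completed curve would close up with its mirror image instead.\<close>
  have "arc (\<eta>2 +++ \<eta>1)"
  proof (rule arc_join[OF arc2 arc1])
    show "pathfinish \<eta>2 = pathstart \<eta>1"
      by (simp add: \<eta>2_def pathstart_compose st1)
    show "path_image \<eta>2 \<inter> path_image \<eta>1 \<subseteq> {pathstart \<eta>1}"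
      unfolding pi1 pi2 st1
    proof
      fix z assume "z \<in> cnj ` P \<inter> P"
      then obtain w where w: "w \<in> P" "z = cnj w" "z \<in> P" by blast
      then have "\<not> 0 < Im z" using ImP[OF w(1)] by auto
      then show "z \<in> {of_real x0}" using ImP[OF w(3)] by simp
    qed
  qed
  then have "connected (- path_image (\<eta>2 +++ \<eta>1))" by (intro connected_arc_complement) auto
  moreover have "path_image (\<eta>2 +++ \<eta>1) = P \<union> cnj ` P"
    using path_image_join[of \<eta>2 \<eta>1] pi1 pi2 by (auto simp: \<eta>2_def pathstart_compose st1)
  ultimately have conn: "connected \<Omega>" by (simp add: \<Omega>_def)
  have trP: "trace s \<in> P" if "s \<in> {0..<T}" for s
  proof -
    have "trace s \<in> \<eta> ` {0..<arc_end}" unfolding trace_image[symmetric] using that by (rule imageI)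
    then show ?thesis by (auto simp: P_def)
  qed
  have al: "alive t z" if z: "z \<in> \<Omega>" and t: "t \<in> {0..<T}" for z t
  proof (rule alive_off_trace)
    have "z \<notin> P" "cnj z \<notin> P" using z by (auto simp: \<Omega>_def image_iff) 
    then show "z \<notin> trace ` {0..t}" "cnj z \<notin> trace ` {0..t}" using trP t by auto
  qed (use t in auto)
  \<comment> \<open>Real atoms differ from \<open>x0\<close>, the only real point of
    \<open>P\<close>. By continuity |B| = 1, in product form, holds on all of \<open>P\<close>; at a
    zero or pole of B exactly one of the two products vanishes.\<close>
  have S\<Omega>: "a \<in> \<Omega>" if a: "a \<in> S" for a
  proof -
    have notP: "a \<notin> P" if a: "a \<in> S" for a
    proof
      assume aP: "a \<in> P"
      have "a \<noteq> of_real x0" using a x0_S by auto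
      then have Ima: "0 < Im a" using ImP[OF aP] by simp
      have aU: "a \<in> U" using a Ima by (auto simp: S_def)
      obtain s where s: "s \<in> {0..arc_end}" "a = \<eta> s" using aP by (auto simp: P_def)
      have l1: "((\<lambda>t. norm (\<Prod>b\<in>A. \<eta> t - b) - norm (\<Prod>b\<in>A. \<eta> t - cnj b)) \<longlongrightarrow>
          norm (\<Prod>b\<in>A. \<eta> s - b) - norm (\<Prod>b\<in>A. \<eta> s - cnj b)) (at s within {0..<arc_end})"
      proof -
        have "continuous (at s within {0..1}) \<eta>" using arc_cont s lt by (auto simp: continuous_on_eq_continuous_within)
        then have "(\<eta> \<longlongrightarrow> \<eta> s) (at s within {0..<arc_end})"
          unfolding continuous_within by (rule tendsto_within_subset) (use arc_end in auto)
        then show ?thesis by (intro tendsto_intros)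
      qed
      have l0: "\<forall>\<^sub>F t in at s within {0..<arc_end}. norm (\<Prod>b\<in>A. \<eta> t - b) - norm (\<Prod>b\<in>A. \<eta> t - cnj b) = 0"
        unfolding eventually_at_filter
      proof (intro always_eventually allI impI)
        fix t assume t: "t \<in> {0..<arc_end}"
        then have "\<eta> t \<in> trace ` {0..<T}" using trace_image by auto
        then obtain r where r: "r \<in> {0..<T}" "\<eta> t = trace r" by auto
        show "norm (\<Prod>b\<in>A. \<eta> t - b) - norm (\<Prod>b\<in>A. \<eta> t - cnj b) = 0"
        proof (cases "r = 0")
          case True
          have "norm (\<Prod>b\<in>A. of_real x0 - cnj b) = norm (cnj (\<Prod>b\<in>A. of_real x0 - b))" by simp
          then show ?thesis unfolding complex_mod_cnj using r True by (simp add: trace_def X0)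
        next
          case False
          then show ?thesis using killed_level[of r "trace r"] trace_killed[of r] r by auto
        qed
      qed
      have nb: "at s within {0..<arc_end} \<noteq> bot"
        using s arc_end(1) by (simp add: trivial_limit_within)
      have eq: "norm (\<Prod>b\<in>A. a - b) = norm (\<Prod>b\<in>A. a - cnj b)"
        using tendsto_unique[OF nb l1 tendsto_eventually[OF l0]] s(2) by simp
      show False
      proof (cases "a \<in> A")
        case True
        then have "(\<Prod>b\<in>A. a - b) = 0" using finA by auto
        then have "(\<Prod>b\<in>A. a - cnj b) = 0" using eq by simp
        then show False using finA A_cnj True by auto
      next
        case False
        then have "(\<Prod>b\<in>A. a - cnj b) = 0" using finA aU by (auto simp: U_def)
        then have "(\<Prod>b\<in>A. a - b) = 0" using eq by simp
        then show False using finA False by auto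
      qed
    qed
    have "cnj a \<in> S" using a cnj_U by (auto simp: S_def)
    then show ?thesis using notP[OF a] notP[of "cnj a"] by (auto simp: \<Omega>_def)
  qed
  define t where "t n = T * (1 - inverse (real (Suc n)))" for n
  have t: "t n \<in> {0..<T}" for n
    using T_pos by (auto simp: t_def mult_less_cancel_left1 field_simps)
  have "t \<longlonglongrightarrow> T * (1 - 0)" unfolding t_def by (intro tendsto_intros LIMSEQ_inverse_real_of_nat)
  then have tT: "t \<longlonglongrightarrow> T" by simp
  obtain G r where Gr: "G holomorphic_on \<Omega>" "strict_mono (r :: nat \<Rightarrow> nat)"
    "\<And>z. z \<in> \<Omega> \<Longrightarrow> (\<lambda>n. g (t (r n)) z) \<longlonglongrightarrow> G z"
    "\<And>K. compact K \<Longrightarrow> K \<subseteq> \<Omega> \<Longrightarrow> uniform_limit K ((\<lambda>n. g (t n)) \<circ> r) G sequentially"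
  proof (rule Montel[OF op, of "range (\<lambda>n. g (t n))" "\<lambda>n. g (t n)"])
    show "h holomorphic_on \<Omega>" if "h \<in> range (\<lambda>n. g (t n))" for h
      using that t al by (auto intro!: g_holomorphic)
    show "\<exists>B. \<forall>h\<in>range (\<lambda>n. g (t n)). \<forall>z\<in>K. norm (h z) \<le> B" if K: "compact K" "K \<subseteq> \<Omega>" for K
    proof -
      obtain R where R: "\<And>z. z \<in> K \<Longrightarrow> norm z \<le> R" using compact_imp_bounded[OF K(1)] by (auto simp: bounded_iff)
      have "norm (g (t n) z) \<le> R + driver_bound + 1 + 2 * T" if "z \<in> K" for z n
        using g_bounded[OF al[OF _ t], of z n] R[OF that] K(2) that t[of n] by force
      then show ?thesis by blast
    qed
  qed auto
  have Xb: "bounded (range (\<lambda>n. X (t (r n))))"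
    using driver_bounded t by (auto simp: bounded_iff intro!: exI[of _ driver_bound] less_imp_le)
  obtain xs q where xs: "strict_mono (q :: nat \<Rightarrow> nat)" "((\<lambda>n. X (t (r n))) \<circ> q) \<longlonglongrightarrow> xs"
    using bounded_imp_convergent_subsequence[OF Xb] by blast
  define k where "k n = t (r (q n))" for n
  have k: "k n \<in> {0..<T}" for n using t by (simp add: k_def)
  have kT: "k \<longlonglongrightarrow> T"
    using LIMSEQ_subseq_LIMSEQ[OF LIMSEQ_subseq_LIMSEQ[OF tT Gr(2)] xs(1)] by (simp add: k_def[abs_def] o_def)
  have kX: "(\<lambda>n. X (k n)) \<longlonglongrightarrow> xs" using xs(2) by (simp add: k_def[abs_def] o_def)
  have kG: "(\<lambda>n. g (k n) z) \<longlonglongrightarrow> G z" if "z \<in> \<Omega>" for z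
    using LIMSEQ_subseq_LIMSEQ[OF Gr(3)[OF that] xs(1)] by (simp add: k_def[abs_def] o_def)
  have ext: "z \<in> \<Omega>" if "arc_bound < norm z" for z
    using arc_bound(2) arc_end that by (fastforce simp: \<Omega>_def P_def path_image_def subset_iff)
  have Gz: "norm (G z - z) \<le> 2 * (4 * arc_bound + 1)" if z: "4 * arc_bound \<le> norm z" for z
  proof (rule tendsto_upperbound)
    show "(\<lambda>n. norm (g (k n) z - z)) \<longlonglongrightarrow> norm (G z - z)"
      using z arc_bound(1) by (intro tendsto_intros kG ext) auto
    show "\<forall>\<^sub>F n in sequentially. norm (g (k n) z - z) \<le> 2 * (4 * arc_bound + 1)"
      using g_exterior_bound[OF _ _ z] k by (intro always_eventually) auto
  qed simp
  have ne: "G a - of_real xs \<noteq> 0" if a: "a \<in> \<Omega>" for a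
  proof (rule Hurwitz_no_zeros[OF op conn, of "\<lambda>n z. g (k n) z - of_real (X (k n))" "\<lambda>z. G z - of_real xs"])
    show "(\<lambda>z. g (k n) z - of_real (X (k n))) holomorphic_on \<Omega>" for n
      using k al by (intro holomorphic_intros g_holomorphic) auto
    show "(\<lambda>z. G z - of_real xs) holomorphic_on \<Omega>" by (intro holomorphic_intros Gr(1))
    show "uniform_limit K (\<lambda>n z. g (k n) z - of_real (X (k n))) (\<lambda>z. G z - of_real xs) sequentially"
      if K: "compact K" "K \<subseteq> \<Omega>" for K
    proof (rule uniform_limit_minus)
      have "uniform_limit K (\<lambda>n. ((\<lambda>n. g (t n)) \<circ> r) (q n)) G sequentially"
        by (rule filterlim_compose[OF Gr(4)[OF K] filterlim_subseq[OF xs(1)]])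
      then show "uniform_limit K (\<lambda>n. g (k n)) G sequentially" by (simp add: k_def o_def)
      have "(\<lambda>n. complex_of_real (X (k n))) \<longlonglongrightarrow> of_real xs" by (intro tendsto_of_real kX)
      then show "uniform_limit K (\<lambda>n z. complex_of_real (X (k n))) (\<lambda>z. of_real xs) sequentially"
        by (auto simp: uniform_limit_iff tendsto_iff elim!: eventually_mono)
    qed
    \<comment> \<open>The limit moves far points by a bounded amount, hence separates two real
      points far enough apart.\<close>
    show "\<not> (\<lambda>z. G z - of_real xs) constant_on \<Omega>"
    proof
      assume "(\<lambda>z. G z - of_real xs) constant_on \<Omega>"
      then obtain c where c: "\<And>z. z \<in> \<Omega> \<Longrightarrow> G z - of_real xs = c" by (auto simp: constant_on_def)
      define b where "b = 4 * arc_bound + 2 * (4 * arc_bound + 1) + 1"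
      have b: "0 < b" "4 * arc_bound \<le> b" "arc_bound < b" "2 * (4 * arc_bound + 1) < b" using arc_bound(1) by (auto simp: b_def)
      have n: "norm (complex_of_real b) = b" "norm (- complex_of_real b) = b" using b by auto
      have "norm (G (of_real b) - of_real b) \<le> 2 * (4 * arc_bound + 1)"
        by (rule Gz) (unfold n, rule b(2))
      moreover have "norm (G (- of_real b) - (- of_real b)) \<le> 2 * (4 * arc_bound + 1)"
        by (rule Gz) (unfold n, rule b(2))
      moreover have "of_real b \<in> \<Omega>" by (rule ext) (unfold n, rule b(3))
      moreover have "- of_real b \<in> \<Omega>" by (rule ext) (unfold n, rule b(3))
      moreover have "G (of_real b) = G (- of_real b)" using c[of "of_real b"] c[of "- of_real b"] calculation(3,4) by auto
      moreover have "norm (complex_of_real b - (- of_real b)) \<le> norm (G (of_real b) - of_real b) + norm (G (of_real b) - (- of_real b))"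
        using norm_triangle_ineq4[of "G (of_real b) - (- of_real b)" "G (of_real b) - of_real b"] by (simp add: algebra_simps)
      moreover have "norm (complex_of_real b - (- of_real b)) = 2 * b" using b by (simp add: norm_mult)
      ultimately show False using b by auto
    qed
    show "g (k n) z - of_real (X (k n)) \<noteq> 0" if "z \<in> \<Omega>" for n z
      using g_neq[OF al[OF that k]] k[of n] by auto
  qed (rule a)
  define d where "d = Min (insert 1 ((\<lambda>a. norm (G a - of_real xs)) ` S))"
  have d: "0 < d" unfolding d_def using finS ne S\<Omega> by (subst Min_gr_iff) auto
  have "\<forall>\<^sub>F n in sequentially. \<forall>a\<in>S. d / 2 < norm (g (k n) a - of_real (X (k n)))"
  proof (rule eventually_ball_finite[OF finS], rule ballI)
    fix a assume a: "a \<in> S"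
    have "(\<lambda>n. norm (g (k n) a - of_real (X (k n)))) \<longlonglongrightarrow> norm (G a - of_real xs)"
      by (intro tendsto_intros kG kX S\<Omega> a)
    moreover have "d \<le> norm (G a - of_real xs)" unfolding d_def using a finS by (intro Min_le) auto
    ultimately show "\<forall>\<^sub>F n in sequentially. d / 2 < norm (g (k n) a - of_real (X (k n)))"
      using d by (intro order_tendstoD) auto
  qed
  then obtain N where N: "\<And>n a. N \<le> n \<Longrightarrow> a \<in> S \<Longrightarrow> d / 2 < norm (g (k n) a - of_real (X (k n)))"
    by (auto simp: eventually_sequentially)
  show ?thesis
  proof (rule that[of "\<lambda>n. k (n + N)" "d / 2"])
    show "(\<lambda>n. k (n + N)) \<longlonglongrightarrow> T" using LIMSEQ_ignore_initial_segment[OF kT] .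
  qed (use d k N in \<open>auto intro: less_imp_le\<close>)
qed

end

context sle_maximal
begin

text \<open>Gaps bounded below along times tending to \<open>T\<close> would leave a fixed positive
  lifetime beyond \<open>T\<close>.\<close>

lemma arc_end_1: "arc_end = 1"
proof (rule ccontr)
  assume "arc_end \<noteq> 1"
  then have "arc_end < 1" using arc_end by simp
  then obtain t \<delta> where t: "t \<longlonglongrightarrow> T" "0 < \<delta>" "\<And>n::nat. t n \<in> {0..<T}"
    "\<And>n a. a \<in> S \<Longrightarrow> \<delta> \<le> norm (g (t n) a - of_real (X (t n)))"
    by (rule no_collision_before_end) blast
  have "t n + step (\<delta> / 2) \<le> T" for n
    by (rule blowup) (use t in auto)
  then have "T + step (\<delta> / 2) \<le> T"
    using t(1) by (intro tendsto_upperbound[OF tendsto_add[OF t(1) tendsto_const]]) auto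
  then show False using step_pos[of "\<delta> / 2"] t(2) by simp
qed

end

section \<open>Convergence of the driving function\<close>

lemma mono_bounded_tendsto_at_left:
  fixes f :: "real \<Rightarrow> real"
  assumes T: "0 < T" and mono: "\<And>s t. 0 \<le> s \<Longrightarrow> s \<le> t \<Longrightarrow> t < T \<Longrightarrow> f s \<le> f t"
    and B: "\<And>t. t \<in> {0..<T} \<Longrightarrow> f t \<le> B"
  obtains l where "(f \<longlongrightarrow> l) (at_left T)"
proof -
  define l where "l = Sup (f ` {0..<T})"
  have bdd: "bdd_above (f ` {0..<T})" using B by (auto intro!: bdd_aboveI[of _ B])
  have "(f \<longlongrightarrow> l) (at_left T)"
  proof (rule order_tendstoI)
    fix a assume "a < l"
    then obtain t where t: "t \<in> {0..<T}" "a < f t"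
      using less_cSup_iff[OF _ bdd, of a] T by (auto simp: l_def)
    have "\<forall>\<^sub>F s in at_left T. s \<in> {t<..<T}" using t by (intro eventually_at_left_real) auto
    then show "\<forall>\<^sub>F s in at_left T. a < f s"
    proof eventually_elim
      case (elim s)
      then show ?case using mono[of t s] t by auto
    qed
  next
    fix a assume a: "l < a"
    have "\<forall>\<^sub>F s in at_left T. s \<in> {0<..<T}" using T by (intro eventually_at_left_real) auto
    then show "\<forall>\<^sub>F s in at_left T. f s < a"
    proof eventually_elim
      case (elim s)
      then have "f s \<le> l" unfolding l_def by (intro cSup_upper bdd) auto
      then show ?case using a by simp
    qed
  qed
  then show ?thesis by (rule that)
qed

text \<open>For a 1-Lipschitz real function h, here the real or imaginary part, h (f t) + L t is
  increasing and bounded.\<close>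

lemma lipschitz_tendsto_at_left:
  fixes f :: "real \<Rightarrow> complex"
  assumes T: "0 < T" and lip: "\<And>s t. 0 \<le> s \<Longrightarrow> s \<le> t \<Longrightarrow> t < T \<Longrightarrow> norm (f t - f s) \<le> L * (t - s)"
  obtains l where "(f \<longlongrightarrow> l) (at_left T)"
proof -
  have conv: "\<exists>l. ((\<lambda>t. h (f t)) \<longlongrightarrow> l) (at_left T)"
    if h: "\<And>z w. h z - h w \<le> norm (z - w)" for h :: "complex \<Rightarrow> real"
  proof -
    have L: "0 \<le> L"
      using lip[of 0 "T / 2"] T order_trans[OF norm_ge_zero, of "f (T / 2) - f 0" "L * (T / 2)"] by (simp add: zero_le_mult_iff)
    obtain l where l: "((\<lambda>t. h (f t) + L * t) \<longlongrightarrow> l) (at_left T)"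
    proof (rule mono_bounded_tendsto_at_left[OF T])
      fix s t :: real assume st: "0 \<le> s" "s \<le> t" "t < T"
      then have "h (f s) - h (f t) \<le> L * (t - s)"
        using h[of "f s" "f t"] lip[OF st] by (simp add: norm_minus_commute)
      then show "h (f s) + L * s \<le> h (f t) + L * t" by argo
    next
      fix t assume t: "t \<in> {0..<T}"
      then have "h (f t) - h (f 0) \<le> L * t" using h[of "f t" "f 0"] lip[of 0 t] by simp
      moreover have "L * t \<le> L * T" using t L by (intro mult_left_mono) auto
      ultimately show "h (f t) + L * t \<le> h (f 0) + L * T + L * T" by simp
    qed blast
    have "((\<lambda>t. h (f t) + L * t - L * t) \<longlongrightarrow> l - L * T) (at_left T)"
      by (intro tendsto_intros l)
    then show ?thesis by auto
  qed
  obtain a where a: "((\<lambda>t. Re (f t)) \<longlongrightarrow> a) (at_left T)"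
    using conv[of Re] by (metis complex_Re_le_cmod minus_complex.sel(1))
  obtain b where b: "((\<lambda>t. Im (f t)) \<longlongrightarrow> b) (at_left T)"
    using conv[of Im] abs_Im_le_cmod by (metis abs_le_D1 minus_complex.sel(2))
  have "((\<lambda>t. Complex (Re (f t)) (Im (f t))) \<longlongrightarrow> Complex a b) (at_left T)"
    by (intro tendsto_Complex a b)
  then show ?thesis using that by simp
qed

lemma finite_bounded_subseq:
  fixes f :: "'i \<Rightarrow> nat \<Rightarrow> 'a::heine_borel"
  assumes "finite I" "\<And>i. i \<in> I \<Longrightarrow> bounded (range (f i))"
  shows "\<exists>r l. strict_mono (r :: nat \<Rightarrow> nat) \<and> (\<forall>i\<in>I. (\<lambda>n. f i (r n)) \<longlonglongrightarrow> l i)"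
  using assms
proof (induction rule: finite_induct)
  case empty
  then show ?case using strict_mono_id by (auto simp: id_def)
next
  case (insert i I)
  then obtain r l where r: "strict_mono (r :: nat \<Rightarrow> nat)" "\<forall>i\<in>I. (\<lambda>n. f i (r n)) \<longlonglongrightarrow> l i" by auto
  have "bounded (range (\<lambda>n. f i (r n)))"
    using insert.prems[of i] by (auto intro: bounded_subset)
  then obtain k q where q: "strict_mono (q :: nat \<Rightarrow> nat)" "((\<lambda>n. f i (r n)) \<circ> q) \<longlonglongrightarrow> k"
    using bounded_imp_convergent_subsequence by blast
  have "(\<lambda>n. f j ((r \<circ> q) n)) \<longlonglongrightarrow> (if j = i then k else l j)" if "j \<in> insert i I" for j
    using that q(2) LIMSEQ_subseq_LIMSEQ[OF r(2)[rule_format, of j] q(1)] by (auto simp: o_def)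
  then have "\<forall>j\<in>insert i I. (\<lambda>n. f j ((r \<circ> q) n)) \<longlonglongrightarrow> (if j = i then k else l j)" ..
  with strict_mono_o[OF r(1) q(1)] show ?case
    by (intro exI[of _ "r \<circ> q"] exI[of _ "\<lambda>j. if j = i then k else l j"] conjI)
qed

text \<open>The quotients a / b and c / d coincide, so their logarithmic derivatives do; this is
  that identity without denominators.\<close>

lemma wronskian_proportional:
  fixes a b c d :: "complex poly"
  assumes eq: "a * d = b * c"
  shows "(pderiv a * b - a * pderiv b) * (c * d) = (pderiv c * d - c * pderiv d) * (a * b)"
proof -
  have D: "pderiv a * d - pderiv b * c = pderiv c * b - a * pderiv d"
    using arg_cong[OF eq, of pderiv] by (simp add: pderiv_mult algebra_simps)
  have "(pderiv a * b - a * pderiv b) * (c * d) = pderiv a * d * (b * c) - pderiv b * c * (a * d)"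
    by (simp add: algebra_simps)
  also have "\<dots> = (pderiv a * d - pderiv b * c) * (a * d)" by (simp add: eq algebra_simps)
  also have "\<dots> = (pderiv c * b) * (a * d) - (a * pderiv d) * (a * d)" unfolding D by (simp add: algebra_simps)
  also have "(a * pderiv d) * (a * d) = (a * pderiv d) * (b * c)" by (simp only: eq)
  finally show ?thesis by (simp add: algebra_simps)
qed

context sle_data
begin

text \<open>The sum is the numerator of the derivative of a quotient with zeros
  \<open>\<alpha> a\<close> and poles \<open>\<alpha> (cnj a)\<close>. The map
  \<open>\<alpha>\<close> need not be injective, so limits of configurations in which points have
  merged are covered.\<close>

lemma wronskian_poly:
  fixes \<alpha> :: "complex \<Rightarrow> complex"
  defines "p \<equiv> (\<Prod>a\<in>A. [:- \<alpha> a, 1:])" and "q \<equiv> (\<Prod>a\<in>A. [:- \<alpha> (cnj a), 1:])"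
  shows "(\<Sum>\<zeta>\<in>U. sgnA \<zeta> * (\<Prod>m\<in>U - {\<zeta>}. w - \<alpha> m)) = poly (pderiv p * q - p * pderiv q) w"
proof -
  have lin: "pderiv [:- c, 1:] = (1 :: complex poly)" for c by (simp add: pderiv_pCons)
  have p: "poly p w = (\<Prod>a\<in>A. w - \<alpha> a)" and q: "poly q w = (\<Prod>a\<in>A. w - \<alpha> (cnj a))"
    unfolding p_def q_def poly_prod by simp_all
  have p': "poly (pderiv p) w = (\<Sum>a\<in>A. \<Prod>b\<in>A - {a}. w - \<alpha> b)"
    and q': "poly (pderiv q) w = (\<Sum>a\<in>A. \<Prod>b\<in>A - {a}. w - \<alpha> (cnj b))"
    unfolding p_def q_def pderiv_prod poly_sum poly_mult poly_prod by (simp_all add: lin)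
  have disj: "cnj a \<notin> A" "a \<notin> cnj ` A" if "a \<in> A" for a using A_cnj that by (auto simp: image_iff)
  have 1: "(\<Prod>m\<in>U - {a}. w - \<alpha> m) = (\<Prod>b\<in>A - {a}. w - \<alpha> b) * (\<Prod>b\<in>A. w - \<alpha> (cnj b))" if a: "a \<in> A" for a
  proof -
    have "U - {a} = (A - {a}) \<union> cnj ` A" using disj[OF a] by (auto simp: U_def)
    then have "(\<Prod>m\<in>U - {a}. w - \<alpha> m) = (\<Prod>b\<in>A - {a}. w - \<alpha> b) * (\<Prod>b\<in>cnj ` A. w - \<alpha> b)"
      using finA A_cnj by (simp only:) (intro prod.union_disjoint, auto)
    also have "(\<Prod>b\<in>cnj ` A. w - \<alpha> b) = (\<Prod>b\<in>A. w - \<alpha> (cnj b))"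
      by (subst prod.reindex) (auto simp: inj_on_def)
    finally show ?thesis .
  qed
  have 2: "(\<Prod>m\<in>U - {cnj a}. w - \<alpha> m) = (\<Prod>b\<in>A. w - \<alpha> b) * (\<Prod>b\<in>A - {a}. w - \<alpha> (cnj b))" if a: "a \<in> A" for a
  proof -
    have "U - {cnj a} = A \<union> cnj ` (A - {a})" using disj[OF a] by (auto simp: U_def)
    then have "(\<Prod>m\<in>U - {cnj a}. w - \<alpha> m) = (\<Prod>b\<in>A. w - \<alpha> b) * (\<Prod>b\<in>cnj ` (A - {a}). w - \<alpha> b)"
      using finA A_cnj by (simp only:) (intro prod.union_disjoint, auto)
    also have "(\<Prod>b\<in>cnj ` (A - {a}). w - \<alpha> b) = (\<Prod>b\<in>A - {a}. w - \<alpha> (cnj b))"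
      by (subst prod.reindex) (auto simp: inj_on_def)
    finally show ?thesis .
  qed
  have "(\<Sum>\<zeta>\<in>U. sgnA \<zeta> * (\<Prod>m\<in>U - {\<zeta>}. w - \<alpha> m)) =
     (\<Sum>a\<in>A. (\<Prod>b\<in>A - {a}. w - \<alpha> b) * (\<Prod>b\<in>A. w - \<alpha> (cnj b))) - (\<Sum>a\<in>A. (\<Prod>b\<in>A. w - \<alpha> b) * (\<Prod>b\<in>A - {a}. w - \<alpha> (cnj b)))"
    unfolding sum_U_sgn using 1 2 by simp
  then show ?thesis
    by (simp add: p q p' q' sum_distrib_left sum_distrib_right)
qed

end

section \<open>Limits at the final time\<close>

context sle_solution
begin

text \<open>Beyond this radius points are never swallowed, the Schwarz bound holds, the gap to the
  driver is at least 1, and there is no point of \<open>U\<close>.\<close>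

definition far_radius :: real where
  "far_radius = driver_bound + 4 * arc_bound + 2 * (4 * arc_bound + 1) + 1 + (\<Sum>a\<in>U. norm a)"

lemma far_gap:
  assumes z: "far_radius \<le> norm z" and t: "0 \<le> t" "t < T"
  shows "alive t z" "norm (g t z - z) \<le> 2 * (4 * arc_bound + 1)" "1 \<le> norm (g t z - of_real (X t))"
proof -
  have B: "0 < driver_bound" using driver_bounded[of 0] T_pos by auto
  have s: "0 \<le> (\<Sum>a\<in>U. norm a)" by (intro sum_nonneg) auto
  have far: "4 * arc_bound \<le> norm z" "arc_bound \<le> norm z" "driver_bound + 2 * (4 * arc_bound + 1) + 1 \<le> norm z"
    using z B s arc_bound(1) by (auto simp: far_radius_def)
  show "alive t z" by (rule alive_exterior[OF t far(2)])
  show *: "norm (g t z - z) \<le> 2 * (4 * arc_bound + 1)" by (rule g_exterior_bound[OF t far(1)])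
  have "norm z \<le> norm (g t z - of_real (X t)) + \<bar>X t\<bar> + norm (g t z - z)"
    using norm_triangle_ineq4[of "g t z" "g t z - z"] norm_triangle_ineq[of "g t z - of_real (X t)" "of_real (X t)"]
    by (simp add: algebra_simps)
  then show "1 \<le> norm (g t z - of_real (X t))" using * far(3) driver_bounded[OF t] by linarith
qed

lemma far_not_U: "far_radius \<le> norm z \<Longrightarrow> z \<notin> U"
proof
  assume z: "far_radius \<le> norm z" "z \<in> U"
  have "norm z \<le> (\<Sum>a\<in>U. norm a)" using z(2) finU by (intro member_le_sum) auto
  moreover have "0 < driver_bound" using driver_bounded[of 0] T_pos by auto
  ultimately show False using z(1) arc_bound(1) by (simp add: far_radius_def)
qed

text \<open>With gap at least 1 the flow has speed at most 2, hence is Lipschitz in time up to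
  \<open>T\<close>.\<close>

lemma far_limit:
  assumes z: "far_radius \<le> norm z"
  obtains w where "((\<lambda>t. g t z) \<longlongrightarrow> w) (at_left T)" "norm (w - z) \<le> 2 * (4 * arc_bound + 1)"
proof -
  obtain w where w: "((\<lambda>t. g t z) \<longlongrightarrow> w) (at_left T)"
  proof (rule lipschitz_tendsto_at_left[OF T_pos, of "\<lambda>t. g t z" 2])
    fix s t assume st: "0 \<le> s" "s \<le> t" "t < T"
    have "norm (g t z - g s z - (t - s) *\<^sub>R 0) \<le> 2 * (t - s)"
    proof (rule vector_mean_value_bound[OF st(2)])
      fix r assume r: "r \<in> {s..t}"
      show "((\<lambda>s. g s z) has_vector_derivative 2 / (g r z - of_real (X r))) (at r within {s..t})"
        using st r by (intro has_vector_derivative_within_subset[OF g_deriv[OF far_gap(1)[OF z] st(3)]]) auto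
      show "norm (2 / (g r z - of_real (X r)) - 0) \<le> 2"
        using far_gap(3)[OF z, of r] r st by (simp add: norm_divide divide_le_eq)
    qed
    then show "norm (g t z - g s z) \<le> 2 * (t - s)" by simp
  qed blast
  have "norm (w - z) \<le> 2 * (4 * arc_bound + 1)"
  proof (rule tendsto_upperbound)
    show "((\<lambda>t. norm (g t z - z)) \<longlongrightarrow> norm (w - z)) (at_left T)" by (intro tendsto_intros w)
    have "\<forall>\<^sub>F s in at_left T. s \<in> {0<..<T}" using T_pos by (intro eventually_at_left_real) auto
    then show "\<forall>\<^sub>F t in at_left T. norm (g t z - z) \<le> 2 * (4 * arc_bound + 1)"
      by eventually_elim (rule far_gap(2)[OF z], auto)
  qed simp
  then show ?thesis using that w by blast
qed

text \<open>A real point is pushed away from the driver, to the right or left according to its side,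
  so its image is monotone in time; it is also bounded. The factor \<open>sgn (y - x0)\<close>
  treats both sides at once.\<close>

lemma real_atom_limit:
  assumes y: "y \<in> Y"
  obtains l where "((\<lambda>t. g t (of_real y)) \<longlongrightarrow> of_real l) (at_left T)"
proof -
  have al: "alive t (of_real y)" if "0 \<le> t" "t < T" for t using alive_Y[OF y that] .
  have yx: "y \<noteq> x0" using y x0Y by auto
  define f where "f t = Re (g t (of_real y))" for t
  have real: "g t (of_real y) = of_real (f t)" if "0 \<le> t" "t < T" for t
    using g_real[OF al[OF that]] that by (simp add: f_def)
  have fX: "f t \<noteq> X t" if "0 \<le> t" "t < T" for t
    using g_neq[OF al[OF that] that] real[OF that] by auto
  have ord: "x0 < y \<longleftrightarrow> X t < f t" if "0 \<le> t" "t < T" for t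
    using real_order[OF that yx] by (simp add: f_def)
  have bound: "\<bar>f t\<bar> \<le> \<bar>y\<bar> + driver_bound + 1 + 2 * T" if "0 \<le> t" "t < T" for t
    using order_trans[OF abs_Re_le_cmod g_bounded[OF al[OF that] that]] by (simp add: f_def)
  have der: "(f has_real_derivative 2 / (f s - X s)) (at s within {0..t})" if s: "s \<in> {0..t}" and t: "t < T" for s t
  proof -
    have t0: "0 \<le> t" using s by auto
    have "2 / (g s (of_real y) - of_real (X s)) = of_real (2 / (f s - X s))"
      using real[of s] s t by simp
    then have "Re (2 / (g s (of_real y) - of_real (X s))) = 2 / (f s - X s)" by (simp only: Re_complex_of_real)
    then show ?thesis
      using bounded_linear.has_vector_derivative[OF bounded_linear_Re g_deriv[OF al[OF t0 t] t s]]
      by (simp add: f_def[abs_def] has_real_derivative_iff_has_vector_derivative)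
  qed
  have mono: "sgn (y - x0) * f s \<le> sgn (y - x0) * f t" if st: "0 \<le> s" "s \<le> t" "t < T" for s t
  proof (rule DERIV_nonneg_imp_increasing_open[OF st(2)])
    fix r assume r: "s < r" "r < t"
    have "(f has_real_derivative 2 / (f r - X r)) (at r)"
      using der[of r t] r st at_within_Icc_at[of 0 r t] by auto
    then have "((\<lambda>r. sgn (y - x0) * f r) has_real_derivative sgn (y - x0) * (2 / (f r - X r))) (at r)"
      by (rule DERIV_cmult)
    moreover have "0 \<le> sgn (y - x0) * (2 / (f r - X r))"
      using ord[of r] fX[of r] r st yx by (auto simp: sgn_real_def)
    ultimately show "\<exists>d. ((\<lambda>r. sgn (y - x0) * f r) has_real_derivative d) (at r) \<and> 0 \<le> d" by blast
  next
    have "continuous_on {0..t} f"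
      unfolding continuous_on_eq_continuous_within using der st(3) DERIV_continuous by blast
    then show "continuous_on {s..t} (\<lambda>r. sgn (y - x0) * f r)"
      using st by (intro continuous_intros) (auto elim: continuous_on_subset)
  qed
  obtain l where l: "((\<lambda>t. sgn (y - x0) * f t) \<longlongrightarrow> l) (at_left T)"
  proof (rule mono_bounded_tendsto_at_left[OF T_pos mono])
    fix t assume t: "t \<in> {0..<T}"
    have "sgn (y - x0) * f t \<le> \<bar>f t\<bar>" by (auto simp: sgn_real_def)
    then show "sgn (y - x0) * f t \<le> \<bar>y\<bar> + driver_bound + 1 + 2 * T" using bound[of t] t by auto
  qed auto
  have "((\<lambda>t. sgn (y - x0) * (sgn (y - x0) * f t)) \<longlongrightarrow> sgn (y - x0) * l) (at_left T)"
    by (intro tendsto_intros l)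
  moreover have "(\<lambda>t. sgn (y - x0) * (sgn (y - x0) * f t)) = f" using yx by (auto simp: sgn_real_def)
  ultimately have "(f \<longlongrightarrow> sgn (y - x0) * l) (at_left T)" by (simp only:)
  then have lim: "((\<lambda>t. complex_of_real (f t)) \<longlongrightarrow> of_real (sgn (y - x0) * l)) (at_left T)" by (rule tendsto_of_real)
  have "\<forall>\<^sub>F s in at_left T. s \<in> {0<..<T}" using T_pos by (intro eventually_at_left_real) auto
  then have "\<forall>\<^sub>F t in at_left T. complex_of_real (f t) = g t (of_real y)"
    by eventually_elim (use real in auto)
  from that[OF Lim_transform_eventually[OF lim this]] show ?thesis .
qed

text \<open>Two limit points of the driving function: the limits of the conserved function agree, hence so
  do their logarithmic derivatives, whose denominators are nonnegative on the real line. Their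
  numerators then have the same sign between the two limit points, which is absurd.\<close>

lemma driver_limit_point_not_less:
  assumes s: "\<And>n::nat. s n \<in> {0..<T}" "s \<longlonglongrightarrow> T" "(\<lambda>n. X (s n)) \<longlonglongrightarrow> l"
    and t: "\<And>n::nat. t n \<in> {0..<T}" "t \<longlonglongrightarrow> T" "(\<lambda>n. X (t n)) \<longlonglongrightarrow> l'"
  shows "\<not> l < l'"
proof
  assume ll: "l < l'"
  have left: "filterlim k (at_left T) sequentially" if "\<And>n::nat. k n \<in> {0..<T}" "k \<longlonglongrightarrow> T" for k
    using that by (intro tendsto_imp_filterlim_at_left) auto
  have "\<exists>l. ((\<lambda>t. g t (of_real y)) \<longlongrightarrow> of_real l) (at_left T)" if "y \<in> Y" for y
    by (rule real_atom_limit[OF that]) blast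
  then obtain Yl where Yl: "\<And>y. y \<in> Y \<Longrightarrow> ((\<lambda>t. g t (of_real y)) \<longlongrightarrow> of_real (Yl y)) (at_left T)"
    by metis
  have "\<exists>w. ((\<lambda>t. g t z) \<longlongrightarrow> w) (at_left T) \<and> norm (w - z) \<le> 2 * (4 * arc_bound + 1)" if "far_radius \<le> norm z" for z
    by (rule far_limit[OF that]) blast
  then obtain G where G: "\<And>z. far_radius \<le> norm z \<Longrightarrow> ((\<lambda>t. g t z) \<longlongrightarrow> G z) (at_left T)"
      "\<And>z. far_radius \<le> norm z \<Longrightarrow> norm (G z - z) \<le> 2 * (4 * arc_bound + 1)"
    by metis
  \<comment> \<open>What survives of the chain at a limit point \<open>m\<close> of the driver: a
    limiting configuration \<open>\<alpha>\<close> of zeros and poles, the conserved function at far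
    points, and the Wronskian identity. The limits \<open>G\<close> and \<open>Yl\<close> exist
    along the full time, so they are shared by all limit points.\<close>
  define Lim where "Lim \<alpha> m \<longleftrightarrow> (\<forall>a\<in>A. \<alpha> (cnj a) = cnj (\<alpha> a)) \<and>
     (\<forall>z. far_radius \<le> norm z \<longrightarrow> (\<Prod>a\<in>A. G z - \<alpha> a) * (\<Prod>a\<in>A. z - cnj a) = (\<Prod>a\<in>A. G z - \<alpha> (cnj a)) * (\<Prod>a\<in>A. z - a)) \<and>
     (\<forall>w. (w - of_real m) * (\<Prod>y\<in>Y. w - of_real (Yl y)) = \<kappa> * (\<Sum>\<zeta>\<in>U. sgnA \<zeta> * (\<Prod>k\<in>U - {\<zeta>}. w - \<alpha> k)))"
    for \<alpha> :: "complex \<Rightarrow> complex" and m :: real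
  have LimE: "\<exists>\<alpha>. Lim \<alpha> m" if k: "\<And>n::nat. k n \<in> {0..<T}" "k \<longlonglongrightarrow> T" "(\<lambda>n. X (k n)) \<longlonglongrightarrow> m" for k m
  proof -
    have al: "alive (k n) a" if "a \<in> U" for n a using alive_U[OF that] k(1)[of n] by auto
    have "bounded (range (\<lambda>n. g (k n) a))" if "a \<in> U" for a
      using g_bounded[OF al[OF that]] k(1) by (auto simp: bounded_iff intro!: exI[of _ "norm a + driver_bound + 1 + 2 * T"])
    then obtain r \<alpha> where r: "strict_mono (r :: nat \<Rightarrow> nat)" "\<And>a. a \<in> U \<Longrightarrow> (\<lambda>n. g (k (r n)) a) \<longlonglongrightarrow> \<alpha> a"
      using finite_bounded_subseq[OF finU, of "\<lambda>a n. g (k n) a"] by blast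
    define j where "j n = k (r n)" for n
    have j: "j n \<in> {0..<T}" for n using k(1) by (simp add: j_def)
    have jT: "j \<longlonglongrightarrow> T" using LIMSEQ_subseq_LIMSEQ[OF k(2) r(1)] by (simp add: j_def[abs_def] o_def)
    have jX: "(\<lambda>n. X (j n)) \<longlonglongrightarrow> m" using LIMSEQ_subseq_LIMSEQ[OF k(3) r(1)] by (simp add: j_def[abs_def] o_def)
    have j\<alpha>: "(\<lambda>n. g (j n) a) \<longlonglongrightarrow> \<alpha> a" if "a \<in> U" for a using r(2)[OF that] by (simp add: j_def)
    have AU: "a \<in> U" "cnj a \<in> U" if "a \<in> A" for a using that by (auto simp: U_def)
    note jl = left[OF j jT]
    have "\<alpha> (cnj a) = cnj (\<alpha> a)" if a: "a \<in> A" for a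
    proof (rule LIMSEQ_unique[OF j\<alpha>[OF AU(2)[OF a]]])
      have "(\<lambda>n. cnj (g (j n) a)) \<longlonglongrightarrow> cnj (\<alpha> a)" by (intro tendsto_cnj j\<alpha> AU a)
      moreover have "g (j n) (cnj a) = cnj (g (j n) a)" for n
        using g_cnj[OF alive_U[OF AU(1)[OF a]]] j[of n] by auto
      ultimately show "(\<lambda>n. g (j n) (cnj a)) \<longlonglongrightarrow> cnj (\<alpha> a)" by simp
    qed
    moreover have "(\<Prod>a\<in>A. G z - \<alpha> a) * (\<Prod>a\<in>A. z - cnj a) = (\<Prod>a\<in>A. G z - \<alpha> (cnj a)) * (\<Prod>a\<in>A. z - a)"
      if z: "far_radius \<le> norm z" for z
    proof (rule LIMSEQ_unique)
      have Gj: "(\<lambda>n. g (j n) z) \<longlonglongrightarrow> G z" by (rule filterlim_compose[OF G(1)[OF z] jl])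
      show "(\<lambda>n. (\<Prod>a\<in>A. g (j n) z - g (j n) a) * (\<Prod>a\<in>A. z - cnj a)) \<longlonglongrightarrow> (\<Prod>a\<in>A. G z - \<alpha> a) * (\<Prod>a\<in>A. z - cnj a)"
        by (intro tendsto_intros Gj j\<alpha> AU)
      have "(\<lambda>n. (\<Prod>a\<in>A. g (j n) z - g (j n) (cnj a)) * (\<Prod>a\<in>A. z - a)) \<longlonglongrightarrow> (\<Prod>a\<in>A. G z - \<alpha> (cnj a)) * (\<Prod>a\<in>A. z - a)"
        by (intro tendsto_intros Gj j\<alpha> AU)
      moreover have "(\<Prod>a\<in>A. g (j n) z - g (j n) (cnj a)) * (\<Prod>a\<in>A. z - a) = (\<Prod>a\<in>A. g (j n) z - g (j n) a) * (\<Prod>a\<in>A. z - cnj a)" for n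
        using conserved[OF far_gap(1)[OF z], of "j n"] j[of n] by auto
      ultimately show "(\<lambda>n. (\<Prod>a\<in>A. g (j n) z - g (j n) a) * (\<Prod>a\<in>A. z - cnj a)) \<longlonglongrightarrow> (\<Prod>a\<in>A. G z - \<alpha> (cnj a)) * (\<Prod>a\<in>A. z - a)"
        by simp
    qed
    moreover have "(w - of_real m) * (\<Prod>y\<in>Y. w - of_real (Yl y)) = \<kappa> * (\<Sum>\<zeta>\<in>U. sgnA \<zeta> * (\<Prod>k\<in>U - {\<zeta>}. w - \<alpha> k))" for w
    proof (rule LIMSEQ_unique)
      show "(\<lambda>n. (w - of_real (X (j n))) * (\<Prod>y\<in>Y. w - g (j n) (of_real y))) \<longlonglongrightarrow> (w - of_real m) * (\<Prod>y\<in>Y. w - of_real (Yl y))"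
        by (intro tendsto_intros jX filterlim_compose[OF Yl jl])
      have "(\<lambda>n. \<kappa> * (\<Sum>\<zeta>\<in>U. sgnA \<zeta> * (\<Prod>k\<in>U - {\<zeta>}. w - g (j n) k))) \<longlonglongrightarrow> \<kappa> * (\<Sum>\<zeta>\<in>U. sgnA \<zeta> * (\<Prod>k\<in>U - {\<zeta>}. w - \<alpha> k))"
        by (intro tendsto_intros j\<alpha>) auto
      moreover have "\<kappa> * (\<Sum>\<zeta>\<in>U. sgnA \<zeta> * (\<Prod>k\<in>U - {\<zeta>}. w - g (j n) k)) = (w - of_real (X (j n))) * (\<Prod>y\<in>Y. w - g (j n) (of_real y))" for n
        using wronskian_identity[of "j n" w] j[of n] by auto
      ultimately show "(\<lambda>n. (w - of_real (X (j n))) * (\<Prod>y\<in>Y. w - g (j n) (of_real y))) \<longlonglongrightarrow> \<kappa> * (\<Sum>\<zeta>\<in>U. sgnA \<zeta> * (\<Prod>k\<in>U - {\<zeta>}. w - \<alpha> k))"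
        by simp
    qed
    ultimately show ?thesis unfolding Lim_def by blast
  qed
  obtain \<alpha> where \<alpha>: "Lim \<alpha> l" using LimE[OF s] by blast
  obtain \<beta> where \<beta>: "Lim \<beta> l'" using LimE[OF t] by blast
  define a where "a = (\<Prod>x\<in>A. [:- \<alpha> x, 1:])"
  define b where "b = (\<Prod>x\<in>A. [:- \<alpha> (cnj x), 1:])"
  define c where "c = (\<Prod>x\<in>A. [:- \<beta> x, 1:])"
  define d where "d = (\<Prod>x\<in>A. [:- \<beta> (cnj x), 1:])"
  have pa: "poly a w = (\<Prod>x\<in>A. w - \<alpha> x)" and pb: "poly b w = (\<Prod>x\<in>A. w - \<alpha> (cnj x))"
    and pc: "poly c w = (\<Prod>x\<in>A. w - \<beta> x)" and pd: "poly d w = (\<Prod>x\<in>A. w - \<beta> (cnj x))" for w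
    unfolding a_def b_def c_def d_def poly_prod by simp_all
  \<comment> \<open>Composed with \<open>G\<close>, both limiting quotients equal B at far points.
    \<open>G\<close> is unbounded there, so it takes infinitely many values and the polynomial
    identity follows.\<close>
  have ad: "a * d = b * c"
  proof (rule ccontr)
    assume "a * d \<noteq> b * c"
    then have "finite {w. poly (a * d - b * c) w = 0}" by (intro poly_roots_finite) simp
    moreover have "G z \<in> {w. poly (a * d - b * c) w = 0}" if z: "far_radius \<le> norm z" for z
    proof -
      define D where "D = (\<Prod>x\<in>A. z - cnj x)"
      define N where "N = (\<Prod>x\<in>A. z - x)"
      have D: "D \<noteq> 0" unfolding D_def using far_not_U[OF z] finA by (auto simp: U_def)
      have 1: "poly a (G z) * D = poly b (G z) * N" "poly c (G z) * D = poly d (G z) * N"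
        using \<alpha> \<beta> z unfolding Lim_def pa pb pc pd D_def N_def by blast+
      have "(poly a (G z) * poly d (G z)) * D = (poly b (G z) * poly c (G z)) * D"
        using 1 by (metis mult.assoc mult.commute)
      then show ?thesis using D by simp
    qed
    ultimately have "finite (G ` {z. far_radius \<le> norm z})" by (elim rev_finite_subset) blast
    then have "bounded (G ` {z. far_radius \<le> norm z})" by (rule finite_imp_bounded)
    then obtain R where R: "\<And>z. far_radius \<le> norm z \<Longrightarrow> norm (G z) \<le> R" by (auto simp: bounded_iff)
    define x where "x = \<bar>far_radius\<bar> + \<bar>R\<bar> + 2 * (4 * arc_bound + 1) + 1"
    have x: "0 < x" "far_radius \<le> x" "R + 2 * (4 * arc_bound + 1) < x" using arc_bound(1) by (auto simp: x_def)
    have nx: "norm (complex_of_real x) = x" using x by simp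
    then have "far_radius \<le> norm (complex_of_real x)" using x by simp
    from R[OF this] G(2)[OF this] show False
      using norm_triangle_ineq4[of "G (of_real x)" "G (of_real x) - of_real x"] nx x by simp
  qed
  have W: "(w - of_real l) * (\<Prod>y\<in>Y. w - of_real (Yl y)) * (poly c w * poly d w) =
      (w - of_real l') * (\<Prod>y\<in>Y. w - of_real (Yl y)) * (poly a w * poly b w)" for w
  proof -
    have "(w - of_real l) * (\<Prod>y\<in>Y. w - of_real (Yl y)) = \<kappa> * poly (pderiv a * b - a * pderiv b) w"
      using \<alpha> wronskian_poly[of w \<alpha>] by (simp only: Lim_def a_def b_def)
    moreover have "(w - of_real l') * (\<Prod>y\<in>Y. w - of_real (Yl y)) = \<kappa> * poly (pderiv c * d - c * pderiv d) w"
      using \<beta> wronskian_poly[of w \<beta>] by (simp only: Lim_def c_def d_def)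
    moreover have "poly (pderiv a * b - a * pderiv b) w * (poly c w * poly d w) = poly (pderiv c * d - c * pderiv d) w * (poly a w * poly b w)"
      using arg_cong[OF wronskian_proportional[OF ad], of "\<lambda>p. poly p w"] by (simp only: poly_mult)
    ultimately show ?thesis by (simp only: mult.assoc)
  qed
  \<comment> \<open>Avoiding these finitely many points makes the common factor over
    \<open>Y\<close> and the denominators nonzero.\<close>
  define bad where "bad = Yl ` Y \<union> (\<lambda>x. Re (\<alpha> x)) ` A \<union> (\<lambda>x. Re (\<beta> x)) ` A"
  have "infinite ({l<..<l'} - bad)" using ll finY finA by (simp add: bad_def infinite_Ioo Diff_infinite_finite)
  then obtain x where x: "l < x" "x < l'" "x \<notin> bad"
    by (metis DiffE ex_in_conv finite.emptyI greaterThanLessThan_iff)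
  have "(\<Prod>y\<in>Y. complex_of_real x - of_real (Yl y)) \<noteq> 0"
    using x(3) finY by (auto simp: bad_def)
  then have "(of_real x - of_real l) * (poly c (of_real x) * poly d (of_real x)) = (of_real x - of_real l') * (poly a (of_real x) * poly b (of_real x))"
    using W[of "of_real x"] by (simp add: mult_ac)
  \<comment> \<open>By symmetry the products a b and c d become squared moduli on the real line, so
    the two sides of \<open>W\<close> have opposite signs between \<open>l\<close> and
    \<open>l'\<close>.\<close>
  moreover have "poly b (of_real x) = cnj (poly a (of_real x))" "poly d (of_real x) = cnj (poly c (of_real x))"
    using \<alpha> \<beta> by (simp_all add: pa pb pc pd Lim_def)
  ultimately have "complex_of_real ((x - l) * (norm (poly c (of_real x)))\<^sup>2) = of_real ((x - l') * (norm (poly a (of_real x)))\<^sup>2)"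
    by (simp add: complex_norm_square del: of_real_power) 
  then have "(x - l) * (norm (poly c (of_real x)))\<^sup>2 = (x - l') * (norm (poly a (of_real x)))\<^sup>2"
    using of_real_eq_iff by blast
  moreover have "complex_of_real x - \<beta> y \<noteq> 0" if y: "y \<in> A" for y
  proof
    assume "complex_of_real x - \<beta> y = 0"
    then have "x = Re (\<beta> y)" by (metis Re_complex_of_real eq_iff_diff_eq_0)
    then show False using x(3) y by (auto simp: bad_def)
  qed
  then have "poly c (of_real x) \<noteq> 0" using finA by (simp add: pc)
  then have "0 < (x - l) * (norm (poly c (of_real x)))\<^sup>2" using x by simp
  moreover have "(x - l') * (norm (poly a (of_real x)))\<^sup>2 \<le> 0" using x by (intro mult_nonpos_nonneg) auto
  ultimately show False by linarith
qed

text \<open>The driver is bounded, so without a limit it would have two different limit points;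
  \<open>driver_limit_point_not_less\<close>, used in both orders, excludes this.\<close>

lemma driver_limit:
  obtains l where "(X \<longlongrightarrow> l) (at_left T)"
proof -
  define t where "t n = T * (1 - inverse (real (Suc n)))" for n
  have t: "t n \<in> {0..<T}" for n
    using T_pos by (auto simp: t_def mult_less_cancel_left1 field_simps)
  have "t \<longlonglongrightarrow> T * (1 - 0)" unfolding t_def by (intro tendsto_intros LIMSEQ_inverse_real_of_nat)
  then have tT: "t \<longlonglongrightarrow> T" by simp
  have sub: "\<exists>r l. strict_mono (r :: nat \<Rightarrow> nat) \<and> (\<lambda>n. X (k (r n))) \<longlonglongrightarrow> l" if k: "\<And>n. k n \<in> {0..<T}" for k :: "nat \<Rightarrow> real"
  proof -
    have "bounded (range (\<lambda>n. X (k n)))"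
      using driver_bounded k by (auto simp: bounded_iff intro!: exI[of _ driver_bound] less_imp_le)
    then show ?thesis using bounded_imp_convergent_subsequence unfolding o_def by blast
  qed
  obtain r l where r: "strict_mono (r :: nat \<Rightarrow> nat)" "(\<lambda>n. X (t (r n))) \<longlonglongrightarrow> l" using sub[of t] t by blast
  have rT: "(\<lambda>n. t (r n)) \<longlonglongrightarrow> T" using LIMSEQ_subseq_LIMSEQ[OF tT r(1)] by (simp add: o_def)
  have "(X \<longlongrightarrow> l) (at_left T)"
  proof (rule ccontr)
    assume "\<not> (X \<longlongrightarrow> l) (at_left T)"
    then obtain e where e: "0 < e" "\<not> (\<forall>\<^sub>F s in at_left T. dist (X s) l < e)" by (auto simp: tendsto_iff)
    have "\<exists>s. t n < s \<and> s < T \<and> e \<le> dist (X s) l" for n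
    proof (rule ccontr)
      assume neg: "\<nexists>s. t n < s \<and> s < T \<and> e \<le> dist (X s) l"
      have "\<forall>\<^sub>F s in at_left T. s \<in> {t n<..<T}" using t[of n] by (intro eventually_at_left_real) auto
      then have "\<forall>\<^sub>F s in at_left T. dist (X s) l < e" by eventually_elim (use neg in \<open>auto simp: not_le\<close>)
      then show False using e by simp
    qed
    then obtain s where s: "\<And>n. t n < s n" "\<And>n. s n < T" "\<And>n. e \<le> dist (X (s n)) l" by metis
    have sT: "s \<longlonglongrightarrow> T"
      by (rule tendsto_sandwich[OF _ _ tT tendsto_const]) (use s in \<open>auto intro: always_eventually less_imp_le\<close>)
    have s0: "s n \<in> {0..<T}" for n using s(1,2)[of n] t[of n] by auto
    obtain q l' where q: "strict_mono (q :: nat \<Rightarrow> nat)" "(\<lambda>n. X (s (q n))) \<longlonglongrightarrow> l'" using sub[of s] s0 by blast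
    have qT: "(\<lambda>n. s (q n)) \<longlonglongrightarrow> T" using LIMSEQ_subseq_LIMSEQ[OF sT q(1)] by (simp add: o_def)
    have "\<not> l < l'" using driver_limit_point_not_less[OF t rT r(2) s0 qT q(2)] .
    moreover have "\<not> l' < l" using driver_limit_point_not_less[OF s0 qT q(2) t rT r(2)] .
    ultimately have "l' = l" by simp
    then have "(\<lambda>n. dist (X (s (q n))) l) \<longlonglongrightarrow> dist l l" using q(2) by (intro tendsto_intros) simp
    then have "e \<le> dist l l" by (rule tendsto_lowerbound) (use s in auto)
    then show False using e by simp
  qed
  then show ?thesis by (rule that)
qed

text \<open>While the gap is at least \<open>m\<close> the speed is at most 2 / m, so in the
  remaining time, at most m^2, the point moves by at most \<open>2 * m\<close>, and the driver by at
  most \<open>m\<close>. From distance more than \<open>4 * m\<close> the gap could not become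
  small. No bound on \<open>X'\<close> enters, so this works up to \<open>T\<close>.\<close>

lemma killed_distance:
  assumes k: "killed t' z" and t: "0 \<le> t" "t < t'" and m: "0 < m" "T - t \<le> m\<^sup>2"
    and osc: "\<And>s. s \<in> {t..<T} \<Longrightarrow> \<bar>X s - X t\<bar> \<le> m"
  shows "norm (g t z - of_real (X t)) \<le> 4 * m"
proof (rule ccontr)
  assume neg: "\<not> norm (g t z - of_real (X t)) \<le> 4 * m"
  have t': "t' < T" using k by (simp add: killed_def)
  define h where "h s = norm (g s z - of_real (X t))" for s
  have ge: "m \<le> norm (g s z - of_real (X s))" if s: "s \<in> {t..<t'}" and hs: "2 * m \<le> h s" for s
  proof -
    have "h s \<le> norm (g s z - of_real (X s)) + norm (of_real (X s) - complex_of_real (X t))"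
      unfolding h_def using norm_triangle_ineq[of "g s z - of_real (X s)" "of_real (X s) - of_real (X t)"] by simp
    also have "norm (of_real (X s) - complex_of_real (X t)) = \<bar>X s - X t\<bar>"
      by (metis norm_of_real of_real_diff)
    finally show ?thesis using osc[of s] s t' hs by auto
  qed
  have main: "2 * m < h s" if s: "s \<in> {t..<t'}" for s
  proof (rule ccontr)
    assume no: "\<not> 2 * m < h s"
    have al: "alive s z" using killed_alive[OF k] s by auto
    have sT: "s < T" using s t' by auto
    have cont: "continuous_on {t..s} h" unfolding h_def
      using t by (intro continuous_intros continuous_on_subset[OF g_cont[OF al sT]]) auto
    define B where "B = {r \<in> {t..s}. h r \<le> 2 * m}"
    have "closed B" unfolding B_def by (intro continuous_on_closed_Collect_le cont continuous_on_const) auto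
    moreover have "bounded B" by (rule bounded_subset[of "{t..s}"]) (auto simp: B_def)
    moreover have "B \<noteq> {}" using no s by (auto simp: B_def)
    ultimately obtain q where q: "q \<in> B" "\<And>r. r \<in> B \<Longrightarrow> q \<le> r"
      using compact_attains_inf[of B] by (auto simp: compact_eq_bounded_closed)
    have tq: "t < q" using q(1) neg m by (cases "q = t") (auto simp: B_def h_def)
    have far: "2 * m \<le> h r" if r: "r \<in> {t..q}" for r
    proof (rule continuous_ge_on_closure[of "{t..<q}" h])
      show "continuous_on (closure {t..<q}) h"
        using tq q(1) by (auto intro!: continuous_on_subset[OF cont] simp: B_def)
      show "r \<in> closure {t..<q}" using r tq by simp
      fix r assume r: "r \<in> {t..<q}"
      then show "2 * m \<le> h r" using q(1) q(2)[of r] by (force simp: B_def)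
    qed
    have "norm (g q z - g t z - (q - t) *\<^sub>R 0) \<le> 2 / m * (q - t)"
    proof (rule vector_mean_value_bound)
      fix r assume r: "r \<in> {t..q}"
      show "((\<lambda>s. g s z) has_vector_derivative 2 / (g r z - of_real (X r))) (at r within {t..q})"
        using r t q(1) by (intro has_vector_derivative_within_subset[OF g_deriv[OF al sT]]) (auto simp: B_def)
      have "m \<le> norm (g r z - of_real (X r))" using ge[OF _ far[OF r]] r q(1) s by (auto simp: B_def)
      then show "norm (2 / (g r z - of_real (X r)) - 0) \<le> 2 / m"
        using m by (simp add: norm_divide frac_le)
    qed (use tq in auto)
    also have "\<dots> \<le> 2 / m * m\<^sup>2"
      using m q(1) s t' by (intro mult_left_mono) (auto simp: B_def)
    also have "\<dots> = 2 * m" using m by (simp add: power2_eq_square)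
    finally have "norm (g q z - g t z) \<le> 2 * m" by simp
    moreover have "norm (g t z - of_real (X t)) \<le> h q + norm (g q z - g t z)"
      unfolding h_def using norm_triangle_ineq4[of "g q z - of_real (X t)" "g q z - g t z"] by simp
    ultimately show False using neg q(1) by (auto simp: B_def)
  qed
  obtain s where "t \<le> s" "s < t'" "norm (g s z - of_real (X s)) < m"
    using killed_small[OF k m(1) t(2)] by metis
  then show False using ge[of s] main[of s] by auto
qed

end

context sle_maximal
begin

text \<open>The tips converge to \<open>x1\<close>, and by \<open>killed_distance\<close> the images
  of late tips are close to the driver already at time \<open>t\<close>. Continuity of the map at
  \<open>x1\<close> transfers this to the image of \<open>x1\<close>, uniformly as \<open>t\<close>
  tends to \<open>T\<close>.\<close>

lemma collision:
  obtains l where "(X \<longlongrightarrow> l) (at_left T)" "((\<lambda>t. g t (of_real x1)) \<longlongrightarrow> of_real l) (at_left T)"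
proof -
  obtain l where l: "(X \<longlongrightarrow> l) (at_left T)" by (rule driver_limit)
  let ?y = "complex_of_real x1"
  have end1: "(trace \<longlongrightarrow> ?y) (at_left T)"
    using trace_tendsto finish by (simp add: arc_end_1 pathfinish_def)
  have "((\<lambda>t. g t ?y - of_real (X t)) \<longlongrightarrow> 0) (at_left T)"
  proof (rule tendstoI)
    fix e :: real assume e: "0 < e"
    define m where "m = e / 8"
    have m: "0 < m" "4 * m < e" using e by (auto simp: m_def)
    have "\<forall>\<^sub>F s in at_left T. dist (X s) l < m / 2" using tendstoD[OF l, of "m / 2"] m by simp
    then obtain t0 where t0: "t0 < T" "\<And>s. t0 < s \<Longrightarrow> s < T \<Longrightarrow> dist (X s) l < m / 2"
      unfolding eventually_at_left_field by blast
    define t1 where "t1 = max 0 (max t0 (T - m\<^sup>2))"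
    have t1: "t1 < T" using t0 T_pos m by (auto simp: t1_def)
    have "\<forall>\<^sub>F s in at_left T. s \<in> {t1<..<T}" using t1 by (intro eventually_at_left_real)
    then show "\<forall>\<^sub>F t in at_left T. dist (g t ?y - of_real (X t)) 0 < e"
    proof eventually_elim
      case (elim t)
      then have t: "0 \<le> t" "t < T" "t0 < t" "T - t \<le> m\<^sup>2" by (auto simp: t1_def)
      have osc: "\<bar>X s - X t\<bar> \<le> m" if "s \<in> {t..<T}" for s
      proof -
        have "dist (X s) l < m / 2" "dist (X t) l < m / 2" using t0(2)[of s] t0(2)[of t] t that by auto
        then show ?thesis unfolding dist_real_def by linarith
      qed
      have "norm (g t ?y - of_real (X t)) \<le> 4 * m"
      proof (rule tendsto_upperbound)
        have "((\<lambda>t'. g t (trace t')) \<longlongrightarrow> g t ?y) (at_left T)"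
          by (rule isCont_tendsto_compose[OF g_isCont[OF alive_Y[OF x1 t(1,2)] t(1,2)] end1])
        then show "((\<lambda>t'. norm (g t (trace t') - of_real (X t))) \<longlongrightarrow> norm (g t ?y - of_real (X t))) (at_left T)"
          by (intro tendsto_intros)
        have "\<forall>\<^sub>F s in at_left T. s \<in> {t<..<T}" using t by (intro eventually_at_left_real)
        then show "\<forall>\<^sub>F t' in at_left T. norm (g t (trace t') - of_real (X t)) \<le> 4 * m"
        proof eventually_elim
          case (elim t')
          then have "killed t' (trace t')" using trace_killed[of t'] t by auto
          then show ?case by (rule killed_distance[OF _ t(1) _ m(1) t(4) osc]) (use elim in auto)
        qed
      qed simp
      then show ?case using m by simp
    qed
  qed
  from tendsto_add[OF this tendsto_of_real[OF l]]
  have "((\<lambda>t. g t ?y) \<longlongrightarrow> of_real l) (at_left T)" by simp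
  then show ?thesis using that l by blast
qed

end

section \<open>Real rational functions\<close>

text \<open>In either target chart the derivative is, up to sign, the Wronskian divided by the
  square of a polynomial that does not vanish at \<open>z\<close>.\<close>

lemma critical_imp_wronskian_zero:
  fixes p q :: "real poly"
  defines "P \<equiv> map_poly complex_of_real p" and "Q \<equiv> map_poly complex_of_real q"
  assumes crit: "critical_at (rat_map p q) z" and nz: "\<not> (poly P z = 0 \<and> poly Q z = 0)"
  shows "poly (pderiv P * Q - P * pderiv Q) z = 0"
proof (cases "poly Q z = 0")
  case False
  have ev: "\<forall>\<^sub>F u in nhds z. poly Q u \<noteq> 0"
    by (rule eventually_nhds_in_open[THEN eventually_mono, of "{u. poly Q u \<noteq> 0}"])
      (use False in \<open>auto intro!: open_Collect_neq continuous_intros\<close>)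
  have "((\<lambda>u. the (rat_map p q (Some u))) has_field_derivative 0) (at z)"
    using crit False by (simp add: critical_at_def rat_map_def P_def Q_def)
  moreover have "\<forall>\<^sub>F u in nhds z. the (rat_map p q (Some u)) = poly P u / poly Q u"
    using ev by eventually_elim (simp add: rat_map_def P_def Q_def)
  ultimately have "((\<lambda>u. poly P u / poly Q u) has_field_derivative 0) (at z)"
    by (subst (asm) DERIV_cong_ev) auto
  moreover have "((\<lambda>u. poly P u / poly Q u) has_field_derivative
      (poly (pderiv P) z * poly Q z - poly P z * poly (pderiv Q) z) / (poly Q z * poly Q z)) (at z)"
    by (rule DERIV_divide[OF poly_DERIV poly_DERIV False])
  ultimately have "(poly (pderiv P) z * poly Q z - poly P z * poly (pderiv Q) z) / (poly Q z * poly Q z) = 0"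
    using DERIV_unique by metis
  then show ?thesis using False by simp
next
  case True
  then have Pz: "poly P z \<noteq> 0" using nz by simp
  have ev: "\<forall>\<^sub>F u in nhds z. poly P u \<noteq> 0"
    by (rule eventually_nhds_in_open[THEN eventually_mono, of "{u. poly P u \<noteq> 0}"])
      (use Pz in \<open>auto intro!: open_Collect_neq continuous_intros\<close>)
  have "((\<lambda>u. the (sphere_inverse (rat_map p q (Some u)))) has_field_derivative 0) (at z)"
    using crit True by (simp add: critical_at_def rat_map_def P_def Q_def)
  moreover have "\<forall>\<^sub>F u in nhds z. the (sphere_inverse (rat_map p q (Some u))) = poly Q u / poly P u"
    using ev by eventually_elim (simp add: rat_map_def sphere_inverse_def P_def Q_def Let_def)
  ultimately have "((\<lambda>u. poly Q u / poly P u) has_field_derivative 0) (at z)"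
    by (subst (asm) DERIV_cong_ev) auto
  moreover have "((\<lambda>u. poly Q u / poly P u) has_field_derivative
      (poly (pderiv Q) z * poly P z - poly Q z * poly (pderiv P) z) / (poly P z * poly P z)) (at z)"
    by (rule DERIV_divide[OF poly_DERIV poly_DERIV Pz])
  ultimately have "(poly (pderiv Q) z * poly P z - poly Q z * poly (pderiv P) z) / (poly P z * poly P z) = 0"
    using DERIV_unique by metis
  then show ?thesis using Pz by (simp add: mult.commute)
qed

lemma poly_complex_cnj: "poly (map_poly complex_of_real p) (cnj z) = cnj (poly (map_poly complex_of_real p) z)"
  by (induction p) (simp_all add: map_poly_pCons)

lemma poly_complex_add: "map_poly complex_of_real (p + q) = map_poly complex_of_real p + map_poly complex_of_real q"
  by (rule poly_eqI) (simp add: coeff_map_poly)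

lemma poly_complex_mult: "map_poly complex_of_real (p * q) = map_poly complex_of_real p * map_poly complex_of_real q"
  by (rule poly_eqI) (simp add: coeff_map_poly coeff_mult)

text \<open>For transferring coprimality to the complex numbers: a Bezout relation between real
  polynomials excludes a common complex root as well.\<close>

lemma euclidean_bezout:
  fixes p q :: "'a :: euclidean_ring"
  obtains a b where "(a * p + b * q) dvd p" "(a * p + b * q) dvd q"
proof -
  have "\<exists>a b. (a * p + b * q) dvd p \<and> (a * p + b * q) dvd q"
  proof (induction "euclidean_size q" arbitrary: p q rule: less_induct)
    case less
    show ?case
    proof (cases "q = 0")
      case True
      then have "(1 * p + 0 * q) dvd p \<and> (1 * p + 0 * q) dvd q" by simp
      then show ?thesis by blast
    next
      case False
      then obtain a b where ab: "(a * q + b * (p mod q)) dvd q" "(a * q + b * (p mod q)) dvd p mod q"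
        using less[of "p mod q" q] mod_size_less[of q p] by blast
      have "b * p + (a - b * (p div q)) * q = a * q + b * (p - p div q * q)"
        by (simp add: algebra_simps)
      also have "p - p div q * q = p mod q" by (rule minus_div_mult_eq_mod)
      finally have "b * p + (a - b * (p div q)) * q = a * q + b * (p mod q)" .
      then show ?thesis using ab dvd_mod_imp_dvd[OF ab(2) ab(1)] by metis
    qed
  qed
  then show ?thesis using that by blast
qed

lemma coprime_complex_no_common_root:
  fixes p q :: "real poly"
  assumes "coprime p q"
  shows "\<not> (poly (map_poly complex_of_real p) z = 0 \<and> poly (map_poly complex_of_real q) z = 0)"
proof
  assume z: "poly (map_poly complex_of_real p) z = 0 \<and> poly (map_poly complex_of_real q) z = 0"
  obtain a b where "(a * p + b * q) dvd p" "(a * p + b * q) dvd q" by (rule euclidean_bezout)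
  then have "is_unit (a * p + b * q)" using assms by (simp add: coprime_def)
  then obtain c where "1 = (a * p + b * q) * c" by (rule dvdE)
  then have "c * a * p + c * b * q = 1" by (simp add: algebra_simps)
  then have "poly (map_poly complex_of_real (c * a * p + c * b * q)) z = poly (map_poly complex_of_real 1) z"
    by simp
  then show False using z by (simp add: poly_complex_add poly_complex_mult)
qed

text \<open>The Wronskian is unchanged when a multiple of \<open>b\<close> is subtracted from
  \<open>a\<close>. Cancelling the leading term in this way gains one degree over the obvious bound
  2 d - 1.\<close>

lemma wronskian_degree:
  fixes a b :: "complex poly"
  assumes "degree a = d" "degree b = d"
  shows "degree (pderiv a * b - a * pderiv b) \<le> 2 * d - 2"
proof (cases "d = 0")
  case True
  then obtain x y where "a = [:x:]" "b = [:y:]" using assms by (metis degree_eq_zeroE)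
  then show ?thesis by (simp add: pderiv_pCons)
next
  case False
  then have "b \<noteq> 0" using assms by auto
  then have b: "lead_coeff b \<noteq> 0" by simp
  define k where "k = lead_coeff a / lead_coeff b"
  define c where "c = a - smult k b"
  have a: "a = c + smult k b" by (simp add: c_def)
  have "degree c < d"
  proof (rule degree_lessI)
    show "c \<noteq> 0 \<or> 0 < d" using False by simp
    show "\<forall>i\<ge>d. coeff c i = 0"
    proof (intro allI impI)
      fix i assume "d \<le> i"
      then show "coeff c i = 0"
        using assms b by (cases "i = d") (auto simp: c_def k_def coeff_eq_0)
    qed
  qed
  have "pderiv a * b - a * pderiv b = pderiv c * b - c * pderiv b"
    unfolding a by (simp add: pderiv_add pderiv_smult algebra_simps)
  moreover have "degree (pderiv c * b) \<le> 2 * d - 2"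
  proof (cases "degree c = 0")
    case True
    then have "pderiv c = 0" by (metis pderiv_eq_0_iff)
    then show ?thesis by simp
  next
    case False
    then show ?thesis using degree_mult_le[of "pderiv c" b] assms \<open>degree c < d\<close> by (simp add: degree_pderiv)
  qed
  moreover have "degree (c * pderiv b) \<le> 2 * d - 2"
    using degree_mult_le[of c "pderiv b"] assms \<open>degree c < d\<close> by (simp add: degree_pderiv)
  ultimately show ?thesis by (simp add: degree_diff_le)
qed

lemma (in sle_data) charge_0_iff: "charge a \<noteq> 0 \<longleftrightarrow> a \<in> S"
  by (auto simp: charge_def S_def)

lemma (in sle_data) charge_cnj: "charge (cnj a) = charge a"
proof -
  have Y: "cnj a \<in> complex_of_real ` Y \<longleftrightarrow> a \<in> complex_of_real ` Y"
    by (metis (no_types, lifting) complex_cnj_cnj complex_cnj_complex_of_real image_iff)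
  have "cnj a \<in> U \<longleftrightarrow> a \<in> U" using cnj_U by (metis complex_cnj_cnj image_eqI)
  then show ?thesis using Y by (auto simp: charge_def)
qed

text \<open>The sum is 2 \<open>card Y\<close> - 2 \<open>card U\<close>, and \<open>U\<close> has 2
  \<open>card A\<close> = \<open>card Y + 3\<close> elements.\<close>

lemma (in sle_data) sum_charge_total: "(\<Sum>a\<in>S. charge a) = - 6"
proof -
  have "complex_of_real (\<Sum>a\<in>S. charge a) = (\<Sum>a\<in>S. of_real (charge a) * 1)" by simp
  also have "\<dots> = of_real (2 * real (card Y) - 2 * real (card U))"
    unfolding sum_charge[of "\<lambda>_. 1"] by simp
  finally have "(\<Sum>a\<in>S. charge a) = 2 * real (card Y) - 2 * real (card U)" by (simp only: of_real_eq_iff)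
  moreover have "real (card Y) + 3 = 2 * real (card A)" using cardYA by linarith
  ultimately show ?thesis using cardU by simp
qed

section \<open>The charge distribution and its chain\<close>

context sle_maximal
begin

definition atoms :: "chat \<Rightarrow> real" where
  "atoms a = (case a of None \<Rightarrow> 0 | Some w \<Rightarrow> charge w)"

lemma atoms_support: "{a. atoms a \<noteq> 0} = Some ` S" "{w. atoms (Some w) \<noteq> 0} = S"
  using charge_0_iff by (auto simp: atoms_def split: option.splits)

lemma atoms_properties: "finite_atomic atoms" "cnj_symmetric atoms" "total_mass atoms = - 6"
proof -
  show "finite_atomic atoms" using finS by (simp add: finite_atomic_def atoms_support)
  show "cnj_symmetric atoms"
    by (auto simp: cnj_symmetric_def sphere_cnj_def atoms_def charge_cnj split: option.splits)
  have "total_mass atoms = (\<Sum>a\<in>Some ` S. atoms a)" by (simp only: total_mass_def atoms_support)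
  also have "\<dots> = (\<Sum>a\<in>S. charge a)" by (subst sum.reindex) (auto simp: atoms_def)
  finally show "total_mass atoms = - 6" using sum_charge_total by simp
qed

lemma times_before_eq: "times_before (ereal T) = {0..<T}"
  by (auto simp: times_before_def)

text \<open>The atom hit at the finite time \<open>T\<close> is the other endpoint \<open>x1\<close>
  of the curve, which carries charge 2.\<close>

lemma SLE0_chain_atoms: "SLE0_chain x0 atoms (ereal T) X"
  unfolding SLE0_chain_def times_before_eq
proof (intro conjI ballI allI impI)
  show "0 < ereal T" using T_pos by simp
  show "X 0 = x0" by (rule X0)
  fix t assume t: "t \<in> {0..<T}"
  show "alive t w" if "atoms (Some w) \<noteq> 0" for w
    using alive_S[of w t] that t charge_0_iff by (auto simp: atoms_def)
  have "((\<lambda>s. complex_of_real (X s)) has_vector_derivative of_real (X' t)) (at t within {0..<T})"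
    using bounded_linear.has_vector_derivative[OF bounded_linear_of_real X_deriv[OF t]] .
  moreover have "at t within {0..<T} = at t within {0..}"
    by (rule at_within_nhd[of t "{..<T}"]) (use t in auto)
  moreover have "of_real (X' t) = (\<Sum>w\<in>S. of_real (charge w) / (of_real (X t) - g t w))"
    using X'_complex[OF t] sum_charge[of "\<lambda>w. 1 / (of_real (X t) - g t w)"] by simp
  ultimately show "((\<lambda>s. complex_of_real (X s)) has_vector_derivative
      (\<Sum>w | atoms (Some w) \<noteq> 0. of_real (atoms (Some w)) / (of_real (X t) - g t w))) (at t within {0..})"
    by (simp add: atoms_support) (simp add: atoms_def)
next
  fix \<tau> assume "ereal T = ereal \<tau>"
  then have \<tau>: "\<tau> = T" by simp
  obtain l where l: "(X \<longlongrightarrow> l) (at_left T)" "((\<lambda>t. g t (of_real x1)) \<longlongrightarrow> of_real l) (at_left T)"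
    by (rule collision)
  have "atoms (Some (of_real x1)) \<noteq> 0" using x1 by (simp add: atoms_def charge_def)
  then show "\<exists>w l. atoms (Some w) \<noteq> 0 \<and> (X \<longlongrightarrow> l) (at_left \<tau>) \<and> ((\<lambda>t. g t w) \<longlongrightarrow> of_real l) (at_left \<tau>)"
    using l \<tau> by blast
qed

lemma generates_curve_trace: "generates_curve (ereal T) X trace"
  unfolding generates_curve_def times_before_eq
  using trace_continuous trace_inj hull_eq_trace by (simp add: trace_def)

lemma curve_closure: "path_image \<eta> = closure (trace ` times_before (ereal T))"
  unfolding times_before_eq trace_closure by (simp add: arc_end_1 path_image_def)

end

text \<open>With F = P + \<i> Q and H = P - \<i> Q, the Wronskian of F and H is a multiple of that
  of P and Q. The latter has degree at most 2n and vanishes at the 2n points of \<open>x\<close>, so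
  it is determined up to a constant; all the polynomial data of the locale follow from this.\<close>

lemma sle_geometry_exists:
  fixes n :: nat and x :: "real set"
  assumes n: "1 \<le> n" and x: "finite x" "card x = 2 * n" and R: "R \<in> CRR (n + 1) x"
    and curves: "real_locus_curves R \<alpha> \<eta>" and \<alpha>: "\<Union>\<alpha> = x" and L: "L \<in> \<alpha>"
    and xj: "xj \<in> x" and arc: "arc \<gamma>" "path_image \<gamma> = path_image (\<eta> L)" "pathstart \<gamma> = of_real xj"
      "pathfinish \<gamma> = of_real xk" "xk \<in> x" "\<And>s. s \<in> {0<..<1} \<Longrightarrow> 0 < Im (\<gamma> s)"
  shows "\<exists>A \<kappa> K. sle_geometry xj (x - {xj}) A \<kappa> \<gamma> xk K"
proof -
  obtain p q where pq: "q \<noteq> 0" "coprime p q" "max (degree p) (degree q) = n + 1" "R = rat_map p q"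
    using R by (auto simp: CRR_def real_rational_def)
  define P where "P = map_poly complex_of_real p"
  define Q where "Q = map_poly complex_of_real q"
  note no_root = coprime_complex_no_common_root[OF pq(2), folded P_def Q_def]
  define F where "F = P + smult \<i> Q"
  define H where "H = P - smult \<i> Q"
  have HF: "poly H z = cnj (poly F (cnj z))" for z
    by (simp add: H_def F_def P_def Q_def poly_complex_cnj)
  have PQ: "2 * poly P z = poly F z + poly H z" "2 * \<i> * poly Q z = poly F z - poly H z" for z
    by (simp_all add: F_def H_def)
  have no_root': "\<not> (poly F z = 0 \<and> poly H z = 0)" for z
    using no_root[of z] PQ[of z] by auto
  have coeffs: "coeff F i = of_real (coeff p i) + \<i> * of_real (coeff q i)"
    "coeff H i = of_real (coeff p i) - \<i> * of_real (coeff q i)" for i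
    by (simp_all add: F_def H_def P_def Q_def coeff_map_poly)
  define lc where "lc = coeff F (n + 1)"
  have top: "coeff p (n + 1) \<noteq> 0 \<or> coeff q (n + 1) \<noteq> 0"
    using pq(3) by (auto simp: max_def split: if_splits) (metis Suc_neq_Zero degree_0 leading_coeff_0_iff)+
  have high: "coeff p i = 0" "coeff q i = 0" if "n + 1 < i" for i
    using that pq(3) by (auto intro!: coeff_eq_0)
  \<comment> \<open>The top coefficients of \<open>p\<close> and \<open>q\<close> are real and not
    both 0, so they cannot cancel in P \<plusminus> \<i> Q.\<close>
  have lc0: "lc \<noteq> 0" "coeff H (n + 1) \<noteq> 0"
    using top by (auto simp: lc_def coeffs complex_eq_iff)
  have degF: "degree F = n + 1"
    using lc0 high coeffs by (intro antisym degree_le le_degree) (auto simp: lc_def)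
  have degH: "degree H = n + 1"
    using lc0 high coeffs by (intro antisym degree_le le_degree) auto
  define W where "W = pderiv P * Q - P * pderiv Q"
  have FHW: "pderiv F * H - F * pderiv H = smult (- 2 * \<i>) W"
    unfolding F_def H_def W_def
    by (simp add: pderiv_add pderiv_diff pderiv_smult algebra_simps smult_diff_right flip: smult_add_left)
  have degW: "degree W \<le> 2 * n"
  proof -
    have "degree (smult (- 2 * \<i>) W) \<le> 2 * (n + 1) - 2"
      unfolding FHW[symmetric] by (rule wronskian_degree[OF degF degH])
    then show ?thesis by simp
  qed
  have Wx: "poly W (of_real r) = 0" if r: "r \<in> x" for r
  proof -
    have "critical_point R (Some (of_real r))" using R r by (auto simp: CRR_def)
    then have "critical_at (rat_map p q) (of_real r)" by (simp add: critical_point_def pq(4))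
    then show ?thesis
      unfolding W_def P_def Q_def
      by (rule critical_imp_wronskian_zero) (use no_root in \<open>simp add: P_def Q_def\<close>)
  qed
  \<comment> \<open>Otherwise F' H = F H'. At a zero of F, where H does not vanish, the left side
    has order one less than F, the right side at least the order of F.\<close>
  have W0: "W \<noteq> 0"
  proof
    assume "W = 0"
    then have eq: "pderiv F * H = F * pderiv H" using FHW by simp
    have "F \<noteq> [:c:]" for c using degF by auto
    then obtain z where z: "poly F z = 0"
      using fundamental_theorem_of_algebra_alt[of F] by blast
    have F0: "F \<noteq> 0" using degF by auto
    have F'0: "pderiv F \<noteq> 0" using degF by (simp add: pderiv_eq_0_iff)
    have H0: "order z H = 0" using no_root'[of z] z by (simp add: order_0I)
    have "order z (pderiv F * H) = order z (pderiv F)"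
      using H0 F'0 degH by (subst order_mult) auto
    moreover have "order z F \<le> order z (F * pderiv H)"
      using degH F0 by (subst order_mult) (auto simp: pderiv_eq_0_iff)
    moreover have "order z F = Suc (order z (pderiv F))"
      using z F0 F'0 by (intro order_pderiv) (auto simp: order_root)
    ultimately show False using eq by simp
  qed
  have W_roots: "z \<in> complex_of_real ` x" if z: "poly W z = 0" for z
  proof (rule ccontr)
    assume "z \<notin> complex_of_real ` x"
    then have "card (insert z (complex_of_real ` x)) = Suc (2 * n)"
      using x by (simp add: card_image inj_on_def)
    moreover have "card (insert z (complex_of_real ` x)) \<le> card {z. poly W z = 0}"
      using Wx z by (intro card_mono poly_roots_finite W0) auto
    moreover have "card {z. poly W z = 0} \<le> degree W" by (rule card_poly_roots_bound[OF W0])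
    ultimately show False using degW by simp
  qed
  define A where "A = {z. poly F z = 0}"
  have finA: "finite A" unfolding A_def using degF by (intro poly_roots_finite) auto
  have A_nonreal: "Im a \<noteq> 0" if a: "a \<in> A" for a
  proof
    assume "Im a = 0"
    then have "cnj a = a" by (simp add: complex_eq_iff)
    then show False using HF[of a] a no_root'[of a] by (simp add: A_def)
  qed
  have A_cnj: "A \<inter> cnj ` A = {}"
  proof -
    have False if "a \<in> A" "cnj a \<in> A" for a
      using that HF[of a] no_root'[of a] by (simp add: A_def)
    then show ?thesis by fastforce
  qed
  \<comment> \<open>A double zero of F would be a zero of the Wronskian, hence one of the real
    points \<open>x\<close>, but the zeros of F are nonreal.\<close>
  have "rsquarefree F"
    unfolding rsquarefree_roots
  proof (intro allI notI)
    fix a assume a: "poly F a = 0 \<and> poly (pderiv F) a = 0"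
    then have "poly (pderiv F * H - F * pderiv H) a = 0" by simp
    then have "poly W a = 0" unfolding FHW by simp
    then have "a \<in> complex_of_real ` x" by (rule W_roots)
    then have "Im a = 0" by auto
    then show False using A_nonreal[of a] a by (simp add: A_def)
  qed
  then have Fdec: "F = smult lc (\<Prod>a\<in>A. [:- a, 1:])"
    using complex_poly_decompose_rsquarefree[of F] degF by (simp add: A_def lc_def)
  have polyF: "poly F z = lc * (\<Prod>a\<in>A. z - a)" for z
    by (subst Fdec) (simp add: poly_prod)
  have polyH: "poly H z = cnj lc * (\<Prod>a\<in>A. z - cnj a)" for z
    unfolding HF polyF by simp
  have cardA: "card A = n + 1"
  proof -
    have "degree (\<Prod>a\<in>A. [:- a, 1:]) = (\<Sum>a\<in>A. degree [:- a, 1:])"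
      by (rule degree_prod_sum_eq) auto
    then have "degree F = card A" by (subst Fdec) (use lc0 in simp)
    then show ?thesis using degF by simp
  qed
  define a where "a = (\<Prod>z\<in>A. [:- z, 1:])"
  define b where "b = (\<Prod>z\<in>A. [:- cnj z, 1:])"
  have Fa: "F = smult lc a" using Fdec by (simp add: a_def)
  have Hb: "H = smult (cnj lc) b"
    by (subst poly_eq_poly_eq_iff[symmetric], rule ext) (simp add: polyH b_def poly_prod)
  define V where "V = pderiv a * b - a * pderiv b"
  have WV: "smult (- 2 * \<i>) W = smult (lc * cnj lc) V"
    unfolding FHW[symmetric] Fa Hb V_def by (simp add: pderiv_smult smult_diff_right mult.commute)
  define k where "k = lead_coeff W"
  have k0: "k \<noteq> 0" using W0 by (simp add: k_def)
  have Wdec: "W = smult k (\<Prod>r\<in>x. [:- of_real r, 1:])"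
  proof -
    define D where "D = (\<Prod>r\<in>x. [:- complex_of_real r, 1:])"
    have lcD: "lead_coeff D = 1" unfolding D_def lead_coeff_prod by simp
    have degD: "degree D = 2 * n" unfolding D_def using x by (subst degree_prod_sum_eq) auto
    have "degree W = 2 * n"
    proof (rule antisym[OF degW])
      have "card (complex_of_real ` x) \<le> card {z. poly W z = 0}"
        using Wx by (intro card_mono poly_roots_finite W0) auto
      then show "2 * n \<le> degree W" using card_poly_roots_bound[OF W0] x by (simp add: card_image inj_on_def)
    qed
    then have cf: "coeff W (2 * n) = k" "coeff D (2 * n) = 1" using lcD degD by (simp_all add: k_def)
    have "W - smult k D = 0"
    proof (rule ccontr)
      assume ne: "W - smult k D \<noteq> 0"
      have "degree (W - smult k D) < 2 * n"
      proof (rule degree_lessI)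
        show "W - smult k D \<noteq> 0 \<or> 0 < 2 * n" using n by simp
        show "\<forall>i\<ge>2 * n. coeff (W - smult k D) i = 0"
        proof (intro allI impI)
          fix i assume "2 * n \<le> i"
          then show "coeff (W - smult k D) i = 0"
            using cf degW degD by (cases "i = 2 * n") (auto simp: coeff_eq_0)
        qed
      qed
      moreover have "card (complex_of_real ` x) \<le> card {z. poly (W - smult k D) z = 0}"
        using Wx x(1) by (intro card_mono poly_roots_finite ne) (auto simp: D_def poly_prod)
      ultimately show False using card_poly_roots_bound[OF ne] x by (simp add: card_image inj_on_def)
    qed
    then show ?thesis by (simp add: D_def)
  qed
  \<comment> \<open>Obtained by comparing W = k times the monic polynomial of \<open>x\<close> with
    -2 \<i> W = |lc|^2 V.\<close>
  define \<kappa> where "\<kappa> = lc * cnj lc / (- 2 * \<i> * k)"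
  have \<kappa>: "\<kappa> \<noteq> 0" using lc0 k0 by (simp add: \<kappa>_def)
  have WVz: "(\<Prod>r\<in>x. z - of_real r) = \<kappa> * poly V z" for z
  proof -
    have "- (2 * \<i> * k * (\<Prod>r\<in>x. z - of_real r)) = lc * cnj lc * poly V z"
      using arg_cong[OF WV, of "\<lambda>p. poly p z"] by (simp add: Wdec poly_prod)
    then have "2 * \<i> * k * (\<Prod>r\<in>x. z - of_real r) = - (lc * cnj lc * poly V z)"
      by (metis minus_minus)
    then show ?thesis using k0 by (simp add: \<kappa>_def field_simps)
  qed
  interpret data: sle_data xj "x - {xj}" A \<kappa>
    by unfold_locales (use x finA A_nonreal A_cnj \<kappa> cardA n xj in auto)
  define K where "K = (\<Union>M\<in>\<alpha> - {L}. path_image (\<eta> M))"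
  have fin\<alpha>: "finite \<alpha>" using \<alpha> x by (metis finite_UnionD)
  have arcs: "arc (\<eta> M)" if "M \<in> \<alpha>" for M using curves that by (simp add: real_locus_curves_def)
  have "sle_geometry xj (x - {xj}) A \<kappa> \<gamma> xk K"
  proof unfold_locales
    show "arc \<gamma>" "pathstart \<gamma> = of_real xj" "pathfinish \<gamma> = of_real xk" using arc by auto
    have "pathstart \<gamma> \<noteq> pathfinish \<gamma>" using arc_distinct_ends[OF arc(1)] by metis
    then show "xk \<in> x - {xj}" using arc by auto
    show "0 < Im (\<gamma> s)" if "s \<in> {0<..<1}" for s using arc(6)[OF that] .
    show "closed K" unfolding K_def using fin\<alpha> arcs by (intro closed_UN) (auto intro: closed_arc_image)
    show "path_image \<gamma> \<inter> K = {}"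
      using curves L unfolding K_def arc(2) real_locus_curves_def pairwise_def disjnt_def by blast
  next
    fix z assume Imz: "0 < Im z" and lev: "norm (\<Prod>a\<in>A. z - a) = norm (\<Prod>a\<in>A. z - cnj a)"
    have "norm (poly F z) = norm (poly H z)" using lev by (simp add: polyF polyH norm_mult)
    then have "(norm (poly P z + \<i> * poly Q z))\<^sup>2 = (norm (poly P z - \<i> * poly Q z))\<^sup>2"
      by (simp add: F_def H_def)
    \<comment> \<open>The difference of the two squares is 4 Im (u cnj v), so equal moduli of F and
      H mean that P / Q is real or infinite.\<close>
    moreover have "Im u * Re v = Re u * Im v" if "(norm (u + \<i> * v))\<^sup>2 = (norm (u - \<i> * v))\<^sup>2" for u v
      using that unfolding cmod_power2 by (simp add: power2_eq_square algebra_simps)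
    ultimately have ImPQ: "Im (poly P z) * Re (poly Q z) = Re (poly P z) * Im (poly Q z)"
      by blast
    have "Some z \<in> real_locus R"
    proof (cases "poly Q z = 0")
      case True
      then show ?thesis by (simp add: real_locus_def pq(4) rat_map_def Q_def real_hat_def)
    next
      case False
      have "Im (poly P z / poly Q z) = 0" using ImPQ by (simp add: Im_divide)
      then have "poly P z / poly Q z = of_real (Re (poly P z / poly Q z))" by (simp add: complex_eq_iff)
      then show ?thesis using False
        by (auto simp: real_locus_def pq(4) rat_map_def real_hat_def P_def Q_def)
    qed
    then have "Some z \<in> real_hat \<union> (\<Union>L\<in>\<alpha>. Some ` path_image (\<eta> L)) \<union> (\<Union>L\<in>\<alpha>. Some ` cnj ` path_image (\<eta> L))"
      using curves by (simp add: real_locus_curves_def)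
    moreover have "Some z \<notin> real_hat" using Imz by (auto simp: real_hat_def)
    moreover have "z \<notin> cnj ` path_image (\<eta> M)" if M: "M \<in> \<alpha>" for M
    proof
      assume "z \<in> cnj ` path_image (\<eta> M)"
      then obtain s where s: "s \<in> {0..1}" "z = cnj (\<eta> M s)" by (auto simp: path_image_def)
      have "0 \<le> Im (\<eta> M s)"
      proof (cases "s \<in> {0<..<1}")
        case True
        then show ?thesis using curves M by (auto simp: real_locus_curves_def less_imp_le)
      next
        case False
        then have "s = 0 \<or> s = 1" using s by auto
        then have "\<eta> M s \<in> complex_of_real ` M"
          using curves M by (auto simp: real_locus_curves_def pathstart_def pathfinish_def)
        then show ?thesis by auto
      qed
      then show False using s Imz by simp
    qed
    ultimately obtain M where M: "M \<in> \<alpha>" "z \<in> path_image (\<eta> M)" by blast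
    then show "z \<in> path_image \<gamma> \<union> K" unfolding K_def arc(2) by blast
  next
    fix \<zeta> assume \<zeta>: "\<zeta> \<in> data.U"
    have "poly V \<zeta> = (\<Sum>u\<in>data.U. data.sgnA u * (\<Prod>m\<in>data.U - {u}. \<zeta> - m))"
      using data.wronskian_poly[of \<zeta> "\<lambda>z. z"] by (simp add: V_def a_def b_def)
    \<comment> \<open>At a zero or pole \<open>\<zeta>\<close> every other term of the Wronskian
      contains the factor \<zeta> - \<zeta>.\<close>
    also have "\<dots> = data.sgnA \<zeta> * (\<Prod>m\<in>data.U - {\<zeta>}. \<zeta> - m)"
    proof -
      have "(\<Sum>u\<in>data.U - {\<zeta>}. data.sgnA u * (\<Prod>m\<in>data.U - {u}. \<zeta> - m)) = 0"
        using \<zeta> data.finU by (intro sum.neutral) (auto simp: prod_zero_iff)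
      then show ?thesis
        using sum.remove[OF data.finU \<zeta>, of "\<lambda>u. data.sgnA u * (\<Prod>m\<in>data.U - {u}. \<zeta> - m)"] by simp
    qed
    finally have V: "poly V \<zeta> = data.sgnA \<zeta> * (\<Prod>m\<in>data.U - {\<zeta>}. \<zeta> - m)" .
    have "(\<Prod>r\<in>x. \<zeta> - of_real r) = (\<zeta> - of_real xj) * (\<Prod>y\<in>x - {xj}. \<zeta> - of_real y)"
      using x(1) xj by (rule prod.remove)
    then show "(\<zeta> - of_real xj) * (\<Prod>y\<in>x - {xj}. \<zeta> - of_real y) = \<kappa> * data.sgnA \<zeta> * (\<Prod>l\<in>data.U - {\<zeta>}. \<zeta> - l)"
      using WVz[of \<zeta>] V by (simp add: mult.assoc)
  qed
  then show ?thesis by blast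
qed

theorem corollary2p3:
  fixes n :: nat and x :: "real set" and \<alpha> :: "real set set"
    and C :: "complex set set" and c :: "complex set" and xj :: real
  assumes "n \<ge> 1"
    and "finite x" and "card x = 2 * n"
    and "link_pattern x \<alpha>"
    and "multiple_SLE0 n x \<alpha> C"
    and "c \<in> C"
    and "xj \<in> x" and "complex_of_real xj \<in> c"
  shows "\<exists>\<rho> :: chat \<Rightarrow> real.
           finite_atomic \<rho> \<and> cnj_symmetric \<rho> \<and> total_mass \<rho> = -6 \<and>
           (\<exists>T X \<gamma>. SLE0_chain xj \<rho> T X \<and> generates_curve T X \<gamma> \<and>
                    c = closure (\<gamma> ` times_before T))"
proof -
  obtain R \<eta> where R: "R \<in> CRR (n + 1) x" "real_locus_curves R \<alpha> \<eta>" "C = (\<lambda>L. path_image (\<eta> L)) ` \<alpha>"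
    using assms(5) by (auto simp: multiple_SLE0_def)
  obtain L where L: "L \<in> \<alpha>" "c = path_image (\<eta> L)" using assms(6) R(3) by blast
  have \<alpha>: "\<Union>\<alpha> = x" using assms(4) by (simp add: link_pattern_def)
  have \<eta>: "arc (\<eta> L)" "{pathstart (\<eta> L), pathfinish (\<eta> L)} = complex_of_real ` L"
    "\<And>s. s \<in> {0<..<1} \<Longrightarrow> 0 < Im (\<eta> L s)"
    using R(2) L(1) by (auto simp: real_locus_curves_def)
  have "pathstart (\<eta> L) \<in> complex_of_real ` L" "pathfinish (\<eta> L) \<in> complex_of_real ` L"
    using \<eta>(2) by blast+
  then obtain u v where uv: "u \<in> x" "v \<in> x" "pathstart (\<eta> L) = of_real u" "pathfinish (\<eta> L) = of_real v"
    using \<alpha> L(1) by blast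
  obtain s where s: "s \<in> {0..1}" "of_real xj = \<eta> L s" using assms(8) L(2) by (auto simp: path_image_def)
  have "s \<notin> {0<..<1}" using \<eta>(3)[of s] s(2)[symmetric] by auto
  then have "s = 0 \<or> s = 1" using s(1) by auto
  then have "xj = u \<or> xj = v" using s(2) uv by (auto simp: pathstart_def pathfinish_def)
  \<comment> \<open>The parametrization of a link has no preferred orientation; it is reversed if
    \<open>xj\<close> is its final point.\<close>
  then obtain \<gamma> xk where \<gamma>: "arc \<gamma>" "path_image \<gamma> = path_image (\<eta> L)" "pathstart \<gamma> = of_real xj"
      "pathfinish \<gamma> = of_real xk" "xk \<in> x" "\<And>s. s \<in> {0<..<1} \<Longrightarrow> 0 < Im (\<gamma> s)"
  proof (elim disjE)
    assume "xj = u"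
    then show thesis using that[of "\<eta> L" v] \<eta> uv by auto
  next
    assume "xj = v"
    then show thesis using that[of "reversepath (\<eta> L)" u] \<eta> uv
      by (auto simp: arc_reversepath) (simp add: reversepath_def)
  qed
  obtain A \<kappa> K where geo: "sle_geometry xj (x - {xj}) A \<kappa> \<gamma> xk K"
    using sle_geometry_exists[OF assms(1,2,3) R(1,2) \<alpha> L(1) assms(7) \<gamma>] by blast
  obtain X X' T where "sle_maximal xj (x - {xj}) A \<kappa> \<gamma> xk K X X' T"
    using sle_geometry.maximal_exists[OF geo] by blast
  then interpret sle_maximal xj "x - {xj}" A \<kappa> \<gamma> xk K X X' T .
  have "c = closure (trace ` times_before (ereal T))" using curve_closure \<gamma>(2) L(2) by simp
  then show ?thesis using atoms_properties SLE0_chain_atoms generates_curve_trace by blast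
qed

end
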